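(* Let $\underline{T}=(T_1,\ldots,T_n)$ be a $q$-commuting contractive tuple on a Hilbert space $\mathcal{H}$, where $|q_{ij}|=1$ for all $i,j$. Then the maximal $q$-commuting piece of the standard noncommuting dilation of $\underline{T}$ is a realization of the standard $q$-commuting dilation of $\underline{T}$.
   Context: All Hilbert spaces are complex and separable. Fix $n\ge 2$ and complex numbers $(q_{ij})_{1\le i,j\le n}$ with $|q_{ij}|=1$, $q_{ii}=1$ and $q_{ji}=q_{ij}^{-1}=\overline{q_{ij}}$. A tuple $\underline{T}=(T_1,\ldots,T_n)$ of bounded operators on $\mathcal{H}$ is contractive if $\sum_i T_iT_i^*\le I$, and $q$-commuting if $T_jT_i=q_{ij}T_iT_j$ for all $i,j$. Let $\Lambda=\{1,\ldots,n\}$ and $\tilde\Lambda=\bigcup_{m\ge 0}\Lambda^m$, with $\Lambda^0=\{0\}$; for $\alpha=(\alpha_1,\ldots,\alpha_m)\in\Lambda^m$ put $\underline{T}^\alpha=T_{\alpha_1}\cdots T_{\alpha_m}$, and $\underline{T}^0=I$. Dilation: if $\mathcal{H}\subseteq\mathcal{L}$ is a closed subspace and $\underline{T},\underline{R}$ are $n$-tuples of bounded operators on $\mathcal{H},\mathcal{L}$ respectively, $\underline{R}$ is a dilation of $\underline{T}$ if $R_i^*u=T_i^*u$ for all $u\in\mathcal{H}$ and all $i$; it is minimal if $\overline{\mathrm{span}}\{\underline{R}^\alpha h:\alpha\in\tilde\Lambda,h\in\mathcal{H}\}=\mathcal{L}$. The standard noncommuting dilation of a contractive tuple $\underline T$ is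 its minimal dilation consisting of isometries with mutually orthogonal ranges (it exists and is unique up to unitary equivalence fixing $\mathcal{H}$). Maximal $q$-commuting piece: for an $n$-tuple $\underline{R}$ of bounded operators on $\mathcal{M}$, let $\mathcal{C}^q(\underline{R})$ be the collection of closed subspaces $\mathcal{N}\subseteq\mathcal{M}$ such that every $R_i^*$ leaves $\mathcal{N}$ invariant and $R_i^*R_j^*h=\overline{q_{ij}}R_j^*R_i^*h$ for all $h\in\mathcal{N}$ and all $i,j$. It is closed under arbitrary intersections and closed spans of unions, so it has a largest element $\mathcal{M}^q(\underline{R})$. The maximal $q$-commuting piece of $\underline{R}$ is the tuple $\underline{R}^q=(R_1^q,\ldots,R_n^q)$ obtained by compressing $\underline{R}$ to $\mathcal{M}^q(\underline{R})$. $q$-commuting Fock space: let $\Gamma(\mathbb{C}^n)=\bigoplus_{m\ge0}(\mathbb{C}^n)^{\otimes m}$ be the full Fock space with vacuum $\omega$, let $\{e_1,\ldots,e_n\}$ be the standard basis of $\mathbb{C}^n$, and let $V_ix=e_i\otimes x$ be the left creation operators (with $e_i\otimes\omega=e_i$). Put $\underline{V}=(V_1,\ldots,V_n)$, $\Gamma_q(\mathbb{C}^n)=(\Gamma(\mathbb{C}^n))^q(\underline{V})$, and let $S_i$ be the compression of $V_i$ to $\Gamma_q(\mathbb{C}^n)$, $\underline{S}=(S_1,\ldots,S_n)$. Let $C^*(\underline{S})$ be the unital $C^*$-algebra generated by $S_1,\ldots,S_n$. Standard $q$-commuting dilation: for a $q$-commuting contractive tuple $\underline{T}$ on $\mathcal{H}$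 there is a unique unital completely positive map $\phi:C^*(\underline{S})\to\mathcal{B}(\mathcal{H})$ with $\phi(\underline{S}^\alpha(\underline{S}^\beta)^* )=\underline{T}^\alpha(\underline{T}^\beta)^*$ for all $\alpha,\beta\in\tilde\Lambda$. Let $\pi_1:C^*(\underline{S})\to\mathcal{B}(\mathcal{H}_1)$ be its minimal Stinespring dilation: $\mathcal{H}_1\supseteq\mathcal{H}$, $\pi_1$ is a unital $*$-homomorphism, $\phi(X)=P_{\mathcal{H}}\pi_1(X)|_{\mathcal{H}}$ for all $X$, and $\overline{\mathrm{span}}\{\pi_1(X)h:X\in C^*(\underline{S}),h\in\mathcal{H}\}=\mathcal{H}_1$. The standard $q$-commuting dilation of $\underline{T}$ is $(\pi_1(S_1),\ldots,\pi_1(S_n))$; it is unique up to unitary equivalence. A tuple on a Hilbert space containing $\mathcal{H}$ is a "realization" of it if some unitary between the two dilation spaces, acting as the identity on $\mathcal{H}$, intertwines the two tuples. *)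

theory Defs
  imports "HOL-Analysis.Analysis"
begin

section \<open>Complex Hilbert spaces\<close>

text \<open>The complex inner product is conjugate-linear in its first argument. The real inner product,
  and with it norm and topology, come from \<^class>\<open>real_inner\<close> as the real part of \<open>cinner\<close>.\<close>

class complex_hilbert_space = real_inner + complete_space +
  fixes scaleC :: "complex \<Rightarrow> 'a \<Rightarrow> 'a"  (infixr \<open>*\<^sub>C\<close> 75)
    and cinner :: "'a \<Rightarrow> 'a \<Rightarrow> complex"
  assumes scaleC_add_right: "c *\<^sub>C (x + y) = c *\<^sub>C x + c *\<^sub>C y"
    and scaleC_add_left: "(c + d) *\<^sub>C x = c *\<^sub>C x + d *\<^sub>C x"
    and scaleC_scaleC: "c *\<^sub>C d *\<^sub>C x = (c * d) *\<^sub>C x"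
    and scaleC_of_real: "of_real r *\<^sub>C x = r *\<^sub>R x"
    and cinner_commute: "cinner x y = cnj (cinner y x)"
    and cinner_add_left: "cinner (x + y) z = cinner x z + cinner y z"
    and cinner_scaleC_right: "cinner x (c *\<^sub>C y) = c * cinner x y"
    and inner_eq_Re_cinner: "inner x y = Re (cinner x y)"

global_interpretation complex_vector:
  vector_space "scaleC :: complex \<Rightarrow> 'a \<Rightarrow> 'a::complex_hilbert_space"
  defines csubspace = complex_vector.subspace
    and cspan = complex_vector.span
proof
  fix x :: 'a
  show "1 *\<^sub>C x = x"
    using scaleC_of_real[of 1 x] by simp
qed (simp_all add: scaleC_add_right scaleC_add_left scaleC_scaleC)

text \<open>Hilbert spaces are closed subspaces of an ambient type, so that inclusions between them are
  literal inclusions of sets. Two Hilbert spaces \<open>L\<close> and \<open>K\<close> with a common closed subspace \<open>H\<close> may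
  always be taken in one ambient space, for instance the direct sum of \<open>H\<close> and of its orthogonal
  complements in \<open>L\<close> and in \<open>K\<close>.\<close>

definition closed_csubspace :: "'a::complex_hilbert_space set \<Rightarrow> bool" where
  "closed_csubspace M \<longleftrightarrow> csubspace M \<and> closed M"

definition separable_hilbert :: "'a::complex_hilbert_space set \<Rightarrow> bool" where
  "separable_hilbert M \<longleftrightarrow> closed_csubspace M \<and> separable_space (top_of_set M)"

definition orth_proj :: "'a::complex_hilbert_space set \<Rightarrow> 'a \<Rightarrow> 'a" where
  "orth_proj M x = (THE y. y \<in> M \<and> (\<forall>m\<in>M. cinner m (x - y) = 0))"

definition bounded_clinear :: "('a::complex_hilbert_space \<Rightarrow> 'a) \<Rightarrow> bool" where
  "bounded_clinear X \<longleftrightarrow> bounded_linear X \<and> (\<forall>c x. X (c *\<^sub>C x) = c *\<^sub>C X x)"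

text \<open>\<open>bops M\<close> is the \<open>C\<^sup>*\<close>-algebra \<open>B(M)\<close>: an operator on the closed subspace \<open>M\<close> is represented by
  its extension by zero on the orthogonal complement of \<open>M\<close>. Sums, products and adjoints are then
  those of the ambient space, and the identity operator of \<open>M\<close> is represented by \<open>orth_proj M\<close>.\<close>

definition bops :: "'a::complex_hilbert_space set \<Rightarrow> ('a \<Rightarrow> 'a) set" where
  "bops M = {X. bounded_clinear X \<and> (\<forall>x. X x \<in> M) \<and>
                (\<forall>x. (\<forall>m\<in>M. cinner m x = 0) \<longrightarrow> X x = 0)}"

definition cadjoint :: "('a::complex_hilbert_space \<Rightarrow> 'a) \<Rightarrow> 'a \<Rightarrow> 'a" where
  "cadjoint X = (THE Y. \<forall>x y. cinner (X x) y = cinner x (Y y))"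

definition compression :: "'a::complex_hilbert_space set \<Rightarrow> ('a \<Rightarrow> 'a) \<Rightarrow> 'a \<Rightarrow> 'a" where
  "compression M X = orth_proj M \<circ> X \<circ> orth_proj M"

definition unitary_between ::
  "'a::complex_hilbert_space set \<Rightarrow> 'a set \<Rightarrow> ('a \<Rightarrow> 'a) \<Rightarrow> bool" where
  "unitary_between M N U \<longleftrightarrow> U ` M = N \<and>
     (\<forall>x\<in>M. \<forall>y\<in>M. U (x + y) = U x + U y) \<and> (\<forall>c. \<forall>x\<in>M. U (c *\<^sub>C x) = c *\<^sub>C U x) \<and>
     (\<forall>x\<in>M. \<forall>y\<in>M. cinner (U x) (U y) = cinner x y)"


section \<open>Tuples of operators and dilations\<close>

text \<open>An \<open>n\<close>-tuple is indexed by a finite type \<open>'n\<close> with \<open>n\<close> elements, and multi-indices are lists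
  over \<open>'n\<close>; the empty list is the index \<open>0\<close>.\<close>

definition word_op ::
  "'a::complex_hilbert_space set \<Rightarrow> ('n \<Rightarrow> 'a \<Rightarrow> 'a) \<Rightarrow> 'n list \<Rightarrow> 'a \<Rightarrow> 'a" where
  "word_op M T \<alpha> = foldr (\<lambda>i X. T i \<circ> X) \<alpha> (orth_proj M)"

definition op_tuple ::
  "'a::complex_hilbert_space set \<Rightarrow> ('n \<Rightarrow> 'a \<Rightarrow> 'a) \<Rightarrow> bool" where
  "op_tuple M T \<longleftrightarrow> (\<forall>i. T i \<in> bops M)"

definition contractive ::
  "'a::complex_hilbert_space set \<Rightarrow> ('n::finite \<Rightarrow> 'a \<Rightarrow> 'a) \<Rightarrow> bool" where
  "contractive M T \<longleftrightarrow>
     (\<forall>h\<in>M. cinner h (h - (\<Sum>i\<in>UNIV. T i (cadjoint (T i) h))) \<in> \<real>\<^sub>\<ge>\<^sub>0)"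

definition q_coefficients :: "('n \<Rightarrow> 'n \<Rightarrow> complex) \<Rightarrow> bool" where
  "q_coefficients q \<longleftrightarrow>
     (\<forall>i j. cmod (q i j) = 1) \<and> (\<forall>i. q i i = 1) \<and> (\<forall>i j. q j i = inverse (q i j))"

definition q_commuting ::
  "('n \<Rightarrow> 'n \<Rightarrow> complex) \<Rightarrow> ('n \<Rightarrow> 'a::complex_hilbert_space \<Rightarrow> 'a) \<Rightarrow> bool" where
  "q_commuting q T \<longleftrightarrow> (\<forall>i j x. T j (T i x) = q i j *\<^sub>C T i (T j x))"

definition is_dilation :: "'a::complex_hilbert_space set \<Rightarrow> ('n \<Rightarrow> 'a \<Rightarrow> 'a) \<Rightarrow>
    'a set \<Rightarrow> ('n \<Rightarrow> 'a \<Rightarrow> 'a) \<Rightarrow> bool" where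
  "is_dilation H T L R \<longleftrightarrow> separable_hilbert L \<and> H \<subseteq> L \<and> op_tuple L R \<and>
     (\<forall>i. \<forall>u\<in>H. cadjoint (R i) u = cadjoint (T i) u)"

definition minimal_dilation :: "'a::complex_hilbert_space set \<Rightarrow> ('n \<Rightarrow> 'a \<Rightarrow> 'a) \<Rightarrow>
    'a set \<Rightarrow> ('n \<Rightarrow> 'a \<Rightarrow> 'a) \<Rightarrow> bool" where
  "minimal_dilation H T L R \<longleftrightarrow> is_dilation H T L R \<and>
     closure (cspan {word_op L R \<alpha> h | \<alpha> h. h \<in> H}) = L"

definition standard_noncommuting_dilation ::
  "'a::complex_hilbert_space set \<Rightarrow> ('n \<Rightarrow> 'a \<Rightarrow> 'a) \<Rightarrow>
    'a set \<Rightarrow> ('n \<Rightarrow> 'a \<Rightarrow> 'a) \<Rightarrow> bool" where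
  "standard_noncommuting_dilation H T L R \<longleftrightarrow> minimal_dilation H T L R \<and>
     (\<forall>i. \<forall>x\<in>L. norm (R i x) = norm x) \<and>
     (\<forall>i j. i \<noteq> j \<longrightarrow> (\<forall>x\<in>L. \<forall>y\<in>L. cinner (R i x) (R j y) = 0))"

definition q_subspaces :: "('n \<Rightarrow> 'n \<Rightarrow> complex) \<Rightarrow> 'a::complex_hilbert_space set \<Rightarrow>
    ('n \<Rightarrow> 'a \<Rightarrow> 'a) \<Rightarrow> 'a set set" where
  "q_subspaces q M R = {N. closed_csubspace N \<and> N \<subseteq> M \<and>
     (\<forall>i. \<forall>h\<in>N. cadjoint (R i) h \<in> N) \<and>
     (\<forall>i j. \<forall>h\<in>N. cadjoint (R i) (cadjoint (R j) h) =
        cnj (q i j) *\<^sub>C cadjoint (R j) (cadjoint (R i) h))}"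

definition max_q_space :: "('n \<Rightarrow> 'n \<Rightarrow> complex) \<Rightarrow> 'a::complex_hilbert_space set \<Rightarrow>
    ('n \<Rightarrow> 'a \<Rightarrow> 'a) \<Rightarrow> 'a set" where
  "max_q_space q M R = (GREATEST N. N \<in> q_subspaces q M R)"

definition max_q_piece :: "('n \<Rightarrow> 'n \<Rightarrow> complex) \<Rightarrow> 'a::complex_hilbert_space set \<Rightarrow>
    ('n \<Rightarrow> 'a \<Rightarrow> 'a) \<Rightarrow> 'n \<Rightarrow> 'a \<Rightarrow> 'a" where
  "max_q_piece q M R i = compression (max_q_space q M R) (R i)"

definition is_realization :: "'a::complex_hilbert_space set \<Rightarrow>
    'a set \<Rightarrow> ('n \<Rightarrow> 'a \<Rightarrow> 'a) \<Rightarrow> 'a set \<Rightarrow> ('n \<Rightarrow> 'a \<Rightarrow> 'a) \<Rightarrow> bool" where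
  "is_realization H M X K Q \<longleftrightarrow> H \<subseteq> M \<and> H \<subseteq> K \<and>
     (\<exists>U. unitary_between M K U \<and> (\<forall>h\<in>H. U h = h) \<and>
        (\<forall>i. \<forall>x\<in>M. U (X i x) = Q i (U x)))"


section \<open>\<open>C\<^sup>*\<close>-algebras of operators and completely positive maps\<close>

definition unital_cstar_subalgebra ::
  "'a::complex_hilbert_space set \<Rightarrow> ('a \<Rightarrow> 'a) set \<Rightarrow> bool" where
  "unital_cstar_subalgebra M A \<longleftrightarrow> A \<subseteq> bops M \<and> orth_proj M \<in> A \<and>
     (\<forall>X\<in>A. \<forall>Y\<in>A. (\<lambda>x. X x + Y x) \<in> A) \<and>
     (\<forall>c. \<forall>X\<in>A. (\<lambda>x. c *\<^sub>C X x) \<in> A) \<and>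
     (\<forall>X\<in>A. \<forall>Y\<in>A. X \<circ> Y \<in> A) \<and>
     (\<forall>X\<in>A. cadjoint X \<in> A) \<and>
     (\<forall>F X. (\<forall>k::nat. F k \<in> A) \<and> X \<in> bops M \<and>
        (\<lambda>k. onorm (\<lambda>x. F k x - X x)) \<longlonglongrightarrow> 0 \<longrightarrow> X \<in> A)"

definition generated_cstar ::
  "'a::complex_hilbert_space set \<Rightarrow> ('n \<Rightarrow> 'a \<Rightarrow> 'a) \<Rightarrow> ('a \<Rightarrow> 'a) set" where
  "generated_cstar M S = \<Inter> {A. unital_cstar_subalgebra M A \<and> range S \<subseteq> A}"

definition linear_on_ops :: "('a::complex_hilbert_space \<Rightarrow> 'a) set \<Rightarrow>
    (('a \<Rightarrow> 'a) \<Rightarrow> 'b::complex_hilbert_space \<Rightarrow> 'b) \<Rightarrow> bool" where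
  "linear_on_ops A \<phi> \<longleftrightarrow>
     (\<forall>X\<in>A. \<forall>Y\<in>A. \<phi> (\<lambda>x. X x + Y x) = (\<lambda>h. \<phi> X h + \<phi> Y h)) \<and>
     (\<forall>c. \<forall>X\<in>A. \<phi> (\<lambda>x. c *\<^sub>C X x) = (\<lambda>h. c *\<^sub>C \<phi> X h))"

text \<open>Positivity of the \<open>m \<times> m\<close> matrix \<open>X\<close> over \<open>B(M)\<close>, as an operator on the \<open>m\<close>-fold direct sum
  of \<open>M\<close>.\<close>

definition positive_matrix ::
  "'a::complex_hilbert_space set \<Rightarrow> nat \<Rightarrow> (nat \<Rightarrow> nat \<Rightarrow> 'a \<Rightarrow> 'a) \<Rightarrow> bool" where
  "positive_matrix M m X \<longleftrightarrow>
     (\<forall>h. (\<forall>i<m. h i \<in> M) \<longrightarrow> (\<Sum>i<m. \<Sum>j<m. cinner (h i) (X i j (h j))) \<in> \<real>\<^sub>\<ge>\<^sub>0)"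

definition unital_completely_positive :: "'a::complex_hilbert_space set \<Rightarrow> ('a \<Rightarrow> 'a) set \<Rightarrow>
    'b::complex_hilbert_space set \<Rightarrow> (('a \<Rightarrow> 'a) \<Rightarrow> 'b \<Rightarrow> 'b) \<Rightarrow> bool" where
  "unital_completely_positive M A H \<phi> \<longleftrightarrow>
     (\<forall>X\<in>A. \<phi> X \<in> bops H) \<and> linear_on_ops A \<phi> \<and> \<phi> (orth_proj M) = orth_proj H \<and>
     (\<forall>m X. (\<forall>i<m. \<forall>j<m. X i j \<in> A) \<and> positive_matrix M m X \<longrightarrow>
        positive_matrix H m (\<lambda>i j. \<phi> (X i j)))"

definition unital_star_hom :: "'a::complex_hilbert_space set \<Rightarrow> ('a \<Rightarrow> 'a) set \<Rightarrow>
    'b::complex_hilbert_space set \<Rightarrow> (('a \<Rightarrow> 'a) \<Rightarrow> 'b \<Rightarrow> 'b) \<Rightarrow> bool" where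
  "unital_star_hom M A K \<pi> \<longleftrightarrow>
     (\<forall>X\<in>A. \<pi> X \<in> bops K) \<and> linear_on_ops A \<pi> \<and> \<pi> (orth_proj M) = orth_proj K \<and>
     (\<forall>X\<in>A. \<forall>Y\<in>A. \<pi> (X \<circ> Y) = \<pi> X \<circ> \<pi> Y) \<and>
     (\<forall>X\<in>A. \<pi> (cadjoint X) = cadjoint (\<pi> X))"

definition minimal_stinespring :: "'a::complex_hilbert_space set \<Rightarrow> ('a \<Rightarrow> 'a) set \<Rightarrow>
    'b::complex_hilbert_space set \<Rightarrow> (('a \<Rightarrow> 'a) \<Rightarrow> 'b \<Rightarrow> 'b) \<Rightarrow>
    'b set \<Rightarrow> (('a \<Rightarrow> 'a) \<Rightarrow> 'b \<Rightarrow> 'b) \<Rightarrow> bool" where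
  "minimal_stinespring M A H \<phi> K \<pi> \<longleftrightarrow>
     separable_hilbert K \<and> H \<subseteq> K \<and> unital_star_hom M A K \<pi> \<and>
     (\<forall>X\<in>A. \<phi> X = compression H (\<pi> X)) \<and>
     closure (cspan {\<pi> X h | X h. X \<in> A \<and> h \<in> H}) = K"


section \<open>The space of square-summable families and the full Fock space\<close>

typedef 'i ell2 = "{f :: 'i \<Rightarrow> complex. (\<lambda>i. (cmod (f i))\<^sup>2) summable_on UNIV}"
  by (rule exI[of _ "\<lambda>_. 0"]) simp

setup_lifting type_definition_ell2

lemma ell2_mult_summable:
  assumes "(\<lambda>i. (cmod (f i))\<^sup>2) summable_on UNIV" "(\<lambda>i. (cmod (g i))\<^sup>2) summable_on UNIV"
  shows "(\<lambda>i. cnj (f i) * g i) summable_on UNIV"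
proof (rule Infinite_Sum.abs_summable_summable, rule Infinite_Sum.abs_summable_on_comparison_test')
  show "(\<lambda>i. (cmod (f i))\<^sup>2 + (cmod (g i))\<^sup>2) summable_on UNIV"
    using assms by (rule summable_on_add)
  show "norm (cnj (f i) * g i) \<le> (cmod (f i))\<^sup>2 + (cmod (g i))\<^sup>2" for i
  proof -
    have "0 \<le> cmod (f i) * cmod (g i)" by simp
    moreover have "2 * (cmod (f i) * cmod (g i)) \<le> (cmod (f i))\<^sup>2 + (cmod (g i))\<^sup>2"
      using sum_squares_bound[of "cmod (f i)" "cmod (g i)"] by (simp only: mult.assoc)
    ultimately have "cmod (f i) * cmod (g i) \<le> (cmod (f i))\<^sup>2 + (cmod (g i))\<^sup>2" by linarith
    then show ?thesis by (simp only: norm_mult complex_mod_cnj)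
  qed
qed

lemma ell2_add_summable:
  assumes "(\<lambda>i. (cmod (f i))\<^sup>2) summable_on UNIV" "(\<lambda>i. (cmod (g i))\<^sup>2) summable_on UNIV"
  shows "(\<lambda>i. (cmod (f i + g i))\<^sup>2) summable_on UNIV"
proof (rule summable_on_comparison_test)
  show "(\<lambda>i. 2 * ((cmod (f i))\<^sup>2 + (cmod (g i))\<^sup>2)) summable_on UNIV"
    using assms by (intro summable_on_cmult_right summable_on_add)
  show "(cmod (f i + g i))\<^sup>2 \<le> 2 * ((cmod (f i))\<^sup>2 + (cmod (g i))\<^sup>2)" for i
  proof -
    have "(cmod (f i + g i))\<^sup>2 \<le> (cmod (f i) + cmod (g i))\<^sup>2"
      by (intro power_mono norm_triangle_ineq) simp
    also have "\<dots> \<le> 2 * ((cmod (f i))\<^sup>2 + (cmod (g i))\<^sup>2)"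
      using sum_squares_bound[of "cmod (f i)" "cmod (g i)"] by (simp add: power2_sum)
    finally show ?thesis .
  qed
qed simp

lemma ell2_scale_summable:
  assumes "(\<lambda>i. (cmod (f i))\<^sup>2) summable_on UNIV"
  shows "(\<lambda>i. (cmod (c * f i))\<^sup>2) summable_on UNIV"
  using summable_on_cmult_right[OF assms, of "(cmod c)\<^sup>2"] by (simp add: norm_mult power_mult_distrib)

instantiation ell2 :: (type) real_inner
begin

lift_definition zero_ell2 :: "'a ell2" is "\<lambda>_. 0" by simp
lift_definition plus_ell2 :: "'a ell2 \<Rightarrow> 'a ell2 \<Rightarrow> 'a ell2" is "\<lambda>f g i. f i + g i"
  by (rule ell2_add_summable)
lift_definition uminus_ell2 :: "'a ell2 \<Rightarrow> 'a ell2" is "\<lambda>f i. - f i" by simp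
lift_definition minus_ell2 :: "'a ell2 \<Rightarrow> 'a ell2 \<Rightarrow> 'a ell2" is "\<lambda>f g i. f i - g i"
  by (subst diff_conv_add_uminus, rule ell2_add_summable) simp_all
lift_definition scaleR_ell2 :: "real \<Rightarrow> 'a ell2 \<Rightarrow> 'a ell2" is "\<lambda>r f i. of_real r * f i"
  by (rule ell2_scale_summable)
lift_definition inner_ell2 :: "'a ell2 \<Rightarrow> 'a ell2 \<Rightarrow> real" is
  "\<lambda>f g. Re (\<Sum>\<^sub>\<infinity>i. cnj (f i) * g i)" .

definition norm_ell2 :: "'a ell2 \<Rightarrow> real" where
  "norm_ell2 x = sqrt (inner x x)"
definition dist_ell2 :: "'a ell2 \<Rightarrow> 'a ell2 \<Rightarrow> real" where
  "dist_ell2 x y = norm (x - y)"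
definition sgn_ell2 :: "'a ell2 \<Rightarrow> 'a ell2" where
  "sgn_ell2 x = inverse (norm x) *\<^sub>R x"
definition uniformity_ell2 :: "('a ell2 \<times> 'a ell2) filter" where
  "uniformity_ell2 = (INF e\<in>{0 <..}. principal {(x, y). dist x y < e})"
definition open_ell2 :: "'a ell2 set \<Rightarrow> bool" where
  "open_ell2 U \<longleftrightarrow> (\<forall>x\<in>U. eventually (\<lambda>(x', y). x' = x \<longrightarrow> y \<in> U) uniformity)"

lemma ell2_cinner_summable: "(\<lambda>i. cnj (Rep_ell2 x i) * Rep_ell2 y i) summable_on UNIV"
  using Rep_ell2[of x] Rep_ell2[of y] by (intro ell2_mult_summable) auto

lemma inner_ell2_self: "inner x x = (\<Sum>\<^sub>\<infinity>i. (cmod (Rep_ell2 x i))\<^sup>2)" for x :: "'a ell2"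
proof -
  have "inner x x = (\<Sum>\<^sub>\<infinity>i. Re (cnj (Rep_ell2 x i) * Rep_ell2 x i))"
    by (simp only: inner_ell2.rep_eq infsum_Re ell2_cinner_summable)
  also have "\<dots> = (\<Sum>\<^sub>\<infinity>i. (cmod (Rep_ell2 x i))\<^sup>2)"
    unfolding cmod_power2 by (simp add: power2_eq_square)
  finally show ?thesis .
qed

lemma ell2_component_le_norm: "cmod (Rep_ell2 x i) \<le> norm x" for x :: "'a ell2"
proof -
  have "(\<Sum>i\<in>{i}. (cmod (Rep_ell2 x i))\<^sup>2) \<le> inner x x"
    unfolding inner_ell2_self using Rep_ell2[of x] by (intro finite_sum_le_infsum) auto
  then show ?thesis
    unfolding norm_ell2_def by (simp add: real_le_rsqrt)
qed

lemma ell2_infsum_commute: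
  "(\<Sum>\<^sub>\<infinity>i. cnj (Rep_ell2 x i) * Rep_ell2 y i) = cnj (\<Sum>\<^sub>\<infinity>i. cnj (Rep_ell2 y i) * Rep_ell2 x i)"
  by (simp add: mult.commute flip: infsum_cnj)

lemma ell2_infsum_add_left:
  "(\<Sum>\<^sub>\<infinity>i. cnj (Rep_ell2 (x + y) i) * Rep_ell2 z i) =
     (\<Sum>\<^sub>\<infinity>i. cnj (Rep_ell2 x i) * Rep_ell2 z i) + (\<Sum>\<^sub>\<infinity>i. cnj (Rep_ell2 y i) * Rep_ell2 z i)"
  by (simp add: plus_ell2.rep_eq distrib_right infsum_add ell2_cinner_summable)

lemmas ell2_rep = Rep_ell2_inject[symmetric] fun_eq_iff zero_ell2.rep_eq plus_ell2.rep_eq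
  uminus_ell2.rep_eq minus_ell2.rep_eq scaleR_ell2.rep_eq

instance
proof
  fix x y z :: "'a ell2" and r s :: real
  show "x + y + z = x + (y + z)" "x + y = y + x" "0 + x = x" "- x + x = 0" "x - y = x + - y"
    by (simp_all add: ell2_rep add_ac)
  show "r *\<^sub>R (x + y) = r *\<^sub>R x + r *\<^sub>R y" "(r + s) *\<^sub>R x = r *\<^sub>R x + s *\<^sub>R x"
    "r *\<^sub>R s *\<^sub>R x = (r * s) *\<^sub>R x" "1 *\<^sub>R x = x"
    by (simp_all add: ell2_rep algebra_simps)
  show "sgn x = inverse (norm x) *\<^sub>R x" by (fact sgn_ell2_def)
  show "dist x y = norm (x - y)" by (fact dist_ell2_def)
  show "norm x = sqrt (inner x x)" by (fact norm_ell2_def)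
  show "uniformity = (INF e\<in>{0 <..}. principal {(x, y :: 'a ell2). dist x y < e})"
    by (fact uniformity_ell2_def)
  show "open U \<longleftrightarrow> (\<forall>x\<in>U. eventually (\<lambda>(x', y). x' = x \<longrightarrow> y \<in> U) uniformity)"
    for U :: "'a ell2 set" by (fact open_ell2_def)
  show "inner x y = inner y x"
    using ell2_infsum_commute[of x y] by (simp add: inner_ell2.rep_eq)
  show "inner (x + y) z = inner x z + inner y z"
    by (simp add: inner_ell2.rep_eq ell2_infsum_add_left)
  show "inner (r *\<^sub>R x) y = r * inner x y"
    by (simp add: inner_ell2.rep_eq scaleR_ell2.rep_eq mult.assoc infsum_cmult_right')
  show "0 \<le> inner x x"
    unfolding inner_ell2_self by (rule infsum_nonneg) simp
  show "inner x x = 0 \<longleftrightarrow> x = 0"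
  proof
    assume "inner x x = 0"
    then have "cmod (Rep_ell2 x i) \<le> 0" for i
      using ell2_component_le_norm[of x i] by (simp add: norm_ell2_def)
    then show "x = 0"
      by (simp add: ell2_rep)
  next
    assume "x = 0"
    then show "inner x x = 0"
      by (simp add: inner_ell2_self zero_ell2.rep_eq)
  qed
qed

end

instantiation ell2 :: (type) complex_hilbert_space
begin

lift_definition scaleC_ell2 :: "complex \<Rightarrow> 'a ell2 \<Rightarrow> 'a ell2" is "\<lambda>c f i. c * f i"
  by (rule ell2_scale_summable)
lift_definition cinner_ell2 :: "'a ell2 \<Rightarrow> 'a ell2 \<Rightarrow> complex" is
  "\<lambda>f g. \<Sum>\<^sub>\<infinity>i. cnj (f i) * g i" .

instance
proof
  fix x y z :: "'a ell2" and c d :: complex and r :: real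
  show "c *\<^sub>C (x + y) = c *\<^sub>C x + c *\<^sub>C y" "(c + d) *\<^sub>C x = c *\<^sub>C x + d *\<^sub>C x"
    "c *\<^sub>C d *\<^sub>C x = (c * d) *\<^sub>C x" "of_real r *\<^sub>C x = r *\<^sub>R x"
    by (simp_all add: ell2_rep scaleC_ell2.rep_eq algebra_simps)
  show "inner x y = Re (cinner x y)"
    by (simp add: inner_ell2.rep_eq cinner_ell2.rep_eq)
  show "cinner x y = cnj (cinner y x)"
    unfolding cinner_ell2.rep_eq by (rule ell2_infsum_commute)
  show "cinner (x + y) z = cinner x z + cinner y z"
    unfolding cinner_ell2.rep_eq by (rule ell2_infsum_add_left)
  show "cinner x (c *\<^sub>C y) = c * cinner x y"
    by (simp add: cinner_ell2.rep_eq scaleC_ell2.rep_eq mult.left_commute infsum_cmult_right')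
next
  fix X :: "nat \<Rightarrow> 'a ell2"
  assume X: "Cauchy X"
  have dist: "dist x y = sqrt (\<Sum>\<^sub>\<infinity>i. (cmod (Rep_ell2 x i - Rep_ell2 y i))\<^sup>2)" for x y :: "'a ell2"
    by (simp add: dist_ell2_def norm_ell2_def inner_ell2_self minus_ell2.rep_eq)
  have summable: "(\<lambda>i. (cmod (Rep_ell2 x i - Rep_ell2 y i))\<^sup>2) summable_on UNIV" for x y :: "'a ell2"
    using Rep_ell2[of "x - y"] by (simp add: minus_ell2.rep_eq)
  have "Cauchy (\<lambda>n. Rep_ell2 (X n) i)" for i
  proof (rule metric_CauchyI)
    fix e :: real assume "e > 0"
    then obtain N where N: "\<forall>m\<ge>N. \<forall>n\<ge>N. dist (X m) (X n) < e"
      using X unfolding Cauchy_def by blast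
    have "dist (Rep_ell2 x i) (Rep_ell2 y i) \<le> dist x y" for x y :: "'a ell2"
      using ell2_component_le_norm[of "x - y" i]
      by (simp add: dist_ell2_def dist_norm minus_ell2.rep_eq)
    with N show "\<exists>N. \<forall>m\<ge>N. \<forall>n\<ge>N. dist (Rep_ell2 (X m) i) (Rep_ell2 (X n) i) < e"
      by (meson le_less_trans)
  qed
  then have "\<exists>l. (\<lambda>n. Rep_ell2 (X n) i) \<longlonglongrightarrow> l" for i
    by (simp add: Cauchy_convergent_iff convergent_def)
  then obtain f where f: "\<And>i. (\<lambda>n. Rep_ell2 (X n) i) \<longlonglongrightarrow> f i" by metis
  have fin: "\<exists>N. \<forall>n\<ge>N. \<forall>F. finite F \<longrightarrow> (\<Sum>i\<in>F. (cmod (Rep_ell2 (X n) i - f i))\<^sup>2) \<le> e\<^sup>2"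
    if "e > 0" for e :: real
  proof -
    obtain N where N: "\<And>m n. m \<ge> N \<Longrightarrow> n \<ge> N \<Longrightarrow> dist (X m) (X n) < e"
      using X \<open>e > 0\<close> unfolding Cauchy_def by blast
    have "(\<Sum>i\<in>F. (cmod (Rep_ell2 (X n) i - f i))\<^sup>2) \<le> e\<^sup>2" if "n \<ge> N" "finite F" for n F
    proof (rule LIMSEQ_le_const2)
      show "(\<lambda>m. \<Sum>i\<in>F. (cmod (Rep_ell2 (X n) i - Rep_ell2 (X m) i))\<^sup>2)
        \<longlonglongrightarrow> (\<Sum>i\<in>F. (cmod (Rep_ell2 (X n) i - f i))\<^sup>2)"
        by (intro tendsto_intros f)
      have "(\<Sum>i\<in>F. (cmod (Rep_ell2 (X n) i - Rep_ell2 (X m) i))\<^sup>2) \<le> e\<^sup>2" if "m \<ge> N" for m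
      proof -
        have "(\<Sum>i\<in>F. (cmod (Rep_ell2 (X n) i - Rep_ell2 (X m) i))\<^sup>2)
          \<le> (\<Sum>\<^sub>\<infinity>i. (cmod (Rep_ell2 (X n) i - Rep_ell2 (X m) i))\<^sup>2)"
          using \<open>finite F\<close> summable by (intro finite_sum_le_infsum) auto
        also have "\<dots> = (dist (X n) (X m))\<^sup>2"
          unfolding dist by (simp add: infsum_nonneg)
        also have "\<dots> \<le> e\<^sup>2"
          using N[OF \<open>n \<ge> N\<close> \<open>m \<ge> N\<close>] dist[of "X n" "X m"]
          by (intro power_mono) (auto simp: infsum_nonneg)
        finally show ?thesis .
      qed
      then show "\<exists>M. \<forall>m\<ge>M. (\<Sum>i\<in>F. (cmod (Rep_ell2 (X n) i - Rep_ell2 (X m) i))\<^sup>2) \<le> e\<^sup>2"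
        by blast
    qed
    then show ?thesis by blast
  qed
  have diff_summable: "(\<lambda>i. (cmod (Rep_ell2 (X n) i - f i))\<^sup>2) summable_on UNIV"
    if "\<forall>F. finite F \<longrightarrow> (\<Sum>i\<in>F. (cmod (Rep_ell2 (X n) i - f i))\<^sup>2) \<le> B" for n B
    using that by (intro nonneg_bdd_above_summable_on) (auto simp: bdd_above_def)
  obtain n0 where "\<forall>F. finite F \<longrightarrow> (\<Sum>i\<in>F. (cmod (Rep_ell2 (X n0) i - f i))\<^sup>2) \<le> 1\<^sup>2"
    using fin[of 1] by auto
  then have "(\<lambda>i. (cmod (Rep_ell2 (X n0) i - f i))\<^sup>2) summable_on UNIV"
    by (rule diff_summable)
  then have "(\<lambda>i. (cmod (f i - Rep_ell2 (X n0) i))\<^sup>2) summable_on UNIV"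
    by (simp add: norm_minus_commute)
  then have "(\<lambda>i. (cmod ((f i - Rep_ell2 (X n0) i) + Rep_ell2 (X n0) i))\<^sup>2) summable_on UNIV"
    using Rep_ell2[of "X n0"] by (intro ell2_add_summable) auto
  then have "(\<lambda>i. (cmod (f i))\<^sup>2) summable_on UNIV" by simp
  then obtain L where L: "Rep_ell2 L = f"
    using Abs_ell2_inverse by blast
  have "X \<longlonglongrightarrow> L"
  proof (rule metric_LIMSEQ_I)
    fix r :: real assume "r > 0"
    then obtain N where
      N: "\<forall>n\<ge>N. \<forall>F. finite F \<longrightarrow> (\<Sum>i\<in>F. (cmod (Rep_ell2 (X n) i - f i))\<^sup>2) \<le> (r/2)\<^sup>2"
      using fin[of "r/2"] by auto
    have "dist (X n) L < r" if "n \<ge> N" for n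
    proof -
      have "(\<Sum>\<^sub>\<infinity>i. (cmod (Rep_ell2 (X n) i - f i))\<^sup>2) \<le> (r/2)\<^sup>2"
        using N that diff_summable by (intro infsum_le_finite_sums) auto
      then have "dist (X n) L \<le> r / 2"
        unfolding dist L using \<open>r > 0\<close> by (intro real_le_lsqrt) simp_all
      with \<open>r > 0\<close> show ?thesis by simp
    qed
    then show "\<exists>N. \<forall>n\<ge>N. dist (X n) L < r" by blast
  qed
  then show "convergent X" by (rule convergentI)
qed

end

text \<open>The full Fock space over \<open>\<complex>\<^sup>n\<close> is \<open>'n list ell2\<close>: the \<open>m\<close>-fold tensor power of \<open>\<complex>\<^sup>n\<close> consists
  of the families supported on lists of length \<open>m\<close>, with the unit vector at \<open>[i\<^sub>1, \<dots>, i\<^sub>m]\<close> in the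
  role of \<open>e\<^bsub>i\<^sub>1\<^esub> \<otimes> \<dots> \<otimes> e\<^bsub>i\<^sub>m\<^esub>\<close>; the vacuum is the unit vector at \<open>[]\<close>. In these coordinates
  \<open>e\<^sub>i \<otimes> x\<close> is the following family.\<close>

lift_definition creation :: "'n \<Rightarrow> 'n list ell2 \<Rightarrow> 'n list ell2" is
  "\<lambda>i f w. case w of [] \<Rightarrow> 0 | j # v \<Rightarrow> if j = i then f v else 0"
proof -
  fix i :: 'n and f :: "'n list \<Rightarrow> complex"
  let ?g = "\<lambda>w. case w of [] \<Rightarrow> 0 | j # v \<Rightarrow> if j = i then f v else 0"
  assume "(\<lambda>w. (cmod (f w))\<^sup>2) summable_on UNIV"
  then have "(\<lambda>w. (cmod (?g w))\<^sup>2) \<circ> (#) i summable_on UNIV"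
    by (simp add: o_def)
  then have "(\<lambda>w. (cmod (?g w))\<^sup>2) summable_on range ((#) i)"
    by (subst summable_on_reindex) auto
  then show "(\<lambda>w. (cmod (?g w))\<^sup>2) summable_on UNIV"
    by (rule summable_on_cong_neutral[THEN iffD1, rotated -1]) (auto split: list.splits)
qed


section \<open>The standard \<open>q\<close>-commuting dilation\<close>

definition q_fock :: "('n \<Rightarrow> 'n \<Rightarrow> complex) \<Rightarrow> 'n list ell2 set" where
  "q_fock q = max_q_space q UNIV creation"

definition q_creation :: "('n \<Rightarrow> 'n \<Rightarrow> complex) \<Rightarrow> 'n \<Rightarrow> 'n list ell2 \<Rightarrow> 'n list ell2" where
  "q_creation q = max_q_piece q UNIV creation"

definition q_cstar :: "('n \<Rightarrow> 'n \<Rightarrow> complex) \<Rightarrow> ('n list ell2 \<Rightarrow> 'n list ell2) set" where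
  "q_cstar q = generated_cstar (q_fock q) (q_creation q)"

definition standard_q_dilation :: "('n \<Rightarrow> 'n \<Rightarrow> complex) \<Rightarrow>
    'a::complex_hilbert_space set \<Rightarrow> ('n \<Rightarrow> 'a \<Rightarrow> 'a) \<Rightarrow> 'a set \<Rightarrow> ('n \<Rightarrow> 'a \<Rightarrow> 'a) \<Rightarrow> bool" where
  "standard_q_dilation q H T K Q \<longleftrightarrow> (\<exists>\<phi> \<pi>.
     unital_completely_positive (q_fock q) (q_cstar q) H \<phi> \<and>
     (\<forall>\<alpha> \<beta>. \<phi> (word_op (q_fock q) (q_creation q) \<alpha> \<circ>
                 cadjoint (word_op (q_fock q) (q_creation q) \<beta>)) =
              word_op H T \<alpha> \<circ> cadjoint (word_op H T \<beta>)) \<and>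
     minimal_stinespring (q_fock q) (q_cstar q) H \<phi> K \<pi> \<and>
     (\<forall>i. Q i = \<pi> (q_creation q i)))"

end

theory Submission
  imports Defs
begin

text \<open>
  Let \<open>S\<^sub>i\<close> be the \<open>q\<close>-commuting creation operators and \<open>D = (1 + N)\<^sup>-\<^sup>1\<close>, where \<open>N\<close> is the number
  operator. Then
  \<open>S\<^sub>i\<^sup>\<star> S\<^sub>j = q\<^sub>i\<^sub>j S\<^sub>j S\<^sub>i\<^sup>\<star> (1 - D) + \<delta>\<^sub>i\<^sub>j D\<close>,
  and \<open>D\<close> is a norm limit of polynomials in the \<open>S\<^sub>i\<close> and \<open>S\<^sub>i\<^sup>\<star>\<close>. The theorem holds because both tuples,
  the maximal piece \<open>Z\<close> of \<open>R\<close> on its space \<open>M\<close> and the tuple \<open>Q\<close> on \<open>K\<close>, satisfy the relations of this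
  kind collected in \<open>fock_relations\<close>, because the adjoints of both extend those of \<open>T\<close>, and because both
  are generated by \<open>H\<close>. The relations push all adjoints to the right, down to \<open>H\<close>, so that nothing is
  left to choose.

  The relations hold for the maximal \<open>q\<close>-commuting piece \<open>Z\<close> of any isometries \<open>R\<^sub>i\<close> with orthogonal
  ranges (\<open>fock_relations_piece\<close>). Membership in the largest subspace \<open>M\<close> is coinductive: a set of
  vectors lies in \<open>M\<close> if the adjoints map it to itself and \<open>q\<close>-commute on it. This is applied to the
  sums of all insertions of the letter \<open>j\<close> into a vector of \<open>M\<close>. If the vector has exactly \<open>m\<close>
  particles, then the sum of its \<open>m + 1\<close> insertions is in \<open>M\<close> and equals \<open>(m + 1) Z\<^sub>j\<close> applied to the
  vector; the relation follows when \<open>R\<^sub>i\<^sup>\<star>\<close> strips off the first letter. On the part where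
  \<open>\<Sum>\<^sub>i R\<^sub>i R\<^sub>i\<^sup>\<star>\<close> is the identity to all orders there are infinitely many insertions, but their
  averages converge as in a law of large numbers; the limit lies in \<open>M\<close> and is \<open>Z\<^sub>j\<close> applied to the
  vector. This yields \<open>Z\<^sub>i\<^sup>\<star> Z\<^sub>j = q\<^sub>i\<^sub>j Z\<^sub>j Z\<^sub>i\<^sup>\<star>\<close> there, and in particular that \<open>Z\<^sub>j\<close> is normal there.

  The \<open>q\<close>-commuting Fock space is itself such a piece, so the \<open>S\<^sub>i\<close> satisfy the relations. Norm
  estimates survive the Stinespring representation, by complete positivity (\<open>norm_\<pi>_le\<close>), and hence
  \<open>Q\<close> satisfies the relations too (\<open>fock_relations_\<pi>\<close>).

  The unitary is obtained as a set of pairs. Starting from the diagonal of \<open>H\<close>, Zorn's lemma gives a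
  maximal isometric correspondence between subspaces of \<open>M\<close> and \<open>K\<close> that respects the adjoints of
  \<open>Z\<close> and \<open>Q\<close>. The relations express all inner products of the vectors \<open>Z\<^sub>j x\<close>, and the adjoints applied
  to them, in the same way as for \<open>Q\<^sub>j y\<close>; so the correspondence could be enlarged by the pairs
  \<open>(Z\<^sub>j x, Q\<^sub>j y)\<close>, and by maximality it contains them (\<open>ex_creation_invariant_coupling\<close>). Minimality of
  the two dilations then makes its domain \<open>M\<close> and its range \<open>K\<close>.
\<close>

section \<open>Complex inner products\<close>

lemma cinner_scaleC_left: "cinner (c *\<^sub>C x) y = cnj c * cinner x y"
  by (metis cinner_commute cinner_scaleC_right complex_cnj_mult)

lemma cinner_add_right: "cinner x (y + z) = cinner x y + cinner x z"
  by (metis cinner_add_left cinner_commute complex_cnj_add)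

lemma cinner_zero_left [simp]: "cinner 0 x = 0"
  using cinner_add_left[of 0 0 x] by simp

lemma cinner_zero_right [simp]: "cinner x 0 = 0"
  using cinner_add_right[of x 0 0] by simp

lemma cinner_minus_left: "cinner (- x) y = - cinner x y"
  using cinner_add_left[of x "- x" y] by (simp add: add_eq_0_iff)

lemma cinner_minus_right: "cinner x (- y) = - cinner x y"
  using cinner_add_right[of x y "- y"] by (simp add: add_eq_0_iff)

lemma cinner_diff_left: "cinner (x - y) z = cinner x z - cinner y z"
  using cinner_add_left[of x "- y" z] by (simp add: cinner_minus_left)

lemma cinner_diff_right: "cinner x (y - z) = cinner x y - cinner x z"
  using cinner_add_right[of x y "- z"] by (simp add: cinner_minus_right)

lemma cinner_sum_left: "cinner (\<Sum>i\<in>I. f i) y = (\<Sum>i\<in>I. cinner (f i) y)"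
  by (induction I rule: infinite_finite_induct) (simp_all add: cinner_add_left)

lemma cinner_sum_right: "cinner x (\<Sum>i\<in>I. f i) = (\<Sum>i\<in>I. cinner x (f i))"
  by (induction I rule: infinite_finite_induct) (simp_all add: cinner_add_right)

lemmas cinner_linear = cinner_add_left cinner_add_right cinner_diff_left cinner_diff_right
  cinner_scaleC_left cinner_scaleC_right cinner_sum_left cinner_sum_right

lemma cinner_self: "cinner x x = of_real ((norm x)\<^sup>2)"
proof (rule complex_eqI)
  show "Re (cinner x x) = Re (of_real ((norm x)\<^sup>2))"
    by (simp add: power2_norm_eq_inner inner_eq_Re_cinner)
  show "Im (cinner x x) = Im (of_real ((norm x)\<^sup>2))"
    using arg_cong[OF cinner_commute[of x x], of Im] by simp
qed

lemma cinner_self_eq_0: "cinner x x = 0 \<longleftrightarrow> x = 0"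
  by (simp add: cinner_self)

lemma norm_scaleC: "norm (c *\<^sub>C x) = cmod c * norm x"
proof -
  have "complex_of_real ((norm (c *\<^sub>C x))\<^sup>2) = of_real ((cmod c * norm x)\<^sup>2)"
    unfolding cinner_self[symmetric] cinner_linear
    using complex_norm_square[of c] by (simp add: cinner_self power_mult_distrib mult.assoc[symmetric]
      mult.commute)
  then have "(norm (c *\<^sub>C x))\<^sup>2 = (cmod c * norm x)\<^sup>2"
    using of_real_eq_iff by blast
  then show ?thesis by simp
qed

lemma norm_eqI_cinner: "cinner x x = cinner y y \<Longrightarrow> norm x = norm y"
  by (metis cinner_self norm_ge_zero of_real_eq_iff power2_eq_imp_eq)

text \<open>Rotating the second vector makes the inner product a nonnegative real number, where the real
  Cauchy--Schwarz inequality applies.\<close>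

lemma cinner_Cauchy_Schwarz: "cmod (cinner x y) \<le> norm x * norm y"
proof (cases "cinner x y = 0")
  case False
  define c where "c = cnj (cinner x y) / cmod (cinner x y)"
  have "cmod c = 1" using False by (simp add: c_def norm_divide)
  have "cinner x (c *\<^sub>C y) = cmod (cinner x y)"
    using False by (simp add: c_def cinner_scaleC_right complex_norm_square[symmetric]
      mult.commute power2_eq_square)
  then have "cmod (cinner x y) = inner x (c *\<^sub>C y)"
    by (simp add: inner_eq_Re_cinner)
  also have "\<dots> \<le> norm x * norm (c *\<^sub>C y)" by (rule norm_cauchy_schwarz)
  also have "\<dots> = norm x * norm y" using \<open>cmod c = 1\<close> by (simp add: norm_scaleC)
  finally show ?thesis .
qed simp

lemma scaleR_eq_scaleC: "r *\<^sub>R x = complex_of_real r *\<^sub>C x"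
  by (simp add: scaleC_of_real)

lemma bounded_linear_cinner_right: "bounded_linear (cinner x)"
proof (rule bounded_linear_intro)
  show "cinner x (r *\<^sub>R y) = r *\<^sub>R cinner x y" for r y
    by (simp add: scaleR_eq_scaleC cinner_scaleC_right scaleR_conv_of_real)
  show "norm (cinner x y) \<le> norm y * norm x" for y
    using cinner_Cauchy_Schwarz[of x y] by (simp add: mult.commute)
qed (rule cinner_add_right)

lemma bounded_linear_scaleC: "bounded_linear (\<lambda>x. c *\<^sub>C x)"
proof (rule bounded_linear_intro)
  show "c *\<^sub>C r *\<^sub>R x = r *\<^sub>R c *\<^sub>C x" for r x
    by (simp add: scaleR_eq_scaleC scaleC_scaleC mult.commute)
  show "norm (c *\<^sub>C x) \<le> norm x * cmod c" for x
    by (simp add: norm_scaleC)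
qed (rule scaleC_add_right)

lemmas tendsto_cinner_right = bounded_linear.tendsto[OF bounded_linear_cinner_right]
lemmas tendsto_scaleC = bounded_linear.tendsto[OF bounded_linear_scaleC]

lemma tendsto_cinner:
  fixes x y :: "'a::complex_hilbert_space"
  assumes "(f \<longlongrightarrow> x) F" "(g \<longlongrightarrow> y) F"
  shows "((\<lambda>n. cinner (f n) (g n)) \<longlongrightarrow> cinner x y) F"
proof -
  have "bounded_bilinear (\<lambda>x y :: 'a. cinner x y)"
  proof
    show "cinner (r *\<^sub>R x) y = r *\<^sub>R cinner x y" for r and x y :: 'a
      by (simp add: scaleR_eq_scaleC cinner_scaleC_left scaleR_conv_of_real)
    show "cinner x (r *\<^sub>R y) = r *\<^sub>R cinner x y" for r and x y :: 'a
      by (simp add: scaleR_eq_scaleC cinner_scaleC_right scaleR_conv_of_real)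
    show "\<exists>K. \<forall>x y :: 'a. norm (cinner x y) \<le> norm x * norm y * K"
      by (rule exI[of _ 1]) (simp add: cinner_Cauchy_Schwarz)
  qed (rule cinner_add_left cinner_add_right)+
  then show ?thesis using assms by (rule bounded_bilinear.tendsto)
qed

lemma eqI_cinner: "(\<And>z. cinner z x = cinner z y) \<Longrightarrow> x = y"
  by (metis cinner_diff_right cinner_self_eq_0 eq_iff_diff_eq_0)

section \<open>Orthogonal projections and adjoints\<close>

lemma closed_csubspaceD:
  assumes "closed_csubspace M"
  shows "0 \<in> M" "x \<in> M \<Longrightarrow> y \<in> M \<Longrightarrow> x + y \<in> M" "x \<in> M \<Longrightarrow> c *\<^sub>C x \<in> M"
    "x \<in> M \<Longrightarrow> y \<in> M \<Longrightarrow> x - y \<in> M" "(\<And>i. i \<in> I \<Longrightarrow> f i \<in> M) \<Longrightarrow> (\<Sum>i\<in>I. f i) \<in> M"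
    "(\<And>n::nat. X n \<in> M) \<Longrightarrow> X \<longlonglongrightarrow> x \<Longrightarrow> x \<in> M"
  using assms unfolding closed_csubspace_def
  by (auto intro: complex_vector.subspace_0 complex_vector.subspace_add complex_vector.subspace_scale
      complex_vector.subspace_diff complex_vector.subspace_sum simp: closed_sequential_limits)

lemma closed_csubspaceI:
  assumes "0 \<in> M" "\<And>x y. x \<in> M \<Longrightarrow> y \<in> M \<Longrightarrow> x + y \<in> M" "\<And>c x. x \<in> M \<Longrightarrow> c *\<^sub>C x \<in> M"
    "\<And>X x. (\<And>n::nat. X n \<in> M) \<Longrightarrow> X \<longlonglongrightarrow> x \<Longrightarrow> x \<in> M"
  shows "closed_csubspace M"
  unfolding closed_csubspace_def closed_sequential_limits
  using assms(1-3) by (intro conjI complex_vector.subspaceI allI impI; (blast intro: assms(4))?)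

lemma closed_csubspace_UNIV: "closed_csubspace UNIV"
  by (rule closed_csubspaceI) auto

text \<open>A minimising sequence for the distance from \<open>x\<close> to \<open>M\<close> is Cauchy by the parallelogram law,
  and its limit is the foot of the perpendicular.\<close>

lemma ex_orth_proj:
  assumes M: "closed_csubspace M"
  shows "\<exists>y\<in>M. \<forall>m\<in>M. cinner m (x - y) = 0"
proof -
  note sub = closed_csubspaceD[OF M]
  define d where "d = Inf ((\<lambda>m. (norm (x - m))\<^sup>2) ` M)"
  have bdd: "bdd_below ((\<lambda>m. (norm (x - m))\<^sup>2) ` M)"
    by (rule bdd_belowI[of _ 0]) auto
  have ne: "(\<lambda>m. (norm (x - m))\<^sup>2) ` M \<noteq> {}" using sub(1) by auto
  have d: "d \<le> (norm (x - m))\<^sup>2" if "m \<in> M" for m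
    unfolding d_def using bdd that by (auto intro: cInf_lower)
  have "\<exists>m\<in>M. (norm (x - m))\<^sup>2 < d + 1 / real (Suc n)" for n
    using cInf_lessD[OF ne, of "d + 1 / real (Suc n)"] by (auto simp: d_def)
  then obtain f where fM: "\<And>n. f n \<in> M" and f: "\<And>n. (norm (x - f n))\<^sup>2 < d + 1 / real (Suc n)"
    by metis
  have par: "(norm (f m - f n))\<^sup>2 \<le> 2 / real (Suc m) + 2 / real (Suc n)" for m n
  proof -
    have "(norm (f m - f n))\<^sup>2 =
        2 * (norm (x - f m))\<^sup>2 + 2 * (norm (x - f n))\<^sup>2 - 4 * (norm (x - (1/2) *\<^sub>R (f m + f n)))\<^sup>2"
      unfolding power2_norm_eq_inner by (simp add: algebra_simps inner_commute)
    moreover have "(1/2) *\<^sub>R (f m + f n) \<in> M"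
      using fM sub by (simp add: scaleR_eq_scaleC)
    ultimately show ?thesis using d[of "(1/2) *\<^sub>R (f m + f n)"] f[of m] f[of n] by simp
  qed
  have "Cauchy f"
  proof (rule metric_CauchyI)
    fix e :: real assume e: "e > 0"
    obtain N where N: "4 / e\<^sup>2 < real N" using reals_Archimedean2 by blast
    have "dist (f m) (f n) < e" if "m \<ge> N" "n \<ge> N" for m n
    proof -
      have "2 / real (Suc m) \<le> 2 / real (Suc N)" "2 / real (Suc n) \<le> 2 / real (Suc N)"
        using that by (auto intro!: divide_left_mono)
      then have "(norm (f m - f n))\<^sup>2 \<le> 4 / real (Suc N)" using par[of m n] by simp
      also have "\<dots> < e\<^sup>2"
        using N e by (simp add: divide_simps mult.commute) (smt (verit) mult_pos_pos zero_less_power2 distrib_left mult.commute mult_1 e)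
      finally show ?thesis using e by (simp add: dist_norm power2_less_imp_less)
    qed
    then show "\<exists>N. \<forall>m\<ge>N. \<forall>n\<ge>N. dist (f m) (f n) < e" by blast
  qed
  then obtain y where y: "f \<longlonglongrightarrow> y" using Cauchy_convergent convergent_def by blast
  then have yM: "y \<in> M" using fM sub(6) by blast
  have "(\<lambda>n. (norm (x - f n))\<^sup>2) \<longlonglongrightarrow> (norm (x - y))\<^sup>2" by (intro tendsto_intros y)
  moreover have "(\<lambda>n. d + 1 / real (Suc n)) \<longlonglongrightarrow> d + 0"
    by (intro tendsto_intros LIMSEQ_Suc lim_1_over_n)
  ultimately have min: "(norm (x - y))\<^sup>2 \<le> d"
    using LIMSEQ_le[of "\<lambda>n. (norm (x - f n))\<^sup>2"] f by (smt (verit))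
  have "cinner m (x - y) = 0" if m: "m \<in> M" for m
  proof (cases "m = 0")
    case False
    \<comment> \<open>The component of \<open>x - y\<close> along \<open>m\<close> could be subtracted to get closer to \<open>x\<close>.\<close>
    define c where "c = cinner m (x - y) / (norm m)\<^sup>2"
    have n0: "complex_of_real ((norm m)\<^sup>2) \<noteq> 0" using False by simp
    have "complex_of_real ((norm (x - (y + c *\<^sub>C m)))\<^sup>2) =
        cinner ((x - y) - c *\<^sub>C m) ((x - y) - c *\<^sub>C m)"
      by (simp add: cinner_self diff_diff_eq)
    also have "\<dots> = cinner (x - y) (x - y) - cnj (cinner m (x - y)) * cinner m (x - y) / (norm m)\<^sup>2"
      using n0 by (simp add: cinner_linear c_def cinner_self[of m]
        cinner_commute[of x m] cinner_commute[of y m] divide_simps) (simp add: algebra_simps)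
    also have "\<dots> = complex_of_real ((norm (x - y))\<^sup>2 - (cmod (cinner m (x - y)))\<^sup>2 / (norm m)\<^sup>2)"
      using complex_norm_square[of "cinner m (x - y)"] by (simp add: cinner_self mult.commute)
    finally have "(norm (x - (y + c *\<^sub>C m)))\<^sup>2 =
        (norm (x - y))\<^sup>2 - (cmod (cinner m (x - y)))\<^sup>2 / (norm m)\<^sup>2"
      using of_real_eq_iff by blast
    moreover have "y + c *\<^sub>C m \<in> M" using sub m yM by auto
    ultimately have "(cmod (cinner m (x - y)))\<^sup>2 / (norm m)\<^sup>2 \<le> 0"
      using d[of "y + c *\<^sub>C m"] min by simp
    then show ?thesis using False by (simp add: divide_le_0_iff)
  qed simp
  then show ?thesis using yM by blast
qed

lemma orth_proj_eqI:
  assumes "y \<in> M" "\<And>m. m \<in> M \<Longrightarrow> cinner m (x - y) = 0" "closed_csubspace M"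
  shows "orth_proj M x = y"
  unfolding orth_proj_def
proof (rule the_equality)
  fix z assume z: "z \<in> M \<and> (\<forall>m\<in>M. cinner m (x - z) = 0)"
  have "z - y \<in> M" using z assms closed_csubspaceD(4) by blast
  then have "cinner (z - y) (x - y) = 0" "cinner (z - y) (x - z) = 0" using z assms(2) by auto
  then have "cinner (z - y) (z - y) = 0" by (simp add: cinner_diff_right)
  then show "z = y" by (simp add: cinner_self_eq_0)
qed (use assms in blast)

context
  fixes M :: "'a::complex_hilbert_space set"
  assumes M: "closed_csubspace M"
begin

lemma orth_proj_in: "orth_proj M x \<in> M"
  using ex_orth_proj[OF M, of x] orth_proj_eqI[OF _ _ M] by metis

lemma cinner_orth_proj_right: "m \<in> M \<Longrightarrow> cinner m (orth_proj M x) = cinner m x"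
  using ex_orth_proj[OF M, of x] orth_proj_eqI[OF _ _ M]
  by (metis cinner_diff_right eq_iff_diff_eq_0)

lemma cinner_orth_proj_left: "m \<in> M \<Longrightarrow> cinner (orth_proj M x) m = cinner x m"
  by (metis cinner_commute cinner_orth_proj_right)

lemma orth_proj_eqI': "y \<in> M \<Longrightarrow> (\<And>m. m \<in> M \<Longrightarrow> cinner m y = cinner m x) \<Longrightarrow> orth_proj M x = y"
  by (rule orth_proj_eqI[OF _ _ M]) (simp_all add: cinner_diff_right)

lemma orth_proj_id: "x \<in> M \<Longrightarrow> orth_proj M x = x"
  by (rule orth_proj_eqI') auto

lemma orth_proj_self_adjoint: "cinner (orth_proj M x) y = cinner x (orth_proj M y)"
  by (metis cinner_orth_proj_left cinner_orth_proj_right orth_proj_in)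

lemma norm_orth_proj_le: "norm (orth_proj M x) \<le> norm x"
proof -
  have "(norm (orth_proj M x))\<^sup>2 = cmod (cinner (orth_proj M x) x)"
    by (metis cinner_orth_proj_right cinner_self norm_of_real orth_proj_in abs_of_nonneg zero_le_power2)
  also have "\<dots> \<le> norm (orth_proj M x) * norm x" by (rule cinner_Cauchy_Schwarz)
  finally have "norm (orth_proj M x) * norm (orth_proj M x) \<le> norm (orth_proj M x) * norm x"
    by (simp add: power2_eq_square)
  then show ?thesis by (cases "orth_proj M x = 0") simp_all
qed

end

lemma bounded_clinearI:
  assumes "\<And>x y. X (x + y) = X x + X y" "\<And>c x. X (c *\<^sub>C x) = c *\<^sub>C X x"
    "\<And>x. norm (X x) \<le> B * norm x"
  shows "bounded_clinear X"
  unfolding bounded_clinear_def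
  by (intro conjI allI bounded_linear_intro[of _ B])
    (simp_all add: assms scaleR_eq_scaleC mult.commute)

lemma bounded_clinearD:
  assumes "bounded_clinear X"
  shows "X (x + y) = X x + X y" "X (x - y) = X x - X y" "X 0 = 0" "X (c *\<^sub>C x) = c *\<^sub>C X x"
    "X (\<Sum>i\<in>I. f i) = (\<Sum>i\<in>I. X (f i))" "(g \<longlongrightarrow> l) F \<Longrightarrow> ((\<lambda>n. X (g n)) \<longlongrightarrow> X l) F"
    "\<exists>B\<ge>0. \<forall>x. norm (X x) \<le> B * norm x" "bounded_linear X"
proof -
  have bl: "bounded_linear X" and "linear X"
    using assms by (simp_all add: bounded_clinear_def bounded_linear.linear)
  then show "X (x + y) = X x + X y" "X (x - y) = X x - X y" "X 0 = 0"
    "X (\<Sum>i\<in>I. f i) = (\<Sum>i\<in>I. X (f i))"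
    by (simp_all add: linear_add linear_diff linear_0 linear_sum)
  show "X (c *\<^sub>C x) = c *\<^sub>C X x" using assms by (simp add: bounded_clinear_def)
  show "(g \<longlongrightarrow> l) F \<Longrightarrow> ((\<lambda>n. X (g n)) \<longlongrightarrow> X l) F"
    by (rule bounded_linear.tendsto[OF bl])
  show "\<exists>B\<ge>0. \<forall>x. norm (X x) \<le> B * norm x"
    using bounded_linear.nonneg_bounded[OF bl] by (auto simp: mult.commute)
  show "bounded_linear X" by (fact bl)
qed

lemma bounded_clinear_orth_proj:
  assumes M: "closed_csubspace M" shows "bounded_clinear (orth_proj M)"
proof (rule bounded_clinearI[of _ 1])
  show "orth_proj M (x + y) = orth_proj M x + orth_proj M y" for x y
    by (rule orth_proj_eqI'[OF M])
      (simp_all add: M orth_proj_in closed_csubspaceD(2) cinner_add_right cinner_orth_proj_right)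
  show "orth_proj M (c *\<^sub>C x) = c *\<^sub>C orth_proj M x" for c x
    by (rule orth_proj_eqI'[OF M])
      (simp_all add: M orth_proj_in closed_csubspaceD(3) cinner_scaleC_right cinner_orth_proj_right)
qed (simp add: norm_orth_proj_le[OF M])

text \<open>A nonzero functional is a multiple of the inner product with a vector orthogonal to its
  kernel.\<close>

lemma Riesz_representation:
  fixes f :: "'a::complex_hilbert_space \<Rightarrow> complex"
  assumes f: "bounded_linear f" and fC: "\<And>c x. f (c *\<^sub>C x) = c * f x"
  shows "\<exists>v. \<forall>x. f x = cinner v x"
proof (cases "\<forall>x. f x = 0")
  case True then show ?thesis by (intro exI[of _ 0]) simp
next
  case False
  then obtain x0 where x0: "f x0 \<noteq> 0" by blast
  note lin = linear_simps[OF f]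
  define N where "N = {x. f x = 0}"
  have N: "closed_csubspace N"
    unfolding N_def
  proof (rule closed_csubspaceI)
    fix X :: "nat \<Rightarrow> 'a" and x assume X: "\<And>n. X n \<in> {x. f x = 0}" "X \<longlonglongrightarrow> x"
    have "(\<lambda>n. f (X n)) \<longlonglongrightarrow> f x" using bounded_linear.tendsto[OF f X(2)] .
    then show "x \<in> {x. f x = 0}" using X(1) by (simp add: LIMSEQ_const_iff)
  qed (auto simp: lin fC)
  define z where "z = x0 - orth_proj N x0"
  have fz: "f z \<noteq> 0" using x0 orth_proj_in[OF N, of x0] by (simp add: z_def lin N_def)
  then have z0: "z \<noteq> 0" using lin by auto
  have orth: "cinner z n = 0" if "n \<in> N" for n
    using that by (simp add: z_def cinner_diff_left cinner_orth_proj_left[OF N])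
  have "f x = cinner ((cnj (f z) / (norm z)\<^sup>2) *\<^sub>C z) x" for x
  proof -
    have "x - (f x / f z) *\<^sub>C z \<in> N" using fz by (simp add: N_def lin fC)
    from orth[OF this] have "cinner z x = (f x / f z) * (norm z)\<^sup>2"
      by (simp add: cinner_linear cinner_self)
    then show ?thesis using fz z0 by (simp add: cinner_scaleC_left)
  qed
  then show ?thesis by blast
qed

lemma cadjoint_eqI:
  assumes "\<And>x y. cinner (X x) y = cinner x (Y y)"
  shows "cadjoint X = Y"
  unfolding cadjoint_def
proof (rule the_equality)
  fix Z assume "\<forall>x y. cinner (X x) y = cinner x (Z y)"
  with assms show "Z = Y" by (intro ext eqI_cinner) metis
qed (use assms in blast)

lemma cinner_cadjoint_right:
  assumes X: "bounded_clinear X"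
  shows "cinner x (cadjoint X y) = cinner (X x) y"
proof -
  have "\<exists>v. \<forall>x. cinner y (X x) = cinner v x" for y
  proof (rule Riesz_representation)
    show "bounded_linear (\<lambda>x. cinner y (X x))"
      using bounded_linear_compose[OF bounded_linear_cinner_right bounded_clinearD(8)[OF X]] .
  qed (simp add: bounded_clinearD(4)[OF X] cinner_scaleC_right)
  then obtain Y where "\<And>y x. cinner y (X x) = cinner (Y y) x" by metis
  then have Y: "cinner (X x) y = cinner x (Y y)" for x y by (metis cinner_commute)
  then have "cadjoint X = Y" by (rule cadjoint_eqI)
  then show ?thesis using Y by simp
qed

lemma cinner_cadjoint_left: "bounded_clinear X \<Longrightarrow> cinner (cadjoint X y) x = cinner y (X x)"
  by (metis cinner_cadjoint_right cinner_commute)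

lemma norm_cadjoint_le:
  assumes X: "bounded_clinear X" and B: "\<And>x. norm (X x) \<le> B * norm x" and "B \<ge> 0"
  shows "norm (cadjoint X y) \<le> B * norm y"
proof (cases "cadjoint X y = 0")
  case False
  have "(norm (cadjoint X y))\<^sup>2 = cmod (cinner (X (cadjoint X y)) y)"
    by (simp add: cinner_cadjoint_right[OF X, symmetric] cinner_self norm_power)
  also have "\<dots> \<le> norm (X (cadjoint X y)) * norm y" by (rule cinner_Cauchy_Schwarz)
  also have "\<dots> \<le> B * norm (cadjoint X y) * norm y" using B by (simp add: mult_right_mono)
  finally have "norm (cadjoint X y) * norm (cadjoint X y) \<le> norm (cadjoint X y) * (B * norm y)"
    by (simp add: power2_eq_square mult_ac)
  then show ?thesis using False by simp
qed (simp add: \<open>B \<ge> 0\<close>)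

lemma bounded_clinear_cadjoint:
  assumes X: "bounded_clinear X" shows "bounded_clinear (cadjoint X)"
proof -
  obtain B where B: "B \<ge> 0" "\<And>x. norm (X x) \<le> B * norm x" using bounded_clinearD(7)[OF X] by blast
  show ?thesis
  proof (rule bounded_clinearI)
    show "cadjoint X (x + y) = cadjoint X x + cadjoint X y" for x y
      by (rule eqI_cinner) (simp add: cinner_cadjoint_right[OF X] cinner_add_right)
    show "cadjoint X (c *\<^sub>C x) = c *\<^sub>C cadjoint X x" for c x
      by (rule eqI_cinner) (simp add: cinner_cadjoint_right[OF X] cinner_scaleC_right)
    show "norm (cadjoint X x) \<le> B * norm x" for x
      by (rule norm_cadjoint_le[OF X B(2,1)])
  qed
qed

lemma cadjoint_cadjoint: "bounded_clinear X \<Longrightarrow> cadjoint (cadjoint X) = X"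
  by (rule cadjoint_eqI) (rule cinner_cadjoint_left)

lemma bounded_clinear_comp:
  assumes "bounded_clinear X" "bounded_clinear Y" shows "bounded_clinear (X \<circ> Y)"
proof -
  have "bounded_linear (\<lambda>x. X (Y x))"
    using assms by (intro bounded_linear_compose[of X Y]) (simp_all add: bounded_clinear_def)
  then show ?thesis using assms by (simp add: bounded_clinear_def o_def)
qed

lemma bounded_clinear_add:
  "bounded_clinear X \<Longrightarrow> bounded_clinear Y \<Longrightarrow> bounded_clinear (\<lambda>x. X x + Y x)"
  by (simp add: bounded_clinear_def bounded_linear_add scaleC_add_right)

lemma bounded_clinear_scale:
  assumes "bounded_clinear X" shows "bounded_clinear (\<lambda>x. c *\<^sub>C X x)"
  using bounded_linear_compose[OF bounded_linear_scaleC[of c] bounded_clinearD(8)[OF assms]]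
  by (simp add: bounded_clinear_def bounded_clinearD(4)[OF assms] scaleC_scaleC mult.commute)

lemma bopsD:
  assumes "X \<in> bops M" "closed_csubspace M"
  shows "bounded_clinear X" "X x \<in> M" "X (orth_proj M x) = X x"
proof -
  show X: "bounded_clinear X" and "X x \<in> M" using assms by (auto simp: bops_def)
  have "X (x - orth_proj M x) = 0"
    using assms by (auto simp: bops_def cinner_diff_right cinner_orth_proj_right)
  then show "X (orth_proj M x) = X x" by (simp add: bounded_clinearD[OF X])
qed

lemma bopsI:
  assumes "bounded_clinear X" "\<And>x. X x \<in> M" "\<And>x. X (orth_proj M x) = X x" "closed_csubspace M"
  shows "X \<in> bops M"
proof -
  have "X x = 0" if "\<forall>m\<in>M. cinner m x = 0" for x
  proof -
    have "orth_proj M x = 0"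
      using that closed_csubspaceD(1)[OF assms(4)] by (intro orth_proj_eqI'[OF assms(4)]) auto
    then show ?thesis using assms(3)[of x] bounded_clinearD(3)[OF assms(1)] by simp
  qed
  then show ?thesis using assms by (simp add: bops_def)
qed

context
  fixes M :: "'a::complex_hilbert_space set"
  assumes M: "closed_csubspace M"
begin

lemma orth_proj_bops: "orth_proj M \<in> bops M"
  by (rule bopsI) (auto simp: M bounded_clinear_orth_proj orth_proj_in orth_proj_id)

lemma cadjoint_orth_proj: "cadjoint (orth_proj M) = orth_proj M"
  by (rule cadjoint_eqI) (rule orth_proj_self_adjoint[OF M])

lemma bops_cadjoint: "X \<in> bops M \<Longrightarrow> cadjoint X \<in> bops M"
proof (rule bopsI)
  assume X: "X \<in> bops M"
  note bX = bopsD(1)[OF X M]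
  show "bounded_clinear (cadjoint X)" by (rule bounded_clinear_cadjoint[OF bX])
  have "orth_proj M (cadjoint X x) = cadjoint X x" for x
    by (rule eqI_cinner)
      (simp add: orth_proj_self_adjoint[OF M, symmetric] cinner_cadjoint_right[OF bX] bopsD(3)[OF X M])
  then show "cadjoint X x \<in> M" for x using orth_proj_in[OF M] by metis
  show "cadjoint X (orth_proj M x) = cadjoint X x" for x
    by (rule eqI_cinner)
      (simp add: cinner_cadjoint_right[OF bX] cinner_orth_proj_right[OF M] bopsD(2)[OF X M])
qed (rule M)

lemma bops_comp: "X \<in> bops M \<Longrightarrow> Y \<in> bops M \<Longrightarrow> X \<circ> Y \<in> bops M"
  by (rule bopsI) (auto simp: M bopsD[OF _ M] intro: bounded_clinear_comp)

lemma bops_add: "X \<in> bops M \<Longrightarrow> Y \<in> bops M \<Longrightarrow> (\<lambda>x. X x + Y x) \<in> bops M"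
  by (rule bopsI) (auto simp: M bopsD[OF _ M] closed_csubspaceD(2)[OF M] intro: bounded_clinear_add)

lemma bops_scale: "X \<in> bops M \<Longrightarrow> (\<lambda>x. c *\<^sub>C X x) \<in> bops M"
  by (rule bopsI) (auto simp: M bopsD[OF _ M] closed_csubspaceD(3)[OF M] intro: bounded_clinear_scale)

lemma compression_bops: "bounded_clinear X \<Longrightarrow> compression M X \<in> bops M"
  unfolding compression_def
  by (rule bopsI)
    (auto simp: M orth_proj_in orth_proj_id intro!: bounded_clinear_comp bounded_clinear_orth_proj)

lemma cadjoint_compression:
  "bounded_clinear X \<Longrightarrow> cadjoint (compression M X) = compression M (cadjoint X)"
  unfolding compression_def
  by (rule cadjoint_eqI) (metis comp_apply orth_proj_self_adjoint[OF M] cinner_cadjoint_right)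

lemma unital_cstar_subalgebra_bops: "unital_cstar_subalgebra M (bops M)"
  unfolding unital_cstar_subalgebra_def
  by (auto intro: orth_proj_bops bops_add bops_scale bops_comp bops_cadjoint)

end

section \<open>The maximal \<open>q\<close>-commuting piece\<close>

notation cadjoint (\<open>_\<^sup>\<star>\<close> [1000] 1000)

context
  fixes q :: "'n \<Rightarrow> 'n \<Rightarrow> complex" and L :: "'a::complex_hilbert_space set"
    and R :: "'n \<Rightarrow> 'a \<Rightarrow> 'a"
  assumes L: "closed_csubspace L" and R: "op_tuple L R"
begin

lemma adjoint_clinear: "bounded_clinear ((R i)\<^sup>\<star>)"
  using R bopsD(1)[OF _ L] by (simp add: op_tuple_def bounded_clinear_cadjoint)

lemma adjoint_mem: "(R i)\<^sup>\<star> x \<in> L"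
  using R bopsD(2)[OF bops_cadjoint[OF L] L] by (simp add: op_tuple_def)

text \<open>The largest element of \<^term>\<open>q_subspaces q L R\<close> consists of the vectors whose images under
  all words in the adjoints satisfy the \<open>q\<close>-commutation relations of the adjoints. Hence membership
  in it can be proved coinductively, without regard to closures and spans.\<close>

lemma max_q_space_coinduct:
  assumes "V \<subseteq> L" "\<And>x i. x \<in> V \<Longrightarrow> (R i)\<^sup>\<star> x \<in> V"
    "\<And>x i j. x \<in> V \<Longrightarrow> (R i)\<^sup>\<star> ((R j)\<^sup>\<star> x) = cnj (q i j) *\<^sub>C (R j)\<^sup>\<star> ((R i)\<^sup>\<star> x)"
  shows "V \<subseteq> max_q_space q L R"
    and "max_q_space q L R \<in> q_subspaces q L R"
proof -
  let ?w = "\<lambda>\<beta>. fold (\<lambda>k. (R k)\<^sup>\<star>) \<beta>"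
  define D where "D i j x = (R i)\<^sup>\<star> ((R j)\<^sup>\<star> x) - cnj (q i j) *\<^sub>C (R j)\<^sup>\<star> ((R i)\<^sup>\<star> x)" for i j x
  define W where "W = {x\<in>L. \<forall>\<beta> i j. D i j (?w \<beta> x) = 0}"
  note Rlin = bounded_clinearD[OF adjoint_clinear]
  have w: "bounded_clinear (?w \<beta>)" for \<beta>
  proof (induction \<beta>)
    case Nil
    show ?case by (rule bounded_clinearI[of _ 1]) auto
  next
    case (Cons k \<beta>)
    then show ?case using bounded_clinear_comp[OF _ adjoint_clinear[of k]] by (simp add: o_def)
  qed
  note wlin = bounded_clinearD[OF w]
  have "bounded_clinear (\<lambda>x. ((R i)\<^sup>\<star> \<circ> (R j)\<^sup>\<star>) x + (- cnj (q i j)) *\<^sub>C ((R j)\<^sup>\<star> \<circ> (R i)\<^sup>\<star>) x)" for i j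
    by (intro bounded_clinear_add bounded_clinear_scale bounded_clinear_comp adjoint_clinear)
  then have "bounded_clinear (D i j)" for i j
    by (simp add: D_def[abs_def])
  note Dlin = bounded_clinearD[OF this]
  have W_adj: "(R i)\<^sup>\<star> x \<in> W" if "x \<in> W" for i x
  proof -
    have "D k j (?w (i # \<beta>) x) = 0" for \<beta> k j using that unfolding W_def by blast
    then show ?thesis by (simp add: W_def adjoint_mem)
  qed
  have "closed_csubspace W"
  proof (rule closed_csubspaceI)
    fix X :: "nat \<Rightarrow> 'a" and x assume X: "\<And>n. X n \<in> W" "X \<longlonglongrightarrow> x"
    have "(\<lambda>n. D i j (?w \<beta> (X n))) \<longlonglongrightarrow> D i j (?w \<beta> x)" for i j \<beta>
      by (intro Dlin(6) wlin(6) X)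
    then have "D i j (?w \<beta> x) = 0" for i j \<beta>
      using X(1) by (simp add: W_def LIMSEQ_const_iff)
    moreover have "x \<in> L" using X closed_csubspaceD(6)[OF L, of X x] by (auto simp: W_def)
    ultimately show "x \<in> W" by (simp add: W_def)
  qed (simp_all add: W_def wlin(1,3,4) Dlin(1,3,4) closed_csubspaceD(1,2,3)[OF L])
  moreover have W_sub: "x \<in> L" if "x \<in> W" for x using that by (simp add: W_def)
  moreover have "D i j x = 0" if "x \<in> W" for i j x
  proof -
    have "D i j (?w [] x) = 0" using that unfolding W_def by blast
    then show ?thesis by simp
  qed
  ultimately have Wq: "W \<in> q_subspaces q L R"
    using W_adj unfolding q_subspaces_def D_def right_minus_eq by (blast intro: W_sub)
  have sub: "U \<subseteq> W" if "U \<subseteq> L" and adj: "\<And>x i. x \<in> U \<Longrightarrow> (R i)\<^sup>\<star> x \<in> U"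
    and comm: "\<And>x i j. x \<in> U \<Longrightarrow> (R i)\<^sup>\<star> ((R j)\<^sup>\<star> x) = cnj (q i j) *\<^sub>C (R j)\<^sup>\<star> ((R i)\<^sup>\<star> x)" for U
  proof
    fix x assume "x \<in> U"
    then have "?w \<beta> x \<in> U" for \<beta>
      by (induction \<beta> arbitrary: x) (simp_all add: adj)
    then have "D i j (?w \<beta> x) = 0" for i j \<beta> unfolding D_def using comm by (metis right_minus_eq)
    then show "x \<in> W" using \<open>x \<in> U\<close> \<open>U \<subseteq> L\<close> by (auto simp: W_def)
  qed
  have "U \<subseteq> W" if "U \<in> q_subspaces q L R" for U
    using that unfolding q_subspaces_def by (intro sub) blast+
  then have "max_q_space q L R = W"
    unfolding max_q_space_def by (intro Greatest_equality Wq)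
  then show "V \<subseteq> max_q_space q L R" "max_q_space q L R \<in> q_subspaces q L R"
    using sub[OF assms] Wq by simp_all
qed

lemma max_q_space_mem: "max_q_space q L R \<in> q_subspaces q L R"
  by (rule max_q_space_coinduct(2)[of "{}"]) auto

lemma closed_csubspace_max_q_space: "closed_csubspace (max_q_space q L R)"
  and max_q_space_subset: "max_q_space q L R \<subseteq> L"
  using max_q_space_mem unfolding q_subspaces_def by blast+

lemma max_q_space_adjoint: "x \<in> max_q_space q L R \<Longrightarrow> (R i)\<^sup>\<star> x \<in> max_q_space q L R"
  and max_q_space_comm: "x \<in> max_q_space q L R \<Longrightarrow>
    (R i)\<^sup>\<star> ((R j)\<^sup>\<star> x) = cnj (q i j) *\<^sub>C (R j)\<^sup>\<star> ((R i)\<^sup>\<star> x)"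
  using max_q_space_mem unfolding q_subspaces_def by blast+

lemma max_q_spaceI:
  assumes "x \<in> L" "\<And>i. (R i)\<^sup>\<star> x \<in> max_q_space q L R"
    "\<And>i j. (R i)\<^sup>\<star> ((R j)\<^sup>\<star> x) = cnj (q i j) *\<^sub>C (R j)\<^sup>\<star> ((R i)\<^sup>\<star> x)"
  shows "x \<in> max_q_space q L R"
proof -
  have "insert x (max_q_space q L R) \<subseteq> max_q_space q L R"
  proof (rule max_q_space_coinduct)
    fix y i j assume "y \<in> insert x (max_q_space q L R)"
    then show "(R i)\<^sup>\<star> y \<in> insert x (max_q_space q L R)"
      "(R i)\<^sup>\<star> ((R j)\<^sup>\<star> y) = cnj (q i j) *\<^sub>C (R j)\<^sup>\<star> ((R i)\<^sup>\<star> y)"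
      using assms max_q_space_adjoint max_q_space_comm by blast+
  qed (use assms max_q_space_subset in blast)
  then show ?thesis by simp
qed

end

section \<open>Particle levels\<close>

text \<open>For the \<open>q\<close>-commuting creation operators, \<open>level M B m\<close> is the projection onto the vectors
  with at least \<open>m\<close> particles.\<close>

primrec level :: "'a::complex_hilbert_space set \<Rightarrow> ('n::finite \<Rightarrow> 'a \<Rightarrow> 'a) \<Rightarrow> nat \<Rightarrow> 'a \<Rightarrow> 'a" where
  "level M B 0 = orth_proj M"
| "level M B (Suc m) = (\<lambda>x. \<Sum>k\<in>UNIV. B k (level M B m ((B k)\<^sup>\<star> x)))"

text \<open>On the Fock space with number operator \<open>N\<close>, these are the partial sums of the norm convergent
  spectral expansion of \<open>(1 + N)\<^sup>-\<^sup>1\<close>.\<close>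

definition inv_number ::
  "'a::complex_hilbert_space set \<Rightarrow> ('n::finite \<Rightarrow> 'a \<Rightarrow> 'a) \<Rightarrow> nat \<Rightarrow> 'a \<Rightarrow> 'a" where
  "inv_number M B n x = (\<Sum>m<n. (1 / of_nat (Suc m)) *\<^sub>C (level M B m x - level M B (Suc m) x))"

text \<open>Adjoints lower the level by one, levels are idempotent, and the last clause is the relation
  \<open>S\<^sub>i\<^sup>\<star> S\<^sub>j = q\<^sub>i\<^sub>j S\<^sub>j S\<^sub>i\<^sup>\<star> (1 - D) + \<delta>\<^sub>i\<^sub>j D\<close> with \<open>D = (1 + N)\<^sup>-\<^sup>1\<close>, in the form of norm estimates for the
  partial sums of \<open>D\<close>. In this form each clause is about finitely many operators, so that it survives
  representations. The rate \<open>4 / (n + 1)\<close> is the one that a summation by parts yields.\<close>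

definition fock_relations ::
  "('n::finite \<Rightarrow> 'n \<Rightarrow> complex) \<Rightarrow> 'a::complex_hilbert_space set \<Rightarrow> ('n \<Rightarrow> 'a \<Rightarrow> 'a) \<Rightarrow> bool" where
  "fock_relations q M B \<longleftrightarrow> closed_csubspace M \<and> op_tuple M B \<and>
     (\<forall>m i. \<forall>x\<in>M. (B i)\<^sup>\<star> (level M B (Suc m) x) = level M B m ((B i)\<^sup>\<star> x)) \<and>
     (\<forall>m. \<forall>x\<in>M. level M B m (level M B m x) = level M B m x) \<and>
     (\<forall>n i j. \<forall>x\<in>M. norm ((B i)\<^sup>\<star> (B j x) - (q i j *\<^sub>C B j ((B i)\<^sup>\<star> (x - inv_number M B n x)) +
        (if i = j then inv_number M B n x else 0))) \<le> 4 / Suc n * norm x)"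

context
  fixes M :: "'a::complex_hilbert_space set" and B :: "'n::finite \<Rightarrow> 'a \<Rightarrow> 'a"
  assumes M: "closed_csubspace M" and B: "op_tuple M B"
begin

lemma op_tuple_clinear: "bounded_clinear (B k)"
  and op_tuple_mem: "B k x \<in> M"
  using B bopsD[OF _ M] by (simp_all add: op_tuple_def)

lemma level_bops: "level M B m \<in> bops M"
proof (induction m)
  case 0
  then show ?case by (simp add: orth_proj_bops[OF M])
next
  case (Suc m)
  have *: "B k \<circ> (level M B m \<circ> (B k)\<^sup>\<star>) \<in> bops M" for k
    using B Suc by (intro bops_comp[OF M] bops_cadjoint[OF M]) (simp_all add: op_tuple_def)
  have "(\<lambda>x. \<Sum>k\<in>I. B k (level M B m ((B k)\<^sup>\<star> x))) \<in> bops M" for I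
  proof (induction I rule: infinite_finite_induct)
    case (insert k I)
    then show ?case using bops_add[OF M *[of k]] by simp
  qed (use bops_scale[OF M *, of 0] in simp_all)
  then show ?case by simp
qed

lemmas level_clinear = bopsD(1)[OF level_bops M]
  and level_mem = bopsD(2)[OF level_bops M]

lemma inv_number_mem: "inv_number M B n x \<in> M"
  unfolding inv_number_def
  by (intro closed_csubspaceD(5)[OF M] closed_csubspaceD(3)[OF M] closed_csubspaceD(4)[OF M] level_mem)

lemma cinner_level_left:
  "x \<in> M \<Longrightarrow> y \<in> M \<Longrightarrow> cinner (level M B m x) y = cinner x (level M B m y)"
proof (induction m arbitrary: x y)
  case 0
  then show ?case by (simp add: orth_proj_id[OF M])
next
  case (Suc m)
  have adj: "(B k)\<^sup>\<star> z \<in> M" for k z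
    by (rule adjoint_mem[OF M B])
  show ?case
    by (simp add: cinner_sum_left cinner_sum_right Suc.IH[OF adj adj] op_tuple_clinear
        flip: cinner_cadjoint_right cinner_cadjoint_left)
qed

end

declare level.simps(2) [simp del]

section \<open>Isometries with orthogonal ranges\<close>

lemma q_coefficientsD:
  assumes "q_coefficients q"
  shows "q i i = 1" "cnj (q i j) = q j i" "q i j * q j i = 1" "cnj (q i j) * q i j = 1"
proof -
  have c: "cmod (q i j) = 1" "q j i = inverse (q i j)" and "q i i = 1"
    using assms unfolding q_coefficients_def by blast+
  then show "q i i = 1" by simp
  have nz: "q i j \<noteq> 0" using c(1) by auto
  have "cnj (q i j) * q i j = 1"
    using c(1) complex_norm_square[of "q i j"] by (simp add: mult.commute)
  then show "cnj (q i j) * q i j = 1" .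
  then show "cnj (q i j) = q j i" unfolding c(2) using nz by (simp add: field_simps)
  show "q i j * q j i = 1" unfolding c(2) using nz by simp
qed

locale orthogonal_isometries =
  fixes q :: "'n::finite \<Rightarrow> 'n \<Rightarrow> complex" and L :: "'a::complex_hilbert_space set"
    and R :: "'n \<Rightarrow> 'a \<Rightarrow> 'a"
  assumes q: "q_coefficients q"
    and L: "closed_csubspace L" and R: "op_tuple L R"
    and isometry: "x \<in> L \<Longrightarrow> norm (R i x) = norm x"
    and orthogonal: "i \<noteq> j \<Longrightarrow> x \<in> L \<Longrightarrow> y \<in> L \<Longrightarrow> cinner (R i x) (R j y) = 0"
begin

abbreviation "M \<equiv> max_q_space q L R"
abbreviation "Z \<equiv> max_q_piece q L R"
abbreviation "P \<equiv> orth_proj M"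

lemmas M = closed_csubspace_max_q_space[OF L R, of q]
  and M_sub = max_q_space_subset[OF L R, of q, THEN subsetD]
  and M_adj = max_q_space_adjoint[OF L R, of _ q]
  and M_comm = max_q_space_comm[OF L R, of _ q]
  and M_I = max_q_spaceI[OF L R, of _ q]
  and qD = q_coefficientsD[OF q]
  and R_clin = op_tuple_clinear[OF L R]
  and R_mem = op_tuple_mem[OF L R]
  and R_adj_clin = adjoint_clinear[OF L R]
  and R_adj_mem = adjoint_mem[OF L R]

lemmas Rlin = bounded_clinearD[OF R_clin] and Rslin = bounded_clinearD[OF R_adj_clin]
  and Plin = bounded_clinearD[OF bounded_clinear_orth_proj[OF M]]

text \<open>Isometry is polarised, with \<open>\<i> y\<close> in place of \<open>y\<close> for the imaginary part.\<close>

lemma cinner_R_R: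
  assumes "x \<in> L" "y \<in> L"
  shows "cinner (R i x) (R j y) = (if i = j then cinner x y else 0)"
proof (cases "i = j")
  case True
  have re: "inner (R j x) (R j z) = inner x z" if "z \<in> L" for z
  proof -
    have "(norm (R j (x + z)))\<^sup>2 = (norm (x + z))\<^sup>2" "(norm (R j x))\<^sup>2 = (norm x)\<^sup>2"
      "(norm (R j z))\<^sup>2 = (norm z)\<^sup>2"
      using assms that closed_csubspaceD(2)[OF L] by (simp_all add: isometry)
    then show ?thesis
      by (simp add: power2_norm_eq_inner Rlin inner_add_left inner_add_right inner_commute)
  qed
  have "cinner (R j x) (R j y) = cinner x y"
  proof (rule complex_eqI)
    show "Re (cinner (R j x) (R j y)) = Re (cinner x y)"
      using re[OF assms(2)] by (simp add: inner_eq_Re_cinner)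
    show "Im (cinner (R j x) (R j y)) = Im (cinner x y)"
      using re[of "\<i> *\<^sub>C y"] closed_csubspaceD(3)[OF L assms(2)]
      by (simp add: inner_eq_Re_cinner Rlin cinner_scaleC_right)
  qed
  then show ?thesis using True by simp
qed (simp add: orthogonal assms)

lemma Rs_R: "x \<in> L \<Longrightarrow> (R i)\<^sup>\<star> (R j x) = (if i = j then x else 0)"
proof (rule eqI_cinner)
  fix z assume x: "x \<in> L"
  have "R i z = R i (orth_proj L z)"
    using R bopsD(3)[OF _ L, of "R i" z] by (simp add: op_tuple_def)
  then show "cinner z ((R i)\<^sup>\<star> (R j x)) = cinner z (if i = j then x else 0)"
    using x by (simp add: cinner_cadjoint_right[OF R_clin] cinner_R_R orth_proj_in[OF L]
        cinner_orth_proj_left[OF L])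
qed

lemma Rs_sum_R: "(\<And>k. f k \<in> L) \<Longrightarrow> (R i)\<^sup>\<star> (\<Sum>k\<in>UNIV. R k (f k)) = f i"
  by (simp add: Rslin Rs_R)

lemma sum_R_mem: "(\<Sum>k\<in>I. R k (f k)) \<in> L"
  by (rule closed_csubspaceD(5)[OF L]) (rule R_mem)

lemma Z_clin: "bounded_clinear (Z i)" and Z_mem: "Z i x \<in> M" and Z_tuple: "op_tuple M Z"
  and Z_compression: "Z i = compression M (R i)"
proof -
  show "Z i = compression M (R i)" for i by (simp add: max_q_piece_def fun_eq_iff)
  then have *: "Z i \<in> bops M" for i using compression_bops[OF M R_clin] by simp
  then show "bounded_clinear (Z i)" "Z i x \<in> M" using bopsD[OF _ M] by auto
  show "op_tuple M Z" using * by (simp add: op_tuple_def)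
qed

lemmas Zlin = bounded_clinearD[OF Z_clin]

lemma Z_eq: "x \<in> M \<Longrightarrow> Z i x = P (R i x)"
  by (simp add: Z_compression compression_def orth_proj_id[OF M])

lemma Zs_eq: "x \<in> M \<Longrightarrow> (Z i)\<^sup>\<star> x = (R i)\<^sup>\<star> x"
  unfolding Z_compression cadjoint_compression[OF M R_clin]
  by (simp add: compression_def orth_proj_id[OF M] M_adj)

text \<open>The orthogonal complement of \<open>M\<close> is invariant under \<open>R i\<close>, since \<open>M\<close> is invariant under its
  adjoint.\<close>

lemma proj_R: "P (R i x) = Z i (P x)"
proof -
  have "P (R i x) = P (R i (P x))"
    by (rule orth_proj_eqI'[OF M])
      (simp_all add: orth_proj_in[OF M] cinner_orth_proj_right[OF M] M_adj
        flip: cinner_cadjoint_left[OF R_clin])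
  then show ?thesis by (simp add: Z_eq orth_proj_in[OF M])
qed

lemma cinner_Z: "m \<in> M \<Longrightarrow> x \<in> M \<Longrightarrow> cinner m (Z i x) = cinner ((R i)\<^sup>\<star> m) x"
  by (simp add: Z_eq cinner_orth_proj_right[OF M] cinner_cadjoint_left[OF R_clin])

lemma Z_commute:
  assumes "x \<in> M" shows "Z k (Z j x) = q j k *\<^sub>C Z j (Z k x)"
proof (rule eqI_cinner)
  fix z
  have "cinner (P z) (Z k (Z j x)) = cinner (P z) (q j k *\<^sub>C Z j (Z k x))"
    using assms by (simp add: cinner_Z Z_mem orth_proj_in[OF M] M_adj cinner_scaleC_right
        M_comm[of "P z" j k] cinner_scaleC_left)
  then show "cinner z (Z k (Z j x)) = cinner z (q j k *\<^sub>C Z j (Z k x))"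
    by (simp add: cinner_orth_proj_left[OF M] Z_mem closed_csubspaceD(3)[OF M])
qed

section \<open>Levels of the piece\<close>

abbreviation "lv \<equiv> level M Z"

lemmas lv_mem = level_mem[OF M Z_tuple]
  and lvlin = bounded_clinearD[OF level_clinear[OF M Z_tuple]]

lemma lv_0: "x \<in> M \<Longrightarrow> lv 0 x = x"
  by (simp add: orth_proj_id[OF M])


end

context orthogonal_isometries
begin

text \<open>By the coinduction principle, the level projections of \<open>R\<close> leave \<open>M\<close> invariant; hence no
  compression to \<open>M\<close> is needed in the levels of \<open>Z\<close>.\<close>

lemma lv_Suc: "x \<in> M \<Longrightarrow> lv (Suc m) x = (\<Sum>k\<in>UNIV. R k (lv m ((R k)\<^sup>\<star> x)))"
proof (induction m arbitrary: x)
  have step: "lv (Suc m) x = (\<Sum>k\<in>UNIV. R k (lv m ((R k)\<^sup>\<star> x)))"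
    if x: "x \<in> M" and comm: "\<And>i j. (R i)\<^sup>\<star> (lv m ((R j)\<^sup>\<star> x)) =
      cnj (q i j) *\<^sub>C (R j)\<^sup>\<star> (lv m ((R i)\<^sup>\<star> x))" for m x
  proof -
    let ?y = "\<Sum>k\<in>UNIV. R k (lv m ((R k)\<^sup>\<star> x))"
    have adj: "(R i)\<^sup>\<star> ?y = lv m ((R i)\<^sup>\<star> x)" for i
      by (rule Rs_sum_R) (rule M_sub[OF lv_mem])
    have "?y \<in> M"
    proof (rule M_I)
      show "(R i)\<^sup>\<star> ((R j)\<^sup>\<star> ?y) = cnj (q i j) *\<^sub>C (R j)\<^sup>\<star> ((R i)\<^sup>\<star> ?y)" for i j
        unfolding adj by (rule comm)
    qed (simp_all only: sum_R_mem adj lv_mem)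
    then have "?y = P ?y" by (simp add: orth_proj_id[OF M])
    also have "\<dots> = lv (Suc m) x"
      using x by (simp add: level.simps(2) Plin Zs_eq Z_eq lv_mem)
    finally show ?thesis by simp
  qed
  { case 0
    have low: "lv 0 ((R j)\<^sup>\<star> x) = (R j)\<^sup>\<star> x" for j
      by (rule lv_0[OF M_adj[OF 0]])
    show ?case
    proof (rule step[OF 0])
      show "(R i)\<^sup>\<star> (lv 0 ((R j)\<^sup>\<star> x)) = cnj (q i j) *\<^sub>C (R j)\<^sup>\<star> (lv 0 ((R i)\<^sup>\<star> x))" for i j
        unfolding low by (rule M_comm[OF 0])
    qed
  next
    case (Suc m)
    have adj: "(R i)\<^sup>\<star> (lv (Suc m) ((R j)\<^sup>\<star> x)) = lv m ((R i)\<^sup>\<star> ((R j)\<^sup>\<star> x))" for i j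
    proof -
      have "(R i)\<^sup>\<star> (lv (Suc m) ((R j)\<^sup>\<star> x)) =
          (R i)\<^sup>\<star> (\<Sum>k\<in>UNIV. R k (lv m ((R k)\<^sup>\<star> ((R j)\<^sup>\<star> x))))"
        by (rule arg_cong[OF Suc.IH[OF M_adj[OF Suc.prems]]])
      also have "\<dots> = lv m ((R i)\<^sup>\<star> ((R j)\<^sup>\<star> x))"
        by (rule Rs_sum_R[OF M_sub[OF lv_mem]])
      finally show ?thesis .
    qed
    show ?case
    proof (rule step[OF Suc.prems])
      fix i j
      show "(R i)\<^sup>\<star> (lv (Suc m) ((R j)\<^sup>\<star> x)) =
          cnj (q i j) *\<^sub>C (R j)\<^sup>\<star> (lv (Suc m) ((R i)\<^sup>\<star> x))"
        unfolding adj by (subst M_comm[OF Suc.prems, of i j]) (rule lvlin(4))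
    qed
  }
qed

lemma Rs_lv: "x \<in> M \<Longrightarrow> (R i)\<^sup>\<star> (lv (Suc m) x) = lv m ((R i)\<^sup>\<star> x)"
  by (simp only: lv_Suc) (rule Rs_sum_R[OF M_sub[OF lv_mem]])

lemma lv_lv: "x \<in> M \<Longrightarrow> lv p (lv m x) = lv (max p m) x"
proof (induction p arbitrary: m x)
  case 0
  show ?case using lv_0[OF lv_mem] by simp
next
  case (Suc p)
  show ?case
  proof (cases m)
    case 0
    then show ?thesis using lv_0[OF Suc.prems] by simp
  next
    case (Suc m')
    have "lv (Suc p) (lv (Suc m') x) = (\<Sum>k\<in>UNIV. R k (lv p (lv m' ((R k)\<^sup>\<star> x))))"
      using lv_Suc[OF lv_mem] Rs_lv[OF Suc.prems] by simp
    also have "\<dots> = lv (Suc (max p m')) x"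
      using lv_Suc[OF Suc.prems] Suc.IH[OF M_adj[OF Suc.prems]] by simp
    finally show ?thesis using Suc by simp
  qed
qed

lemma cinner_lv_left: "x \<in> M \<Longrightarrow> y \<in> M \<Longrightarrow> cinner (lv m x) y = cinner x (lv m y)"
  by (rule cinner_level_left[OF M Z_tuple])

lemma norm_lv_le: assumes "x \<in> M" shows "norm (lv m x) \<le> norm x"
proof (cases "lv m x = 0")
  case False
  have "cinner x (lv m x) = of_real ((norm (lv m x))\<^sup>2)"
    using cinner_lv_left[OF assms lv_mem[of m x], of m] lv_lv[OF assms, of m m]
    by (simp add: cinner_self)
  then have "(norm (lv m x))\<^sup>2 = cmod (cinner x (lv m x))"
    by (simp only: norm_of_real abs_power2)
  also have "\<dots> \<le> norm x * norm (lv m x)" by (rule cinner_Cauchy_Schwarz)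
  finally show ?thesis using False by (simp add: power2_eq_square)
qed simp

lemma norm_Z_le: assumes "x \<in> M" shows "norm (Z i x) \<le> norm x"
  using norm_orth_proj_le[OF M, of "R i x"] isometry[OF M_sub[OF assms]] by (simp add: Z_eq assms)

lemma norm_Rs_le: "norm ((R i)\<^sup>\<star> x) \<le> norm x"
proof -
  have "norm (R i x) \<le> 1 * norm x" for x
    using R bopsD(3)[OF _ L, of "R i" x] isometry[OF orth_proj_in[OF L], of i x] norm_orth_proj_le[OF L, of x]
    by (simp add: op_tuple_def)
  from norm_cadjoint_le[OF R_clin this] show ?thesis by simp
qed

section \<open>Insertions\<close>

text \<open>On the full Fock space, \<open>ins j p\<close> puts \<open>e\<^sub>j\<close> after the first \<open>p\<close> tensor factors, multiplies by
  the coefficients picked up when \<open>e\<^sub>j\<close> is moved there from the front, and vanishes on tensors with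
  fewer than \<open>p\<close> factors.\<close>

primrec ins :: "'n \<Rightarrow> nat \<Rightarrow> 'a \<Rightarrow> 'a" where
  "ins j 0 x = R j x"
| "ins j (Suc p) x = (\<Sum>k\<in>UNIV. q k j *\<^sub>C R k (ins j p ((R k)\<^sup>\<star> x)))"

lemma ins_mem: "ins j p x \<in> L"
  by (cases p) (auto intro!: R_mem closed_csubspaceD(5)[OF L] closed_csubspaceD(3)[OF L])

lemma ins_scaleC: "ins j p (c *\<^sub>C x) = c *\<^sub>C ins j p x"
proof (induction p arbitrary: x)
  case (Suc p)
  then show ?case
    by (simp add: Rslin Rlin scaleC_scaleC mult.commute complex_vector.scale_sum_right)
qed (simp add: Rlin)

lemma Rs_ins_0: "x \<in> L \<Longrightarrow> (R k)\<^sup>\<star> (ins j 0 x) = (if k = j then x else 0)"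
  by (simp add: Rs_R)

lemma Rs_ins_Suc: "(R k)\<^sup>\<star> (ins j (Suc p) x) = q k j *\<^sub>C ins j p ((R k)\<^sup>\<star> x)"
proof -
  have "ins j (Suc p) x = (\<Sum>k\<in>UNIV. R k (q k j *\<^sub>C ins j p ((R k)\<^sup>\<star> x)))"
    by (simp add: Rlin)
  then have "(R k)\<^sup>\<star> (ins j (Suc p) x) =
      (R k)\<^sup>\<star> (\<Sum>k\<in>UNIV. R k (q k j *\<^sub>C ins j p ((R k)\<^sup>\<star> x)))"
    by (rule arg_cong)
  also have "\<dots> = q k j *\<^sub>C ins j p ((R k)\<^sup>\<star> x)"
    by (rule Rs_sum_R[where f = "\<lambda>k. q k j *\<^sub>C ins j p ((R k)\<^sup>\<star> x)" and i = k])
      (rule closed_csubspaceD(3)[OF L ins_mem])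
  finally show ?thesis .
qed

text \<open>After projection to \<open>M\<close> the inserted letter can be moved back to the front, which cancels the
  coefficients; all insertions become equal, up to the level that makes them possible.\<close>

lemma proj_ins: "x \<in> M \<Longrightarrow> P (ins j p x) = Z j (lv p x)"
proof (induction p arbitrary: x)
  case 0
  then show ?case by (simp add: Z_eq orth_proj_id[OF M])
next
  case (Suc p)
  have comm: "q k j *\<^sub>C Z k (Z j y) = Z j (Z k y)" if "y \<in> M" for k y
    unfolding Z_commute[OF that, of k j] by (simp add: scaleC_scaleC qD(3))
  have "P (ins j (Suc p) x) = (\<Sum>k\<in>UNIV. q k j *\<^sub>C Z k (Z j (lv p ((R k)\<^sup>\<star> x))))"
    by (simp add: Plin proj_R Suc.IH M_adj Suc.prems)
  also have "\<dots> = (\<Sum>k\<in>UNIV. Z j (Z k (lv p ((R k)\<^sup>\<star> x))))"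
    by (simp add: comm lv_mem)
  also have "\<dots> = Z j (lv (Suc p) x)"
    by (simp add: level.simps(2) Zlin Zs_eq Suc.prems)
  finally show ?case .
qed

definition ins_sum :: "'n \<Rightarrow> nat \<Rightarrow> 'a \<Rightarrow> 'a" where
  "ins_sum j n x = (\<Sum>p<n. ins j p x)"

lemma ins_sum_mem: "ins_sum j n x \<in> L"
  unfolding ins_sum_def by (intro closed_csubspaceD(5)[OF L] ins_mem)

lemma ins_sum_0 [simp]: "ins_sum j 0 x = 0"
  by (simp add: ins_sum_def)

lemma ins_sum_scaleC: "ins_sum j n (c *\<^sub>C x) = c *\<^sub>C ins_sum j n x"
  by (simp add: ins_sum_def ins_scaleC complex_vector.scale_sum_right)

lemma Rs_ins_sum: "x \<in> L \<Longrightarrow>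
    (R k)\<^sup>\<star> (ins_sum j (Suc n) x) = (if k = j then x else 0) + q k j *\<^sub>C ins_sum j n ((R k)\<^sup>\<star> x)"
  unfolding ins_sum_def sum.lessThan_Suc_shift Rslin Rs_ins_0 Rs_ins_Suc
  by (simp only: complex_vector.scale_sum_right)

text \<open>Adding up all possible insertions into a \<open>q\<close>-symmetric tensor gives a \<open>q\<close>-symmetric tensor. The
  hypothesis \<open>lv n x = 0\<close> says that \<open>x\<close> has fewer than \<open>n\<close> particles, so that no insertion is left
  out. One adjoint turns a sum of this kind into \<open>x\<close> and a shorter sum of this kind.\<close>

lemma ins_sum_mem_M: "x \<in> M \<Longrightarrow> lv n x = 0 \<Longrightarrow> ins_sum j n x \<in> M"
proof (induction n arbitrary: x)
  case 0
  then show ?case by (simp add: closed_csubspaceD(1)[OF M])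
next
  case (Suc n)
  note x = Suc.prems(1)
  have n: "lv n ((R k)\<^sup>\<star> x) = 0" for k
    using Rs_lv[OF x, of k n] Suc.prems(2) by (simp add: Rslin)
  note first = Rs_ins_sum[OF M_sub[OF x]]
  show ?case
  proof (rule M_I)
    show "ins_sum j (Suc n) x \<in> L" by (rule ins_sum_mem)
    show "(R k)\<^sup>\<star> (ins_sum j (Suc n) x) \<in> M" for k
      unfolding first using x Suc.IH[OF M_adj[OF x] n] closed_csubspaceD(1-3)[OF M] by simp
    fix l k
    show "(R l)\<^sup>\<star> ((R k)\<^sup>\<star> (ins_sum j (Suc n) x)) =
        cnj (q l k) *\<^sub>C (R k)\<^sup>\<star> ((R l)\<^sup>\<star> (ins_sum j (Suc n) x))"
    proof (cases n)
      case 0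
      then have "(R k)\<^sup>\<star> x = 0" for k using n[of k] lv_0[OF M_adj[OF x]] by simp
      then show ?thesis using 0 by (simp add: first Rslin)
    next
      case (Suc n')
      \<comment> \<open>\<open>e\<^sub>j\<close> may be stripped off first, second, or not at all; the three contributions are
        matched separately.\<close>
      have second: "(R l)\<^sup>\<star> ((R k)\<^sup>\<star> (ins_sum j (Suc n) x)) =
          (if k = j then (R l)\<^sup>\<star> x else 0) + (if l = j then q k j *\<^sub>C (R k)\<^sup>\<star> x else 0) +
          (q k j * q l j) *\<^sub>C ins_sum j n' ((R l)\<^sup>\<star> ((R k)\<^sup>\<star> x))" for l k
        unfolding first Suc using Rs_ins_sum[OF R_adj_mem]
        by (simp add: Rslin scaleC_add_right scaleC_scaleC add.assoc)
      have comm: "ins_sum j n' ((R l)\<^sup>\<star> ((R k)\<^sup>\<star> x)) =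
          cnj (q l k) *\<^sub>C ins_sum j n' ((R k)\<^sup>\<star> ((R l)\<^sup>\<star> x))"
        by (metis M_comm[OF x] ins_sum_scaleC)
      show ?thesis unfolding second comm
        by (simp add: scaleC_add_right scaleC_scaleC qD mult_ac)
    qed
  qed
qed

text \<open>On vectors with exactly \<open>m\<close> particles, \<open>Z j\<close> is the average of the \<open>m + 1\<close> insertions: their sum
  is in \<open>M\<close> already, and each of them projects to \<open>Z j x\<close>. The adjoint of \<open>R k\<close> removes the first
  letter, which is the inserted one in one case out of \<open>m + 1\<close>.\<close>

lemma exact_level_relation:
  assumes x: "x \<in> M" and up: "lv (Suc m) x = 0" and low: "lv m x = x"
  shows "(Z k)\<^sup>\<star> (Z j x) = (1 / of_nat (Suc m)) *\<^sub>C
    ((if k = j then x else 0) + of_nat m *\<^sub>C q k j *\<^sub>C Z j ((Z k)\<^sup>\<star> x))"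
proof -
  have avg: "ins_sum j (Suc m) x = of_nat (Suc m) *\<^sub>C Z j x"
    if x: "x \<in> M" and up: "lv (Suc m) x = 0" and low: "lv m x = x" for m x
  proof -
    have "ins_sum j (Suc m) x = P (ins_sum j (Suc m) x)"
      using ins_sum_mem_M[OF x up] by (simp add: orth_proj_id[OF M])
    also have "\<dots> = (\<Sum>p<Suc m. Z j (lv p x))"
      unfolding ins_sum_def Plin using proj_ins[OF x] by simp
    also have "\<dots> = (\<Sum>p<Suc m. Z j x)"
    proof (rule sum.cong)
      fix p assume "p \<in> {..<Suc m}"
      then have "lv p x = x" using lv_lv[OF x, of p m] low by (simp add: max_def)
      then show "Z j (lv p x) = Z j x" by simp
    qed simp
    also have "\<dots> = of_nat (Suc m) *\<^sub>C Z j x"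
      by (simp only: sum_constant_scaleR card_lessThan scaleR_eq_scaleC of_real_of_nat_eq)
    finally show ?thesis .
  qed
  have avg': "ins_sum j m ((R k)\<^sup>\<star> x) = of_nat m *\<^sub>C Z j ((R k)\<^sup>\<star> x)"
  proof (cases m)
    case (Suc m')
    have "lv m ((R k)\<^sup>\<star> x) = 0" using Rs_lv[OF x, of k m] up by (simp add: Rslin)
    moreover have "lv m' ((R k)\<^sup>\<star> x) = (R k)\<^sup>\<star> x" using Rs_lv[OF x, of k m'] low Suc by simp
    ultimately show ?thesis using avg[OF M_adj[OF x]] Suc by simp
  qed simp
  have "of_nat (Suc m) *\<^sub>C (R k)\<^sup>\<star> (Z j x) = (R k)\<^sup>\<star> (ins_sum j (Suc m) x)"
    unfolding avg[OF x up low] Rslin ..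
  also have "\<dots> = (if k = j then x else 0) + q k j *\<^sub>C of_nat m *\<^sub>C Z j ((R k)\<^sup>\<star> x)"
    unfolding Rs_ins_sum[OF M_sub[OF x]] avg' ..
  finally have eq: "of_nat (Suc m) *\<^sub>C (R k)\<^sup>\<star> (Z j x) =
      (if k = j then x else 0) + of_nat m *\<^sub>C q k j *\<^sub>C Z j ((R k)\<^sup>\<star> x)"
    by (simp add: scaleC_scaleC mult.commute)
  have "(1 / of_nat (Suc m)) *\<^sub>C of_nat (Suc m) *\<^sub>C (R k)\<^sup>\<star> (Z j x) = (R k)\<^sup>\<star> (Z j x)"
    by (simp add: scaleC_scaleC del: of_nat_Suc)
  then show ?thesis unfolding Zs_eq[OF x] Zs_eq[OF Z_mem] eq by (rule sym)
qed
end

section \<open>Averages of infinitely many insertions\<close>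

text \<open>The inner product of the \<open>n\<close>-th and the \<open>m\<close>-th mean is \<open>b + (a - b) / (m + 1)\<close> for \<open>n \<le> m\<close>, which
  makes the means a Cauchy sequence.\<close>

lemma Cesaro_mean_converges:
  fixes v :: "nat \<Rightarrow> 'a::complex_hilbert_space"
  assumes gram: "\<And>p r. cinner (v p) (v r) = (if p = r then a else b)"
  shows "convergent (\<lambda>n. (1 / of_nat (Suc n)) *\<^sub>C (\<Sum>p<Suc n. v p))"
proof -
  define S where "S n = (\<Sum>p<Suc n. v p)" for n
  define A where "A n = (1 / of_nat (Suc n)) *\<^sub>C S n" for n
  have S: "cinner (S n) (S m) = of_nat (Suc n) * of_nat (Suc m) * b + of_nat (Suc n) * (a - b)"
    if "n \<le> m" for n m
  proof -
    have "cinner (v p) (S m) = of_nat (Suc m) * b + (a - b)" if "p < Suc n" for p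
    proof -
      have "cinner (v p) (S m) = (\<Sum>r<Suc m. b + (if p = r then a - b else 0))"
        unfolding S_def cinner_sum_right gram by (rule sum.cong) auto
      also have "\<dots> = of_nat (Suc m) * b + (a - b)"
        using that \<open>n \<le> m\<close> by (simp add: sum.distrib del: sum.lessThan_Suc of_nat_Suc)
      finally show ?thesis .
    qed
    then have "cinner (S n) (S m) = (\<Sum>p<Suc n. of_nat (Suc m) * b + (a - b))"
      unfolding S_def[of n] cinner_sum_left by (intro sum.cong) auto
    also have "\<dots> = of_nat (Suc n) * (of_nat (Suc m) * b + (a - b))"
      by (simp del: sum.lessThan_Suc of_nat_Suc)
    finally show ?thesis by (simp add: algebra_simps)
  qed
  have A: "cinner (A n) (A m) = b + (a - b) / of_nat (Suc m)" if "n \<le> m" for n m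
    using that unfolding A_def cinner_scaleC_left cinner_scaleC_right S[OF that]
    by (simp add: field_simps del: of_nat_Suc)
  have dist: "(dist (A n) (A m))\<^sup>2 \<le> cmod (a - b) / real (Suc n)" if "n \<le> m" for n m
  proof -
    have a0: "a = cinner (v 0) (v 0)" by (simp add: gram)
    have b0: "b = cinner (v 0) (v 1)" "b = cinner (v 1) (v 0)" by (simp_all add: gram)
    have real: "cnj a = a" "cnj b = b" unfolding a0 by (simp add: cinner_self) (metis b0 cinner_commute)
    have "complex_of_real ((dist (A n) (A m))\<^sup>2) =
        cinner (A n) (A n) - cinner (A n) (A m) - (cnj (cinner (A n) (A m)) - cinner (A m) (A m))"
      unfolding dist_norm cinner_self[symmetric] cinner_diff_left cinner_diff_right
      by (simp add: cinner_commute[of "A m" "A n", symmetric])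
    also have "\<dots> = (a - b) * (1 / of_nat (Suc n) - 1 / of_nat (Suc m))"
      using that by (simp add: A real algebra_simps del: of_nat_Suc)
    finally have "(dist (A n) (A m))\<^sup>2 = cmod ((a - b) * (1 / of_nat (Suc n) - 1 / of_nat (Suc m)))"
      by (metis norm_of_real abs_power2)
    also have "\<dots> = cmod (a - b) * cmod (of_real (1 / real (Suc n) - 1 / real (Suc m)))"
      by (simp add: norm_mult)
    also have "\<dots> = cmod (a - b) * (1 / real (Suc n) - 1 / real (Suc m))"
      using that by (simp only: norm_of_real) (simp add: frac_le)
    also have "\<dots> \<le> cmod (a - b) * (1 / real (Suc n))"
      by (rule mult_left_mono) auto
    finally show ?thesis by simp
  qed
  have "Cauchy A"
  proof (rule CauchyI')
    fix e :: real assume e: "e > 0"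
    obtain N where N: "cmod (a - b) / e\<^sup>2 < real N" using reals_Archimedean2 by blast
    have "dist (A m) (A n) < e" if "m \<ge> N" "m < n" for m n
    proof -
      have "cmod (a - b) / e\<^sup>2 < real (Suc m)" using N that by linarith
      then have "cmod (a - b) / real (Suc m) < e\<^sup>2" using e by (simp add: field_simps)
      then have "(dist (A m) (A n))\<^sup>2 < e\<^sup>2" using dist[of m n] that by linarith
      then show ?thesis using e by (simp add: power2_less_imp_less)
    qed
    then show "\<exists>N. \<forall>m\<ge>N. \<forall>n>m. dist (A m) (A n) < e" by blast
  qed
  then show ?thesis unfolding A_def S_def using Cauchy_convergent by blast
qed

context orthogonal_isometries
begin

text \<open>The vectors of \<open>M\<close> with infinitely many particles: the intersection of \<open>M\<close> with the Cuntz summand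
  of the Wold decomposition of \<open>R\<close>.\<close>

definition M_inf :: "'a set" where
  "M_inf = {x\<in>M. \<forall>m. lv m x = x}"

lemma M_inf_adj: "x \<in> M_inf \<Longrightarrow> (R k)\<^sup>\<star> x \<in> M_inf"
  unfolding M_inf_def using M_adj Rs_lv by force

lemma M_inf_scaleC: "x \<in> M_inf \<Longrightarrow> c *\<^sub>C x \<in> M_inf"
  by (simp add: M_inf_def lvlin closed_csubspaceD(3)[OF M])

lemma M_inf_M: "x \<in> M_inf \<Longrightarrow> x \<in> M" and M_inf_lv: "x \<in> M_inf \<Longrightarrow> lv m x = x"
  by (simp_all add: M_inf_def)

lemma sum_norm_Rs:
  assumes "x \<in> M_inf"
  shows "(\<Sum>k\<in>UNIV. cinner ((R k)\<^sup>\<star> x) ((R k)\<^sup>\<star> x)) = cinner x x"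
proof -
  have "x = (\<Sum>k\<in>UNIV. R k ((R k)\<^sup>\<star> x))"
    using lv_Suc[of x 0] assms M_inf_lv[of x "Suc 0"] M_inf_M[OF assms] lv_0 M_adj by simp
  then have "cinner x x = cinner x (\<Sum>k\<in>UNIV. R k ((R k)\<^sup>\<star> x))" by simp
  then show ?thesis by (simp add: cinner_sum_right flip: cinner_cadjoint_left[OF R_clin])
qed

text \<open>Two different insertions into the same vector of \<open>M_inf\<close> have an inner product that does not
  depend on the positions, as for independent identically distributed random variables; so their
  averages converge as in a law of large numbers.\<close>

lemma ins_gram:
  "x \<in> M_inf \<Longrightarrow> cinner (ins j p x) (ins j r x) =
    (if p = r then cinner x x else cinner ((R j)\<^sup>\<star> x) ((R j)\<^sup>\<star> x))"
proof (induction p arbitrary: r x)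
  case 0
  note M0 = M_inf_M[OF 0]
  show ?case
  proof (cases r)
    case 0
    then show ?thesis using M_sub[OF M0] by (simp add: cinner_R_R)
  next
    case (Suc r')
    have "cinner (R j x) (ins j (Suc r') x) = cinner x (ins j r' ((R j)\<^sup>\<star> x))"
      by (simp only: cinner_cadjoint_right[OF R_clin, symmetric] Rs_ins_Suc qD(1)
          complex_vector.scale_one)
    also have "\<dots> = cinner x (P (ins j r' ((R j)\<^sup>\<star> x)))"
      by (simp add: cinner_orth_proj_right[OF M] M0)
    also have "\<dots> = cinner x (Z j ((R j)\<^sup>\<star> x))"
      using proj_ins[OF M_adj[OF M0]] M_inf_lv[OF M_inf_adj[OF 0]] by simp
    also have "\<dots> = cinner ((R j)\<^sup>\<star> x) ((R j)\<^sup>\<star> x)"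
      by (rule cinner_Z[OF M0 M_adj[OF M0]])
    finally show ?thesis using Suc by simp
  qed
next
  case (Suc p)
  note Mx = M_inf_M[OF Suc.prems]
  show ?case
  proof (cases r)
    case 0
    have "cinner (ins j (Suc p) x) (R j x) = cinner (ins j p ((R j)\<^sup>\<star> x)) x"
      by (simp only: cinner_cadjoint_left[OF R_clin, symmetric] Rs_ins_Suc qD(1)
          complex_vector.scale_one)
    also have "\<dots> = cinner (P (ins j p ((R j)\<^sup>\<star> x))) x"
      by (simp add: cinner_orth_proj_left[OF M] Mx)
    also have "\<dots> = cinner (Z j ((R j)\<^sup>\<star> x)) x"
      using proj_ins[OF M_adj[OF Mx]] M_inf_lv[OF M_inf_adj[OF Suc.prems]] by simp
    also have "\<dots> = cinner ((R j)\<^sup>\<star> x) ((R j)\<^sup>\<star> x)"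
      by (subst (1 2) cinner_commute) (simp add: cinner_Z[OF Mx M_adj[OF Mx]])
    finally show ?thesis using 0 by simp
  next
    case (Suc r')
    have exp: "ins j (Suc s) x = (\<Sum>k\<in>UNIV. R k (q k j *\<^sub>C ins j s ((R k)\<^sup>\<star> x)))" for s
      by (simp add: Rlin)
    have "cinner (ins j (Suc p) x) (ins j (Suc r') x) =
        (\<Sum>k\<in>UNIV. cinner (q k j *\<^sub>C ins j p ((R k)\<^sup>\<star> x)) ((R k)\<^sup>\<star> (ins j (Suc r') x)))"
      unfolding exp[of p] cinner_sum_left cinner_cadjoint_right[OF R_clin] ..
    also have "\<dots> = (\<Sum>k\<in>UNIV. cinner (ins j p ((R k)\<^sup>\<star> x)) (ins j r' ((R k)\<^sup>\<star> x)))"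
      unfolding Rs_ins_Suc cinner_scaleC_left cinner_scaleC_right mult.assoc[symmetric]
      by (simp add: qD(4) mult.commute[of "q _ j"])
    also have "\<dots> = (\<Sum>k\<in>UNIV. if p = r' then cinner ((R k)\<^sup>\<star> x) ((R k)\<^sup>\<star> x)
        else cinner ((R j)\<^sup>\<star> ((R k)\<^sup>\<star> x)) ((R j)\<^sup>\<star> ((R k)\<^sup>\<star> x)))"
      by (simp only: Suc.IH[OF M_inf_adj[OF Suc.prems]])
    also have "\<dots> = (\<Sum>k\<in>UNIV. if p = r' then cinner ((R k)\<^sup>\<star> x) ((R k)\<^sup>\<star> x)
        else cinner ((R k)\<^sup>\<star> ((R j)\<^sup>\<star> x)) ((R k)\<^sup>\<star> ((R j)\<^sup>\<star> x)))"
      unfolding M_comm[OF Mx, of j] cinner_scaleC_left cinner_scaleC_right mult.assoc[symmetric]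
      by (simp only: complex_cnj_cnj qD(4) mult_1)
    also have "\<dots> = (if p = r' then cinner x x else cinner ((R j)\<^sup>\<star> x) ((R j)\<^sup>\<star> x))"
      using sum_norm_Rs[OF Suc.prems] sum_norm_Rs[OF M_inf_adj[OF Suc.prems]] by simp
    finally show ?thesis using Suc by simp
  qed
qed

definition ins_mean :: "'n \<Rightarrow> 'a \<Rightarrow> 'a" where
  "ins_mean j x = lim (\<lambda>n. (1 / of_nat (Suc n)) *\<^sub>C ins_sum j (Suc n) x)"

lemma ins_mean_tendsto:
  "x \<in> M_inf \<Longrightarrow> (\<lambda>n. (1 / of_nat (Suc n)) *\<^sub>C ins_sum j (Suc n) x) \<longlonglongrightarrow> ins_mean j x"
  unfolding ins_mean_def ins_sum_def
  by (rule convergent_LIMSEQ_iff[THEN iffD1]) (rule Cesaro_mean_converges[OF ins_gram])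

lemma ins_mean_scaleC:
  assumes "x \<in> M_inf" shows "ins_mean j (c *\<^sub>C x) = c *\<^sub>C ins_mean j x"
proof (rule LIMSEQ_unique)
  show "(\<lambda>n. (1 / of_nat (Suc n)) *\<^sub>C ins_sum j (Suc n) (c *\<^sub>C x)) \<longlonglongrightarrow> ins_mean j (c *\<^sub>C x)"
    by (rule ins_mean_tendsto[OF M_inf_scaleC[OF assms]])
  show "(\<lambda>n. (1 / of_nat (Suc n)) *\<^sub>C ins_sum j (Suc n) (c *\<^sub>C x)) \<longlonglongrightarrow> c *\<^sub>C ins_mean j x"
    using tendsto_scaleC[OF ins_mean_tendsto[OF assms], of c j]
    by (simp add: ins_sum_scaleC scaleC_scaleC mult.commute)
qed

lemma Rs_ins_mean:
  assumes x: "x \<in> M_inf" shows "(R k)\<^sup>\<star> (ins_mean j x) = q k j *\<^sub>C ins_mean j ((R k)\<^sup>\<star> x)"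
proof (rule LIMSEQ_unique)
  let ?A = "\<lambda>x n. (1 / of_nat (Suc n)) *\<^sub>C ins_sum j (Suc n) x"
  show "(\<lambda>n. (R k)\<^sup>\<star> (?A x (Suc n))) \<longlonglongrightarrow> (R k)\<^sup>\<star> (ins_mean j x)"
    by (intro Rslin(6) LIMSEQ_Suc ins_mean_tendsto x)
  let ?x = "if k = j then x else 0"
  have split: "(R k)\<^sup>\<star> (?A x (Suc n)) = (1 / real (Suc (Suc n))) *\<^sub>R ?x +
      (real (Suc n) / real (Suc (Suc n))) *\<^sub>R q k j *\<^sub>C ?A ((R k)\<^sup>\<star> x) n" for n
    unfolding Rslin Rs_ins_sum[OF M_sub[OF M_inf_M[OF x]]] scaleR_eq_scaleC scaleC_add_right scaleC_scaleC
    by (simp add: field_simps del: of_nat_Suc)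
  have "(\<lambda>n. (1 / real (Suc (Suc n))) *\<^sub>R ?x +
      (real (Suc n) / real (Suc (Suc n))) *\<^sub>R q k j *\<^sub>C ?A ((R k)\<^sup>\<star> x) n)
      \<longlonglongrightarrow> 0 *\<^sub>R ?x + 1 *\<^sub>R q k j *\<^sub>C ins_mean j ((R k)\<^sup>\<star> x)"
    by (intro tendsto_add tendsto_scaleR tendsto_const tendsto_scaleC ins_mean_tendsto M_inf_adj x
        LIMSEQ_Suc[OF LIMSEQ_Suc[OF lim_1_over_n]] LIMSEQ_Suc[OF LIMSEQ_n_over_Suc_n])
  then show "(\<lambda>n. (R k)\<^sup>\<star> (?A x (Suc n))) \<longlonglongrightarrow> q k j *\<^sub>C ins_mean j ((R k)\<^sup>\<star> x)"
    unfolding split by simp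
qed

lemma ins_mean_mem_L: "x \<in> M_inf \<Longrightarrow> ins_mean j x \<in> L"
  by (rule closed_csubspaceD(6)[OF L _ ins_mean_tendsto])
    (auto intro: closed_csubspaceD(3)[OF L] ins_sum_mem)

text \<open>The limits of the insertions commute with the adjoints up to the right coefficients. So they
  lie in \<open>M\<close>, by maximality of \<open>M\<close>, and the projection to \<open>M\<close> that enters \<open>Z j\<close> does not alter
  them.\<close>

lemma ins_mean_eq_Z:
  assumes x: "x \<in> M_inf" shows "ins_mean j x = Z j x"
proof -
  have "ins_mean j ` M_inf \<subseteq> M"
  proof (rule max_q_space_coinduct[OF L R])
    fix y k l assume "y \<in> ins_mean j ` M_inf"
    then obtain x where x: "x \<in> M_inf" and y: "y = ins_mean j x" by blast
    have "(R k)\<^sup>\<star> y = ins_mean j (q k j *\<^sub>C (R k)\<^sup>\<star> x)"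
      unfolding y Rs_ins_mean[OF x] by (rule ins_mean_scaleC[OF M_inf_adj[OF x], symmetric])
    then show "(R k)\<^sup>\<star> y \<in> ins_mean j ` M_inf"
      using M_inf_scaleC M_inf_adj x by blast
    have two: "(R l)\<^sup>\<star> ((R k)\<^sup>\<star> y) = (q k j * q l j) *\<^sub>C ins_mean j ((R l)\<^sup>\<star> ((R k)\<^sup>\<star> x))" for l k
      unfolding y Rs_ins_mean[OF x] Rslin Rs_ins_mean[OF M_inf_adj[OF x]] by (rule scaleC_scaleC)
    have comm: "ins_mean j ((R k)\<^sup>\<star> ((R l)\<^sup>\<star> x)) =
        cnj (q k l) *\<^sub>C ins_mean j ((R l)\<^sup>\<star> ((R k)\<^sup>\<star> x))"
      by (metis M_comm[OF M_inf_M[OF x]] ins_mean_scaleC M_inf_adj x)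
    show "(R k)\<^sup>\<star> ((R l)\<^sup>\<star> y) = cnj (q k l) *\<^sub>C (R l)\<^sup>\<star> ((R k)\<^sup>\<star> y)"
      unfolding two comm by (simp add: scaleC_scaleC mult_ac)
  qed (auto simp: ins_mean_mem_L)
  then have "ins_mean j x = P (ins_mean j x)"
    using x by (auto simp: orth_proj_id[OF M])
  moreover have "(\<lambda>n. P ((1 / of_nat (Suc n)) *\<^sub>C ins_sum j (Suc n) x)) \<longlonglongrightarrow> P (ins_mean j x)"
    by (rule Plin(6)) (rule ins_mean_tendsto[OF x])
  moreover have "P ((1 / of_nat (Suc n)) *\<^sub>C ins_sum j (Suc n) x) = Z j x" for n
  proof -
    have "P (ins_sum j (Suc n) x) = (\<Sum>p<Suc n. Z j x)"
      unfolding ins_sum_def Plin proj_ins[OF M_inf_M[OF x]] M_inf_lv[OF x] ..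
    also have "\<dots> = of_nat (Suc n) *\<^sub>C Z j x"
      by (simp only: sum_constant_scaleR card_lessThan scaleR_eq_scaleC of_real_of_nat_eq)
    finally show ?thesis by (simp add: Plin scaleC_scaleC del: of_nat_Suc)
  qed
  ultimately show ?thesis by (simp add: LIMSEQ_const_iff)
qed

lemma infinite_level_relation:
  assumes x: "x \<in> M_inf"
  shows "(Z k)\<^sup>\<star> (Z j x) = q k j *\<^sub>C Z j ((Z k)\<^sup>\<star> x)"
  using Rs_ins_mean[OF x, of k j] ins_mean_eq_Z[OF x] ins_mean_eq_Z[OF M_inf_adj[OF x]]
  by (simp add: Zs_eq Z_mem M_inf_M[OF x])

text \<open>A decreasing sequence of projections converges strongly.\<close>

lemma lv_converges:
  assumes x: "x \<in> M" shows "\<exists>y\<in>M_inf. (\<lambda>n. lv n x) \<longlonglongrightarrow> y"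
proof -
  let ?a = "\<lambda>n. (norm (lv n x))\<^sup>2"
  have diff: "(dist (lv m x) (lv n x))\<^sup>2 = ?a m - ?a n" if "m \<le> n" for m n
  proof -
    have "cinner (lv m x) (lv n x) = cinner x (lv n x)"
      using cinner_lv_left[OF x lv_mem] lv_lv[OF x] that by (simp add: max_def)
    moreover have "cinner (lv n x) (lv n x) = cinner x (lv n x)"
      using cinner_lv_left[OF x lv_mem] lv_lv[OF x] by simp
    ultimately have "inner (lv m x) (lv n x) = inner (lv n x) (lv n x)"
      by (simp add: inner_eq_Re_cinner)
    then show ?thesis
      by (simp add: dist_norm power2_norm_eq_inner inner_diff_left inner_diff_right inner_commute)
  qed
  have "decseq ?a"
    unfolding decseq_def using diff by (metis diff_ge_0_iff_ge zero_le_power2)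
  then have "convergent ?a"
    using decseq_convergent[of ?a 0] by (auto simp: convergent_def)
  then have C: "Cauchy ?a" by (rule convergent_Cauchy)
  have "Cauchy (\<lambda>n. lv n x)"
  proof (rule CauchyI')
    fix e :: real assume e: "e > 0"
    then obtain N where N: "\<And>m n. m \<ge> N \<Longrightarrow> n \<ge> N \<Longrightarrow> dist (?a m) (?a n) < e\<^sup>2"
      using metric_CauchyD[OF C, of "e\<^sup>2"] by auto
    have "dist (lv m x) (lv n x) < e" if "m \<ge> N" "m < n" for m n
    proof -
      have "(dist (lv m x) (lv n x))\<^sup>2 < e\<^sup>2"
        using N[of m n] that diff[of m n] by (simp add: dist_real_def)
      then show ?thesis using e by (simp add: power2_less_imp_less)
    qed
    then show "\<exists>N. \<forall>m\<ge>N. \<forall>n>m. dist (lv m x) (lv n x) < e" by blast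
  qed
  then obtain y where y: "(\<lambda>n. lv n x) \<longlonglongrightarrow> y"
    using Cauchy_convergent convergent_def by blast
  have "y \<in> M" using closed_csubspaceD(6)[OF M lv_mem y] .
  moreover have "lv m y = y" for m
  proof (rule LIMSEQ_unique)
    show "(\<lambda>n. lv m (lv n x)) \<longlonglongrightarrow> lv m y" by (rule lvlin(6)[OF y])
    have "lv m (lv (n + m) x) = lv (n + m) x" for n using lv_lv[OF x] by (simp add: max_def)
    then have "(\<lambda>n. lv m (lv (n + m) x)) \<longlonglongrightarrow> y" using LIMSEQ_ignore_initial_segment[OF y, of m] by simp
    then show "(\<lambda>n. lv m (lv n x)) \<longlonglongrightarrow> y" by (rule LIMSEQ_offset)
  qed
  ultimately show ?thesis using y by (auto simp: M_inf_def)
qed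

section \<open>The relations on the maximal piece\<close>

abbreviation "iN \<equiv> inv_number M Z"

text \<open>Summation by parts, with the decreasing weights \<open>1 / (m + 1)\<close>.\<close>

lemma norm_inv_number_tail:
  assumes x: "x \<in> M" and "n \<le> m"
  shows "norm (iN m x - iN n x) \<le> 2 / real (Suc n) * norm x"
proof -
  have "norm (iN m x - iN n x + (1 / real (Suc m)) *\<^sub>R lv m x)
      \<le> (2 / real (Suc n) - 1 / real (Suc m)) * norm x"
    using \<open>n \<le> m\<close>
  proof (induction m rule: dec_induct)
    case base
    then show ?case using norm_lv_le[OF x, of n] by (simp add: divide_right_mono)
  next
    case (step m)
    let ?d = "1 / real (Suc m) - 1 / real (Suc (Suc m))"
    have d: "?d \<ge> 0" by (simp add: frac_le)
    have "iN (Suc m) x = iN m x + (1 / real (Suc m)) *\<^sub>R (lv m x - lv (Suc m) x)"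
      by (simp add: inv_number_def scaleR_eq_scaleC)
    then have "iN (Suc m) x - iN n x + (1 / real (Suc (Suc m))) *\<^sub>R lv (Suc m) x =
        (iN m x - iN n x + (1 / real (Suc m)) *\<^sub>R lv m x) - ?d *\<^sub>R lv (Suc m) x"
      by (simp add: algebra_simps)
    also have "norm \<dots> \<le> (2 / real (Suc n) - 1 / real (Suc m)) * norm x + ?d * norm x"
    proof (rule order_trans[OF norm_triangle_ineq4], rule add_mono)
      show "norm (?d *\<^sub>R lv (Suc m) x) \<le> ?d * norm x"
        using d norm_lv_le[OF x, of "Suc m"] by (simp add: mult_left_mono del: of_nat_Suc)
    qed (rule step.IH)
    finally show ?case by (simp add: algebra_simps)
  qed
  moreover have "norm ((1 / real (Suc m)) *\<^sub>R lv m x) \<le> 1 / real (Suc m) * norm x"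
    using norm_lv_le[OF x, of m] by (simp add: divide_right_mono)
  moreover have "iN m x - iN n x = (iN m x - iN n x + (1 / real (Suc m)) *\<^sub>R lv m x) -
      (1 / real (Suc m)) *\<^sub>R lv m x" by simp
  ultimately show ?thesis
    using norm_triangle_ineq4[of "iN m x - iN n x + (1 / real (Suc m)) *\<^sub>R lv m x"
        "(1 / real (Suc m)) *\<^sub>R lv m x"]
    by (simp add: algebra_simps)
qed

text \<open>A vector is split into its parts with exactly \<open>m\<close> particles and its part in \<open>M_inf\<close>, on which the
  relations are known. Below level \<open>n\<close> the estimated difference vanishes, and above level \<open>n\<close> it is
  small because the weights \<open>1 / (m + 1)\<close> are.\<close>

theorem fock_relations_piece: "fock_relations q M Z"
  unfolding fock_relations_def
proof (intro conjI allI ballI)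
  fix n i j x assume x: "x \<in> M"
  \<comment> \<open>On vectors with exactly \<open>m\<close> particles \<open>D\<close> is \<open>G / (m + 1)\<close>, and on \<open>M_inf\<close> it is zero.\<close>
  define D where "D y = (Z i)\<^sup>\<star> (Z j y) - q i j *\<^sub>C Z j ((Z i)\<^sup>\<star> y)" for y
  define G where "G y = (if i = j then y else 0) - q i j *\<^sub>C Z j ((Z i)\<^sup>\<star> y)" for y
  note Zs_clin = adjoint_clinear[OF M Z_tuple]
  note Zslin = bounded_clinearD[OF Zs_clin]
  have D_clin: "bounded_clinear D"
  proof -
    have "bounded_clinear (\<lambda>y. ((Z i)\<^sup>\<star> \<circ> Z j) y + (- q i j) *\<^sub>C (Z j \<circ> (Z i)\<^sup>\<star>) y)"
      by (intro bounded_clinear_add bounded_clinear_scale bounded_clinear_comp Zs_clin Z_clin)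
    then show ?thesis by (simp add: D_def[abs_def])
  qed
  note Dlin = bounded_clinearD[OF D_clin]
  have Glin: "G (y + z) = G y + G z" "G (y - z) = G y - G z" "G (c *\<^sub>C y) = c *\<^sub>C G y" "G 0 = 0" for y z c
    by (auto simp: G_def Zlin Zslin algebra_simps complex_vector.scale_right_distrib
      complex_vector.scale_right_diff_distrib complex_vector.scale_left_commute)
  have nq: "cmod (q i j) = 1" using q unfolding q_coefficients_def by blast
  have normG: "norm (G y) \<le> 2 * norm y" if "y \<in> M" for y
  proof -
    have "norm (q i j *\<^sub>C Z j ((Z i)\<^sup>\<star> y)) \<le> norm y"
      using norm_Z_le[OF M_adj[OF that], of j i] norm_Rs_le[of i y]
      by (simp add: norm_scaleC nq Zs_eq that)
    moreover have "norm (if i = j then y else 0) \<le> norm y" by simp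
    ultimately show ?thesis
      unfolding G_def using norm_triangle_ineq4[of "if i = j then y else 0" "q i j *\<^sub>C Z j ((Z i)\<^sup>\<star> y)"]
      by linarith
  qed
  have exact: "D (lv m x - lv (Suc m) x) = (1 / of_nat (Suc m)) *\<^sub>C G (lv m x - lv (Suc m) x)" for m
  proof -
    let ?e = "lv m x - lv (Suc m) x"
    have "?e \<in> M" by (intro closed_csubspaceD(4)[OF M] lv_mem)
    moreover have "lv (Suc m) ?e = 0" "lv m ?e = ?e"
      using lv_lv[OF x] by (simp_all add: lvlin max_def)
    ultimately have rel: "(Z i)\<^sup>\<star> (Z j ?e) = (1 / of_nat (Suc m)) *\<^sub>C
        ((if i = j then ?e else 0) + of_nat m *\<^sub>C q i j *\<^sub>C Z j ((Z i)\<^sup>\<star> ?e))"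
      by (rule exact_level_relation)
    have avg: "(1 / of_nat (Suc m)) *\<^sub>C (a + of_nat m *\<^sub>C w) = (1 / of_nat (Suc m)) *\<^sub>C (a - w) + w"
      for a w :: 'a
    proof -
      have e: "a + of_nat m *\<^sub>C w = (a - w) + of_nat (Suc m) *\<^sub>C w"
        by (simp add: scaleC_add_left)
      show ?thesis
        unfolding e by (simp add: scaleC_add_right scaleC_scaleC del: of_nat_Suc)
    qed
    show ?thesis unfolding D_def rel G_def avg by (rule add_diff_cancel_right')
  qed
  have fin: "D (x - lv m x) = G (iN m x)" for m
  proof (induction m)
    case 0
    then show ?case using lv_0[OF x] by (simp add: inv_number_def Dlin Glin)
  next
    case (Suc m)
    have "D (x - lv (Suc m) x) = D (x - lv m x) + D (lv m x - lv (Suc m) x)"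
      by (simp add: Dlin)
    also have "\<dots> = G (iN (Suc m) x)"
      unfolding Suc.IH exact by (simp add: inv_number_def Glin)
    finally show ?case .
  qed
  have iN: "iN m x \<in> M" for m by (rule inv_number_mem[OF M Z_tuple])
  obtain y where y: "y \<in> M_inf" "(\<lambda>m. lv m x) \<longlonglongrightarrow> y" using lv_converges[OF x] by blast
  have Dy: "D y = 0" unfolding D_def using infinite_level_relation[OF y(1)] by simp
  have "(Z i)\<^sup>\<star> (Z j x) - (q i j *\<^sub>C Z j ((Z i)\<^sup>\<star> (x - iN n x)) + (if i = j then iN n x else 0)) =
      D x - G (iN n x)"
    by (simp add: D_def G_def Zlin Zslin complex_vector.scale_right_diff_distrib)
  also have "\<dots> = D (lv n x)" unfolding fin[symmetric] by (simp add: Dlin)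
  also have "norm \<dots> \<le> 4 / real (Suc n) * norm x"
  proof (rule LIMSEQ_le_const2)
    show "(\<lambda>m. norm (D (lv n x) - D (lv m x))) \<longlonglongrightarrow> norm (D (lv n x))"
      using tendsto_norm[OF tendsto_diff[OF tendsto_const Dlin(6)[OF y(2)]], of "D (lv n x)"] Dy by simp
    have "norm (D (lv n x) - D (lv m x)) \<le> 4 / real (Suc n) * norm x" if "m \<ge> n" for m
    proof -
      have "D (lv n x) - D (lv m x) = G (iN m x - iN n x)"
        using fin[of n] fin[of m] by (simp add: Dlin Glin algebra_simps)
      also have "norm \<dots> \<le> 2 * norm (iN m x - iN n x)"
        by (rule normG) (rule closed_csubspaceD(4)[OF M iN iN])
      also have "\<dots> \<le> 2 * (2 / real (Suc n) * norm x)"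
        using norm_inv_number_tail[OF x that] by simp
      finally show ?thesis by simp
    qed
    then show "\<exists>N. \<forall>m\<ge>N. norm (D (lv n x) - D (lv m x)) \<le> 4 / real (Suc n) * norm x" by blast
  qed
  finally show "norm ((Z i)\<^sup>\<star> (Z j x) - (q i j *\<^sub>C Z j ((Z i)\<^sup>\<star> (x - iN n x)) +
      (if i = j then iN n x else 0))) \<le> 4 / real (Suc n) * norm x" .
next
  fix m x and i :: 'n assume x: "x \<in> M"
  show "lv m (lv m x) = lv m x" using lv_lv[OF x] by simp
  show "(Z i)\<^sup>\<star> (lv (Suc m) x) = lv m ((Z i)\<^sup>\<star> x)"
    using Rs_lv[OF x] by (simp add: Zs_eq x lv_mem)
qed (rule M Z_tuple)+
end

section \<open>The creation operators\<close>

lemma cinner_creation: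
  "cinner (creation i x) (creation j y) = (if i = j then cinner x y else 0)"
proof -
  let ?f = "\<lambda>w. cnj (Rep_ell2 (creation i x) w) * Rep_ell2 (creation j y) w"
  have "cinner (creation i x) (creation j y) = infsum ?f (range ((#) i))"
    unfolding cinner_ell2.rep_eq
    by (rule infsum_cong_neutral) (auto simp: creation.rep_eq split: list.splits)
  also have "\<dots> = infsum (?f \<circ> (#) i) UNIV"
    by (rule infsum_reindex) auto
  also have "\<dots> = (if i = j then cinner x y else 0)"
    by (simp add: o_def creation.rep_eq cinner_ell2.rep_eq)
  finally show ?thesis .
qed

lemma norm_creation: "norm (creation i x) = norm x"
  by (rule norm_eqI_cinner) (simp add: cinner_creation)

lemma bounded_clinear_creation: "bounded_clinear (creation i)"
proof (rule bounded_clinearI[of _ 1])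
  show "creation i (x + y) = creation i x + creation i y" for x y
    by transfer (auto split: list.splits)
  show "creation i (c *\<^sub>C x) = c *\<^sub>C creation i x" for c x
    by transfer (auto split: list.splits)
qed (simp add: norm_creation)

lemma op_tuple_creation: "op_tuple UNIV creation"
  unfolding op_tuple_def
  by (intro allI bopsI bounded_clinear_creation closed_csubspace_UNIV)
    (simp_all add: orth_proj_id[OF closed_csubspace_UNIV])

lemma fock_relations_q_creation:
  assumes "q_coefficients q" shows "fock_relations q (q_fock q) (q_creation q)"
proof -
  interpret orthogonal_isometries q UNIV creation
    by unfold_locales
      (simp_all add: assms closed_csubspace_UNIV op_tuple_creation norm_creation cinner_creation)
  show ?thesis unfolding q_fock_def q_creation_def by (rule fock_relations_piece)
qed

section \<open>Representations of the \<open>C\<^sup>*\<close>-algebra\<close>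

lemma bops_eqI:
  assumes "closed_csubspace M" "X \<in> bops M" "Y \<in> bops M" "\<And>x. x \<in> M \<Longrightarrow> X x = Y x"
  shows "X = Y"
  by (rule ext) (metis assms bopsD(3) orth_proj_in)

lemma unital_cstar_subalgebraD:
  assumes "unital_cstar_subalgebra M A"
  shows "X \<in> A \<Longrightarrow> X \<in> bops M" "orth_proj M \<in> A"
    "X \<in> A \<Longrightarrow> Y \<in> A \<Longrightarrow> (\<lambda>x. X x + Y x) \<in> A" "X \<in> A \<Longrightarrow> (\<lambda>x. c *\<^sub>C X x) \<in> A"
    "X \<in> A \<Longrightarrow> Y \<in> A \<Longrightarrow> X \<circ> Y \<in> A" "X \<in> A \<Longrightarrow> X\<^sup>\<star> \<in> A"
    "(\<And>k::nat. F k \<in> A) \<Longrightarrow> X \<in> bops M \<Longrightarrow> (\<lambda>k. onorm (\<lambda>x. F k x - X x)) \<longlonglongrightarrow> 0 \<Longrightarrow> X \<in> A"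
  using assms unfolding unital_cstar_subalgebra_def by blast+

lemma unital_cstar_subalgebra_generated:
  assumes "closed_csubspace M" "range S \<subseteq> bops M"
  shows "unital_cstar_subalgebra M (generated_cstar M S)"
proof -
  have sub: "generated_cstar M S \<subseteq> bops M"
    unfolding generated_cstar_def using unital_cstar_subalgebra_bops[OF assms(1)] assms(2) by blast
  have mem: "X \<in> generated_cstar M S \<longleftrightarrow>
      (\<forall>A. unital_cstar_subalgebra M A \<and> range S \<subseteq> A \<longrightarrow> X \<in> A)" for X
    unfolding generated_cstar_def by blast
  show ?thesis
    unfolding unital_cstar_subalgebra_def[of M "generated_cstar M S"]
  proof (intro conjI sub ballI allI impI)
    show "orth_proj M \<in> generated_cstar M S"
      unfolding mem using unital_cstar_subalgebraD(2) by blast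
    show "(\<lambda>x. X x + Y x) \<in> generated_cstar M S"
      if "X \<in> generated_cstar M S" "Y \<in> generated_cstar M S" for X Y
      using that unfolding mem using unital_cstar_subalgebraD(3) by blast
    show "(\<lambda>x. c *\<^sub>C X x) \<in> generated_cstar M S" if "X \<in> generated_cstar M S" for c X
      using that unfolding mem using unital_cstar_subalgebraD(4) by blast
    show "X \<circ> Y \<in> generated_cstar M S"
      if "X \<in> generated_cstar M S" "Y \<in> generated_cstar M S" for X Y
      using that unfolding mem using unital_cstar_subalgebraD(5) by blast
    show "X\<^sup>\<star> \<in> generated_cstar M S" if "X \<in> generated_cstar M S" for X
      using that unfolding mem using unital_cstar_subalgebraD(6) by blast
    fix F X assume F: "(\<forall>k::nat. F k \<in> generated_cstar M S) \<and> X \<in> bops M \<and>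
        (\<lambda>k. onorm (\<lambda>x. F k x - X x)) \<longlonglongrightarrow> 0"
    show "X \<in> generated_cstar M S"
      unfolding mem
    proof (intro allI impI)
      fix A assume A: "unital_cstar_subalgebra M A \<and> range S \<subseteq> A"
      then have "F k \<in> A" for k using F mem by blast
      then show "X \<in> A" using F A unital_cstar_subalgebraD(7)[of M A F X] by blast
    qed
  qed
qed

lemma generated_cstar_least:
  "unital_cstar_subalgebra M A \<Longrightarrow> range S \<subseteq> A \<Longrightarrow> generated_cstar M S \<subseteq> A"
  unfolding generated_cstar_def by blast

lemma range_subset_generated_cstar: "range S \<subseteq> generated_cstar M S"
  unfolding generated_cstar_def by blast

locale stinespring =
  fixes M :: "'b::complex_hilbert_space set" and A :: "('b \<Rightarrow> 'b) set"
    and H K :: "'a::complex_hilbert_space set" and \<phi> \<pi> :: "('b \<Rightarrow> 'b) \<Rightarrow> 'a \<Rightarrow> 'a"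
  assumes M: "closed_csubspace M" and H: "closed_csubspace H"
    and A: "unital_cstar_subalgebra M A"
    and ucp: "unital_completely_positive M A H \<phi>"
    and minimal: "minimal_stinespring M A H \<phi> K \<pi>"
begin

lemmas AD = unital_cstar_subalgebraD[OF A] and A_intros = unital_cstar_subalgebraD(2-6)[OF A]

lemma K: "closed_csubspace K" and H_sub: "H \<subseteq> K" and hom: "unital_star_hom M A K \<pi>"
  and \<phi>_eq: "X \<in> A \<Longrightarrow> \<phi> X = compression H (\<pi> X)"
  and K_eq: "K = closure (cspan {\<pi> X h | X h. X \<in> A \<and> h \<in> H})"
  using minimal by (auto simp: minimal_stinespring_def separable_hilbert_def)

lemma \<pi>_bops: "X \<in> A \<Longrightarrow> \<pi> X \<in> bops K"
  and \<pi>_add: "X \<in> A \<Longrightarrow> Y \<in> A \<Longrightarrow> \<pi> (\<lambda>x. X x + Y x) = (\<lambda>h. \<pi> X h + \<pi> Y h)"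
  and \<pi>_scale: "X \<in> A \<Longrightarrow> \<pi> (\<lambda>x. c *\<^sub>C X x) = (\<lambda>h. c *\<^sub>C \<pi> X h)"
  and \<pi>_one: "\<pi> (orth_proj M) = orth_proj K"
  and \<pi>_comp: "X \<in> A \<Longrightarrow> Y \<in> A \<Longrightarrow> \<pi> (X \<circ> Y) = \<pi> X \<circ> \<pi> Y"
  and \<pi>_adj: "X \<in> A \<Longrightarrow> \<pi> (X\<^sup>\<star>) = (\<pi> X)\<^sup>\<star>"
  using hom unfolding unital_star_hom_def linear_on_ops_def by blast+

lemma \<pi>_clin: "X \<in> A \<Longrightarrow> bounded_clinear (\<pi> X)"
  using bopsD(1)[OF \<pi>_bops K] .

lemma cinner_\<phi>: "X \<in> A \<Longrightarrow> h \<in> H \<Longrightarrow> g \<in> H \<Longrightarrow> cinner g (\<phi> X h) = cinner g (\<pi> X h)"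
  by (simp add: \<phi>_eq compression_def orth_proj_id[OF H] cinner_orth_proj_right[OF H])

text \<open>Complete positivity of \<open>\<phi>\<close>, applied to the matrix \<open>Y\<^sub>i\<^sup>\<star> (\<epsilon>\<^sup>2 - X\<^sup>\<star> X) Y\<^sub>j\<close>, bounds \<open>\<pi> X\<close> on the
  vector \<open>\<Sum>\<^sub>i \<pi> Y\<^sub>i h\<^sub>i\<close>. This is how norm estimates pass from \<open>A\<close> to its representation.\<close>

lemma norm_\<pi>_le:
  assumes X: "X \<in> A" and bound: "\<And>x. x \<in> M \<Longrightarrow> norm (X x) \<le> \<epsilon> * norm x" and "\<epsilon> \<ge> 0" and k: "k \<in> K"
  shows "norm (\<pi> X k) \<le> \<epsilon> * norm k"
proof -
  define C where "C = (\<lambda>x. of_real (\<epsilon>\<^sup>2) *\<^sub>C orth_proj M x + (- 1) *\<^sub>C (X\<^sup>\<star> \<circ> X) x)"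
  have XX: "X\<^sup>\<star> \<circ> X \<in> A" by (intro A_intros X)
  have C: "C \<in> A" unfolding C_def by (intro A_intros X)
  note X_clin = bopsD(1)[OF AD(1)[OF X] M]
  have dense: "norm (\<pi> X k) \<le> \<epsilon> * norm k" if k: "k \<in> cspan {\<pi> X h | X h. X \<in> A \<and> h \<in> H}" for k
  proof -
    have "\<exists>m Y h. (\<forall>i<m. Y i \<in> A \<and> h i \<in> H) \<and> k = (\<Sum>i<m::nat. \<pi> (Y i) (h i))"
      using k
    proof (induction rule: complex_vector.span_induct_alt)
      case base
      show ?case by (intro exI[of _ 0]) simp
    next
      case (step c x y)
      then obtain m Y h X' h' where
        *: "\<forall>i<m. Y i \<in> A \<and> h i \<in> H" "y = (\<Sum>i<m::nat. \<pi> (Y i) (h i))" "x = \<pi> X' h'" "X' \<in> A" "h' \<in> H"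
        by blast
      let ?Y = "Y(m := (\<lambda>x. c *\<^sub>C X' x))" and ?h = "h(m := h')"
      have "(\<forall>i<Suc m. ?Y i \<in> A \<and> ?h i \<in> H) \<and> c *\<^sub>C x + y = (\<Sum>i<Suc m. \<pi> (?Y i) (?h i))"
        using * AD(4) by (auto simp: less_Suc_eq \<pi>_scale add.commute)
      then show ?case by blast
    qed
    then obtain m Y h where Y: "\<And>i. i < m \<Longrightarrow> Y i \<in> A" and h: "\<And>i. i < m \<Longrightarrow> h i \<in> H"
      and k: "k = (\<Sum>i<m::nat. \<pi> (Y i) (h i))" by blast
    define W where "W i j = (Y i)\<^sup>\<star> \<circ> (C \<circ> Y j)" for i j
    have W: "W i j \<in> A" if "i < m" "j < m" for i j
      unfolding W_def by (intro A_intros C Y that)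
    have "positive_matrix M m W"
      unfolding positive_matrix_def
    proof (intro allI impI)
      fix g assume "\<forall>i<m. g i \<in> M"
      define u where "u = (\<Sum>i<m. Y i (g i))"
      have u: "u \<in> M"
        unfolding u_def using bopsD(2)[OF AD(1)[OF Y] M] by (intro closed_csubspaceD(5)[OF M]) simp
      note C_clin = bopsD(1)[OF AD(1)[OF C] M]
      have "(\<Sum>i<m. \<Sum>j<m. cinner (g i) (W i j (g j))) =
          (\<Sum>i<m. \<Sum>j<m. cinner (Y i (g i)) (C (Y j (g j))))"
        unfolding W_def using cinner_cadjoint_right[OF bopsD(1)[OF AD(1)[OF Y] M]]
        by (intro sum.cong) auto
      also have "\<dots> = cinner u (C u)"
        unfolding u_def cinner_sum_left
        by (simp only: bounded_clinearD(5)[OF C_clin] cinner_sum_right)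
      also have "\<dots> = of_real (\<epsilon>\<^sup>2 * (norm u)\<^sup>2 - (norm (X u))\<^sup>2)"
        by (simp add: C_def orth_proj_id[OF M u] cinner_linear cinner_minus_right
          cinner_cadjoint_right[OF X_clin] cinner_self)
      finally have "(\<Sum>i<m. \<Sum>j<m. cinner (g i) (W i j (g j))) =
          of_real (\<epsilon>\<^sup>2 * (norm u)\<^sup>2 - (norm (X u))\<^sup>2)" .
      moreover have "(norm (X u))\<^sup>2 \<le> \<epsilon>\<^sup>2 * (norm u)\<^sup>2"
        using power_mono[OF bound[OF u], of 2] by (simp add: power_mult_distrib)
      ultimately show "(\<Sum>i<m. \<Sum>j<m. cinner (g i) (W i j (g j))) \<in> \<real>\<^sub>\<ge>\<^sub>0"
        by (simp only: nonneg_Reals_of_real_iff diff_ge_0_iff_ge)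
    qed
    then have "positive_matrix H m (\<lambda>i j. \<phi> (W i j))"
      using ucp W unfolding unital_completely_positive_def by blast
    then have "(\<Sum>i<m. \<Sum>j<m. cinner (h i) (\<phi> (W i j) (h j))) \<in> \<real>\<^sub>\<ge>\<^sub>0"
      unfolding positive_matrix_def using h by blast
    also have "(\<Sum>i<m. \<Sum>j<m. cinner (h i) (\<phi> (W i j) (h j))) =
        (\<Sum>i<m. \<Sum>j<m. cinner (\<pi> (Y i) (h i)) (\<pi> C (\<pi> (Y j) (h j))))"
    proof (intro sum.cong refl)
      fix i j assume ij: "i \<in> {..<m}" "j \<in> {..<m}"
      have "\<pi> (W i j) = (\<pi> (Y i))\<^sup>\<star> \<circ> (\<pi> C \<circ> \<pi> (Y j))"
        unfolding W_def using ij by (simp add: \<pi>_comp \<pi>_adj A_intros Y C)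
      then show "cinner (h i) (\<phi> (W i j) (h j)) = cinner (\<pi> (Y i) (h i)) (\<pi> C (\<pi> (Y j) (h j)))"
        using ij by (simp add: cinner_\<phi> W h cinner_cadjoint_right \<pi>_clin Y)
    qed
    also have "\<dots> = cinner k (\<pi> C k)"
      unfolding k cinner_sum_left
      by (simp only: bounded_clinearD(5)[OF \<pi>_clin[OF C]] cinner_sum_right)
    also have "\<dots> = of_real (\<epsilon>\<^sup>2 * (norm k)\<^sup>2 - (norm (\<pi> X k))\<^sup>2)"
    proof -
      have "k \<in> K" using that closure_subset by (auto simp: K_eq)
      have "\<pi> C = (\<lambda>h. of_real (\<epsilon>\<^sup>2) *\<^sub>C orth_proj K h + (- 1) *\<^sub>C ((\<pi> X)\<^sup>\<star> \<circ> \<pi> X) h)"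
        unfolding C_def \<pi>_add[OF AD(4)[OF AD(2)] AD(4)[OF XX]] \<pi>_scale[OF AD(2)] \<pi>_scale[OF XX]
          \<pi>_one \<pi>_comp[OF AD(6)[OF X] X] \<pi>_adj[OF X] ..
      then show ?thesis
        by (simp add: orth_proj_id[OF K \<open>k \<in> K\<close>] cinner_linear cinner_minus_right
            cinner_cadjoint_right[OF \<pi>_clin[OF X]] cinner_self)
    qed
    finally have "(norm (\<pi> X k))\<^sup>2 \<le> (\<epsilon> * norm k)\<^sup>2"
      by (simp only: nonneg_Reals_of_real_iff diff_ge_0_iff_ge power_mult_distrib)
    then show ?thesis by (rule power2_le_imp_le) (simp add: \<open>\<epsilon> \<ge> 0\<close>)
  qed
  have "\<exists>s. (\<forall>n. s n \<in> cspan {\<pi> X h | X h. X \<in> A \<and> h \<in> H}) \<and> s \<longlonglongrightarrow> k"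
    using k[unfolded K_eq] unfolding closure_sequential .
  then obtain s where s: "\<forall>n. s n \<in> cspan {\<pi> X h | X h. X \<in> A \<and> h \<in> H}" "s \<longlonglongrightarrow> k"
    by (elim exE conjE) (rule that)
  show ?thesis
  proof (rule LIMSEQ_le)
    show "(\<lambda>n. norm (\<pi> X (s n))) \<longlonglongrightarrow> norm (\<pi> X k)"
      by (intro tendsto_norm bounded_clinearD(6)[OF \<pi>_clin[OF X]] s)
    show "(\<lambda>n. \<epsilon> * norm (s n)) \<longlonglongrightarrow> \<epsilon> * norm k"
      by (intro tendsto_intros s)
  qed (use dense[OF s(1)[rule_format]] in blast)
qed

lemma \<pi>_sum:
  assumes "\<And>k. k \<in> I \<Longrightarrow> F k \<in> A" "finite I"
  shows "(\<lambda>x. \<Sum>k\<in>I. F k x) \<in> A \<and> \<pi> (\<lambda>x. \<Sum>k\<in>I. F k x) = (\<lambda>h. \<Sum>k\<in>I. \<pi> (F k) h)"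
  using assms(2,1)
proof (induction I rule: finite_induct)
  case empty
  then show ?case using AD(4)[OF AD(2), of 0] \<pi>_scale[OF AD(2), of 0] by simp
next
  case (insert k I)
  then show ?case
    using AD(3)[of "F k" "\<lambda>x. \<Sum>k\<in>I. F k x"] \<pi>_add[of "F k" "\<lambda>x. \<Sum>k\<in>I. F k x"] by auto
qed

lemma \<pi>_level:
  fixes B :: "'n::finite \<Rightarrow> 'b \<Rightarrow> 'b"
  assumes B: "\<And>i. B i \<in> A"
  shows "level M B m \<in> A \<and> \<pi> (level M B m) = level K (\<lambda>i. \<pi> (B i)) m"
proof (induction m)
  case 0
  then show ?case by (simp add: AD(2) \<pi>_one)
next
  case (Suc m)
  then have mem: "level M B m \<in> A" and eq: "\<pi> (level M B m) = level K (\<lambda>i. \<pi> (B i)) m" by auto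
  have *: "B k \<circ> (level M B m \<circ> (B k)\<^sup>\<star>) \<in> A" for k by (intro A_intros B mem)
  have "\<pi> (B k \<circ> (level M B m \<circ> (B k)\<^sup>\<star>)) =
      \<pi> (B k) \<circ> (level K (\<lambda>i. \<pi> (B i)) m \<circ> (\<pi> (B k))\<^sup>\<star>)" for k
    by (simp add: \<pi>_comp A_intros B mem \<pi>_adj eq)
  then show ?case
    using \<pi>_sum[of UNIV "\<lambda>k. B k \<circ> (level M B m \<circ> (B k)\<^sup>\<star>)"] *
    by (simp add: level.simps(2))
qed

lemma \<pi>_inv_number:
  fixes B :: "'n::finite \<Rightarrow> 'b \<Rightarrow> 'b"
  assumes B: "\<And>i. B i \<in> A"
  shows "inv_number M B n \<in> A \<and> \<pi> (inv_number M B n) = inv_number K (\<lambda>i. \<pi> (B i)) n"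
proof -
  note lev = \<pi>_level[of B, OF B]
  let ?F = "\<lambda>m x. (1 / of_nat (Suc m)) *\<^sub>C level M B m x +
    (- (1 / of_nat (Suc m))) *\<^sub>C level M B (Suc m) x"
  have lev_A: "level M B m \<in> A" and lev_\<pi>: "\<pi> (level M B m) = level K (\<lambda>i. \<pi> (B i)) m" for m
    using lev by blast+
  have mem: "?F m \<in> A" for m by (intro A_intros lev_A)
  have "\<pi> (?F m) = (\<lambda>h. (1 / of_nat (Suc m)) *\<^sub>C level K (\<lambda>i. \<pi> (B i)) m h +
      (- (1 / of_nat (Suc m))) *\<^sub>C level K (\<lambda>i. \<pi> (B i)) (Suc m) h)" for m
    by (simp only: \<pi>_add[OF AD(4)[OF lev_A] AD(4)[OF lev_A]] \<pi>_scale[OF lev_A] lev_\<pi>)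
  then show ?thesis
    using \<pi>_sum[of "{..<n}" ?F] mem
    by (simp add: inv_number_def[abs_def] complex_vector.scale_right_diff_distrib del: of_nat_Suc)
qed

lemma fock_relations_\<pi>:
  fixes B :: "'n::finite \<Rightarrow> 'b \<Rightarrow> 'b"
  assumes B: "\<And>i. B i \<in> A" and rel: "fock_relations q M B"
  shows "fock_relations q K (\<lambda>i. \<pi> (B i))"
proof -
  let ?Q = "\<lambda>i. \<pi> (B i)"
  note lev = \<pi>_level[of B, OF B]
  have lev_A: "level M B m \<in> A" for m using lev by blast
  note inv = \<pi>_inv_number[of B, OF B]
  have Q: "op_tuple K ?Q" by (simp add: op_tuple_def \<pi>_bops B)
  have B_tuple: "op_tuple M B" using rel by (simp add: fock_relations_def)
  note MD = closed_csubspaceD[OF M]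
  have shift: "(?Q i)\<^sup>\<star> (level K ?Q (Suc m) x) = level K ?Q m ((?Q i)\<^sup>\<star> x)" for i m x
  proof -
    have "(B i)\<^sup>\<star> \<circ> level M B (Suc m) = level M B m \<circ> (B i)\<^sup>\<star>"
    proof (rule bops_eqI[OF M])
      show "(B i)\<^sup>\<star> \<circ> level M B (Suc m) \<in> bops M" "level M B m \<circ> (B i)\<^sup>\<star> \<in> bops M"
        by (intro AD(1) A_intros lev_A B)+
    qed (use rel in \<open>auto simp: fock_relations_def\<close>)
    then have "\<pi> ((B i)\<^sup>\<star> \<circ> level M B (Suc m)) = \<pi> (level M B m \<circ> (B i)\<^sup>\<star>)" by simp
    then show ?thesis using lev by (simp add: \<pi>_comp AD(6) B \<pi>_adj fun_eq_iff)
  qed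
  have idem: "level K ?Q m (level K ?Q m x) = level K ?Q m x" for m x
  proof -
    have "level M B m \<circ> level M B m = level M B m"
    proof (rule bops_eqI[OF M])
      show "level M B m \<circ> level M B m \<in> bops M" "level M B m \<in> bops M"
        by (intro AD(1) A_intros lev_A)+
    qed (use rel in \<open>auto simp: fock_relations_def\<close>)
    then have "\<pi> (level M B m \<circ> level M B m) = \<pi> (level M B m)" by simp
    then show ?thesis using lev by (simp add: \<pi>_comp fun_eq_iff)
  qed
  have est: "norm ((?Q i)\<^sup>\<star> (?Q j x) - (q i j *\<^sub>C ?Q j ((?Q i)\<^sup>\<star> (x - inv_number K ?Q n x)) +
      (if i = j then inv_number K ?Q n x else 0))) \<le> 4 / Suc n * norm x" if x: "x \<in> K" for i j n x
  proof -
    define c where "c = (if i = j then - 1 else 0 :: complex)"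
    \<comment> \<open>The difference to be estimated, written with the operations of the algebra.\<close>
    let ?X = "\<lambda>x. ((B i)\<^sup>\<star> \<circ> B j) x + ((- q i j) *\<^sub>C (B j \<circ> (B i)\<^sup>\<star>) x +
      (q i j *\<^sub>C (B j \<circ> ((B i)\<^sup>\<star> \<circ> inv_number M B n)) x + c *\<^sub>C inv_number M B n x))"
    have X: "?X \<in> A" using inv by (intro A_intros B) blast+
    have "norm (\<pi> ?X x) \<le> 4 / real (Suc n) * norm x"
    proof (rule norm_\<pi>_le[OF X _ _ x])
      fix y assume y: "y \<in> M"
      have eq: "?X y = (B i)\<^sup>\<star> (B j y) - (q i j *\<^sub>C B j ((B i)\<^sup>\<star> (y - inv_number M B n y)) +
          (if i = j then inv_number M B n y else 0))"
        by (simp add: c_def bounded_clinearD[OF op_tuple_clinear[OF M B_tuple]]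
          bounded_clinearD[OF adjoint_clinear[OF M B_tuple]] complex_vector.scale_right_diff_distrib)
      show "norm (?X y) \<le> 4 / real (Suc n) * norm y"
        unfolding eq using rel y unfolding fock_relations_def by blast
    qed simp
    moreover have "\<pi> ?X x = (?Q i)\<^sup>\<star> (?Q j x) - (q i j *\<^sub>C ?Q j ((?Q i)\<^sup>\<star> (x - inv_number K ?Q n x)) +
          (if i = j then inv_number K ?Q n x else 0))"
    proof -
      have 1: "(B i)\<^sup>\<star> \<circ> B j \<in> A" "B j \<circ> (B i)\<^sup>\<star> \<in> A" "inv_number M B n \<in> A"
        "(B i)\<^sup>\<star> \<circ> inv_number M B n \<in> A" "B j \<circ> ((B i)\<^sup>\<star> \<circ> inv_number M B n) \<in> A"
        using inv by (auto intro!: A_intros B)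
      have "\<pi> ?X x = \<pi> ((B i)\<^sup>\<star> \<circ> B j) x + ((- q i j) *\<^sub>C \<pi> (B j \<circ> (B i)\<^sup>\<star>) x +
          (q i j *\<^sub>C \<pi> (B j \<circ> ((B i)\<^sup>\<star> \<circ> inv_number M B n)) x + c *\<^sub>C \<pi> (inv_number M B n) x))"
        by (simp only: \<pi>_add \<pi>_scale 1 AD(3) AD(4))
      also have "\<dots> = (?Q i)\<^sup>\<star> (?Q j x) - (q i j *\<^sub>C ?Q j ((?Q i)\<^sup>\<star> (x - inv_number K ?Q n x)) +
          (if i = j then inv_number K ?Q n x else 0))"
        using inv[of n] by (simp add: c_def \<pi>_comp 1 AD(6) B \<pi>_adj
          bounded_clinearD[OF op_tuple_clinear[OF K Q]] bounded_clinearD[OF adjoint_clinear[OF K Q]]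
          complex_vector.scale_right_diff_distrib)
      finally show ?thesis .
    qed
    ultimately show ?thesis by simp
  qed
  show ?thesis
    unfolding fock_relations_def using K Q shift idem est by blast
qed

text \<open>The operators \<open>X\<close> such that \<open>N\<close> is invariant under \<open>\<pi> X\<close> and its adjoint form a \<open>C\<^sup>*\<close>-algebra,
  which is norm closed since \<open>\<pi>\<close> is contractive. So invariance need only be checked on generators.\<close>

lemma K_least:
  fixes B :: "'n::finite \<Rightarrow> 'b \<Rightarrow> 'b"
  assumes gen: "A = generated_cstar M B" and N: "closed_csubspace N" "H \<subseteq> N" "N \<subseteq> K"
    and inv: "\<And>i x. x \<in> N \<Longrightarrow> \<pi> (B i) x \<in> N" "\<And>i x. x \<in> N \<Longrightarrow> (\<pi> (B i))\<^sup>\<star> x \<in> N"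
  shows "N = K"
proof -
  define A' where "A' = {X\<in>A. \<forall>x\<in>N. \<pi> X x \<in> N \<and> (\<pi> X)\<^sup>\<star> x \<in> N}"
  note ND = closed_csubspaceD[OF N(1)]
  have lim: "\<pi> X x \<in> N" if F: "\<And>k::nat. F k \<in> A" and X: "X \<in> A"
    and conv: "(\<lambda>k. onorm (\<lambda>x. F k x - X x)) \<longlonglongrightarrow> 0" and x: "x \<in> N" and FN: "\<And>k. \<pi> (F k) x \<in> N" for F X x
  proof (rule ND(6))
    have D: "(\<lambda>x. F k x + (- 1) *\<^sub>C X x) \<in> A" for k by (intro A_intros F X)
    have "bounded_linear (\<lambda>x. F k x + (- 1) *\<^sub>C X x)" for k
      by (rule bounded_clinearD(8)[OF bopsD(1)[OF AD(1)[OF D] M]])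
    then have bl: "bounded_linear (\<lambda>x. F k x - X x)" for k by simp
    have "norm (\<pi> (\<lambda>x. F k x + (- 1) *\<^sub>C X x) x) \<le> onorm (\<lambda>x. F k x - X x) * norm x" for k
      using onorm[OF bl] x N(3) onorm_pos_le[OF bl] by (intro norm_\<pi>_le[OF D]) auto
    moreover have "\<pi> (\<lambda>x. F k x + (- 1) *\<^sub>C X x) x = \<pi> (F k) x - \<pi> X x" for k
      unfolding \<pi>_add[OF F AD(4)[OF X]] \<pi>_scale[OF X] by simp
    ultimately have "norm (\<pi> (F k) x - \<pi> X x) \<le> onorm (\<lambda>x. F k x - X x) * norm x" for k
      by simp
    then have "(\<lambda>k. \<pi> (F k) x - \<pi> X x) \<longlonglongrightarrow> 0"
      by (intro Lim_null_comparison[OF always_eventually tendsto_mult_left_zero[OF conv, of "norm x"]]) blast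
    then show "(\<lambda>k. \<pi> (F k) x) \<longlonglongrightarrow> \<pi> X x" by (rule LIM_zero_cancel)
  qed (rule FN)
  have "unital_cstar_subalgebra M A'"
    unfolding unital_cstar_subalgebra_def[of M A']
  proof (intro conjI ballI allI impI)
    show "A' \<subseteq> bops M" using AD(1) by (auto simp: A'_def)
    show "orth_proj M \<in> A'"
      using AD(2) N(3) by (auto simp: A'_def \<pi>_one cadjoint_orth_proj[OF K] orth_proj_id[OF K] subset_iff)
    fix X Y assume XY: "X \<in> A'" "Y \<in> A'"
    then have mem: "X \<in> A" "Y \<in> A" by (auto simp: A'_def)
    note clin = \<pi>_clin[OF mem(1)] \<pi>_clin[OF mem(2)]
    have "(\<lambda>h. \<pi> X h + \<pi> Y h)\<^sup>\<star> = (\<lambda>h. (\<pi> X)\<^sup>\<star> h + (\<pi> Y)\<^sup>\<star> h)"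
      by (rule cadjoint_eqI) (simp add: cinner_linear cinner_cadjoint_right clin)
    then show "(\<lambda>x. X x + Y x) \<in> A'"
      using XY AD(3)[OF mem] ND(2) by (auto simp: A'_def \<pi>_add)
    have "(\<pi> X \<circ> \<pi> Y)\<^sup>\<star> = (\<pi> Y)\<^sup>\<star> \<circ> (\<pi> X)\<^sup>\<star>"
      by (rule cadjoint_eqI) (simp add: cinner_cadjoint_right clin)
    then show "X \<circ> Y \<in> A'"
      using XY AD(5)[OF mem] by (auto simp: A'_def \<pi>_comp)
  next
    fix c X assume X: "X \<in> A'"
    then have mem: "X \<in> A" by (auto simp: A'_def)
    have "(\<lambda>h. c *\<^sub>C \<pi> X h)\<^sup>\<star> = (\<lambda>h. cnj c *\<^sub>C (\<pi> X)\<^sup>\<star> h)"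
      by (rule cadjoint_eqI) (simp add: cinner_linear cinner_cadjoint_right \<pi>_clin mem)
    then show "(\<lambda>x. c *\<^sub>C X x) \<in> A'"
      using X AD(4)[OF mem] ND(3) by (auto simp: A'_def \<pi>_scale)
  next
    fix X assume X: "X \<in> A'"
    then show "X\<^sup>\<star> \<in> A'"
      using AD(6) by (auto simp: A'_def \<pi>_adj cadjoint_cadjoint \<pi>_clin)
  next
    fix F X assume F: "(\<forall>k::nat. F k \<in> A') \<and> X \<in> bops M \<and> (\<lambda>k. onorm (\<lambda>x. F k x - X x)) \<longlonglongrightarrow> 0"
    then have FA: "F k \<in> A" for k by (auto simp: A'_def)
    then have XA: "X \<in> A" using F AD(7) by blast
    note F_clin = bopsD(1)[OF AD(1)[OF FA] M] and X_clin = bopsD(1)[OF AD(1)[OF XA] M]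
    have adj: "(\<lambda>k. onorm (\<lambda>x. (F k)\<^sup>\<star> x - (X)\<^sup>\<star> x)) \<longlonglongrightarrow> 0"
    proof (rule Lim_null_comparison[OF always_eventually])
      show "(\<lambda>k. onorm (\<lambda>x. F k x - X x)) \<longlonglongrightarrow> 0" using F by blast
      show "\<forall>k. norm (onorm (\<lambda>x. (F k)\<^sup>\<star> x - X\<^sup>\<star> x)) \<le> onorm (\<lambda>x. F k x - X x)"
      proof
        fix k
        have "bounded_clinear (\<lambda>x. F k x + (- 1) *\<^sub>C X x)"
          by (intro bounded_clinear_add bounded_clinear_scale F_clin X_clin)
        then have D: "bounded_clinear (\<lambda>x. F k x - X x)" by simp
        have eq: "(\<lambda>x. F k x - X x)\<^sup>\<star> = (\<lambda>x. (F k)\<^sup>\<star> x - X\<^sup>\<star> x)"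
          by (rule cadjoint_eqI) (simp add: cinner_linear cinner_cadjoint_right F_clin X_clin)
        note bl = bounded_clinearD(8)[OF D]
        have "norm ((F k)\<^sup>\<star> x - X\<^sup>\<star> x) \<le> onorm (\<lambda>x. F k x - X x) * norm x" for x
          using norm_cadjoint_le[OF D onorm[OF bl] onorm_pos_le[OF bl]] unfolding eq .
        then have "onorm (\<lambda>x. (F k)\<^sup>\<star> x - X\<^sup>\<star> x) \<le> onorm (\<lambda>x. F k x - X x)"
          by (intro onorm_bound onorm_pos_le[OF bl])
        moreover have "0 \<le> onorm (\<lambda>x. (F k)\<^sup>\<star> x - X\<^sup>\<star> x)"
          using bounded_clinearD(8)[OF bounded_clinear_cadjoint[OF D]] unfolding eq by (rule onorm_pos_le)
        ultimately show "norm (onorm (\<lambda>x. (F k)\<^sup>\<star> x - X\<^sup>\<star> x)) \<le> onorm (\<lambda>x. F k x - X x)" by simp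
      qed
    qed
    have "\<pi> X x \<in> N \<and> (\<pi> X)\<^sup>\<star> x \<in> N" if x: "x \<in> N" for x
    proof
      show "\<pi> X x \<in> N"
        by (rule lim[of F]) (use F FA XA x in \<open>auto simp: A'_def\<close>)
      have "\<pi> (X\<^sup>\<star>) x \<in> N"
        by (rule lim[of "\<lambda>k. (F k)\<^sup>\<star>"]) (use F FA XA x adj AD(6) in \<open>auto simp: A'_def \<pi>_adj\<close>)
      then show "(\<pi> X)\<^sup>\<star> x \<in> N" using \<pi>_adj[OF XA] by simp
    qed
    then show "X \<in> A'" using XA by (simp add: A'_def)
  qed
  moreover have "range B \<subseteq> A'"
    using range_subset_generated_cstar[of B M] inv by (auto simp: A'_def gen)
  ultimately have "A \<subseteq> A'" using generated_cstar_least gen by blast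
  then have "{\<pi> X h | X h. X \<in> A \<and> h \<in> H} \<subseteq> N"
    using N(2) by (auto simp: A'_def)
  then have "K \<subseteq> N"
    unfolding K_eq using N(1)
    by (intro closure_minimal complex_vector.span_minimal) (simp_all add: closed_csubspace_def)
  then show ?thesis using N(3) by blast
qed

end

section \<open>Couplings\<close>

text \<open>A coupling is the graph of an inner product preserving map between subspaces of \<open>M\<close> and \<open>K\<close>
  which are invariant under the adjoints of \<open>Z\<close> and \<open>Q\<close>, and which intertwines these adjoints.\<close>

definition coupling ::
  "'a::complex_hilbert_space set \<Rightarrow> ('n \<Rightarrow> 'a \<Rightarrow> 'a) \<Rightarrow>
    'b::complex_hilbert_space set \<Rightarrow> ('n \<Rightarrow> 'b \<Rightarrow> 'b) \<Rightarrow> ('a \<times> 'b) set \<Rightarrow> bool" where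
  "coupling M Z K Q N \<longleftrightarrow> N \<subseteq> M \<times> K \<and> (0, 0) \<in> N \<and>
     (\<forall>x y x' y' c. (x, y) \<in> N \<longrightarrow> (x', y') \<in> N \<longrightarrow> (c *\<^sub>C x + x', c *\<^sub>C y + y') \<in> N) \<and>
     (\<forall>x y x' y'. (x, y) \<in> N \<longrightarrow> (x', y') \<in> N \<longrightarrow> cinner x x' = cinner y y') \<and>
     (\<forall>i x y. (x, y) \<in> N \<longrightarrow> ((Z i)\<^sup>\<star> x, (Q i)\<^sup>\<star> y) \<in> N)"

lemma couplingD:
  assumes "coupling M Z K Q N"
  shows "N \<subseteq> M \<times> K" "(0, 0) \<in> N"
    "(x, y) \<in> N \<Longrightarrow> (x', y') \<in> N \<Longrightarrow> (c *\<^sub>C x + x', c *\<^sub>C y + y') \<in> N"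
    "(x, y) \<in> N \<Longrightarrow> (x', y') \<in> N \<Longrightarrow> cinner x x' = cinner y y'"
    "(x, y) \<in> N \<Longrightarrow> ((Z i)\<^sup>\<star> x, (Q i)\<^sup>\<star> y) \<in> N"
    "(x, y) \<in> N \<Longrightarrow> (x', y') \<in> N \<Longrightarrow> (x + x', y + y') \<in> N"
    "(x, y) \<in> N \<Longrightarrow> (x', y') \<in> N \<Longrightarrow> (x - x', y - y') \<in> N"
    "(x, y) \<in> N \<Longrightarrow> (c *\<^sub>C x, c *\<^sub>C y) \<in> N"
    "(x, y) \<in> N \<Longrightarrow> x \<in> M" "(x, y) \<in> N \<Longrightarrow> y \<in> K"
proof -
  note N = assms[unfolded coupling_def]
  show "N \<subseteq> M \<times> K" "(0, 0) \<in> N" using N by blast+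
  show lin: "(x, y) \<in> N \<Longrightarrow> (x', y') \<in> N \<Longrightarrow> (c *\<^sub>C x + x', c *\<^sub>C y + y') \<in> N" for x y x' y' c
    using N by blast
  show "(x, y) \<in> N \<Longrightarrow> (x', y') \<in> N \<Longrightarrow> cinner x x' = cinner y y'" using N by blast
  show "(x, y) \<in> N \<Longrightarrow> ((Z i)\<^sup>\<star> x, (Q i)\<^sup>\<star> y) \<in> N" using N by blast
  show "(x, y) \<in> N \<Longrightarrow> (x', y') \<in> N \<Longrightarrow> (x + x', y + y') \<in> N"
    using lin[of x y x' y' 1] by simp
  show "(x, y) \<in> N \<Longrightarrow> (x', y') \<in> N \<Longrightarrow> (x - x', y - y') \<in> N"
    using lin[of x' y' x y "- 1"] by simp
  show "(x, y) \<in> N \<Longrightarrow> (c *\<^sub>C x, c *\<^sub>C y) \<in> N"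
    using lin[of x y 0 0 c] N by simp
  show "(x, y) \<in> N \<Longrightarrow> x \<in> M" "(x, y) \<in> N \<Longrightarrow> y \<in> K" using N[THEN conjunct1] by auto
qed

lemma coupling_converse: "coupling M Z K Q N \<Longrightarrow> coupling K Q M Z (N\<inverse>)"
  unfolding coupling_def by auto

lemma coupling_sum:
  assumes "coupling M Z K Q N" "\<And>i. i \<in> I \<Longrightarrow> (f i, g i) \<in> N"
  shows "(sum f I, sum g I) \<in> N"
  using assms(2)
  by (induction I rule: infinite_finite_induct) (simp_all add: couplingD(2,6)[OF assms(1)])

lemma coupling_norm:
  assumes "coupling M Z K Q N" "(x, y) \<in> N" shows "norm x = norm y"
proof -
  have "complex_of_real ((norm x)\<^sup>2) = of_real ((norm y)\<^sup>2)"
    using couplingD(4)[OF assms(1,2,2)] by (simp only: cinner_self)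
  then show ?thesis by (simp only: of_real_eq_iff) simp
qed

lemma closure_seqI: "(\<And>n::nat. f n \<in> S) \<Longrightarrow> f \<longlonglongrightarrow> l \<Longrightarrow> l \<in> closure S"
  for S :: "'a::first_countable_topology set"
  unfolding closure_sequential by blast

lemma closed_seqD: "closed S \<Longrightarrow> (\<And>n::nat. f n \<in> S) \<Longrightarrow> f \<longlonglongrightarrow> l \<Longrightarrow> l \<in> S"
  for S :: "'a::first_countable_topology set"
  using closure_seqI[of f S l] by (simp add: closure_closed)

text \<open>A coupling preserves norms, so the second components of pairs whose first components converge
  form a Cauchy sequence.\<close>

lemma closed_csubspace_Domain_coupling:
  assumes N: "coupling M Z K Q N" and cl: "closed N"
  shows "closed_csubspace (Domain N)"
proof (rule closed_csubspaceI)
  show "0 \<in> Domain N" using couplingD(2)[OF N] by blast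
  show "x + y \<in> Domain N" if "x \<in> Domain N" "y \<in> Domain N" for x y
    using that couplingD(6)[OF N] by blast
  show "c *\<^sub>C x \<in> Domain N" if "x \<in> Domain N" for c x
    using that couplingD(8)[OF N] by blast
  fix X :: "nat \<Rightarrow> 'a" and x assume X: "\<And>n. X n \<in> Domain N" "X \<longlonglongrightarrow> x"
  have "\<forall>n. \<exists>y. (X n, y) \<in> N" using X(1) by blast
  then obtain Y where Y: "\<And>n. (X n, Y n) \<in> N" by metis
  have "dist (X m) (X n) = dist (Y m) (Y n)" for m n
    unfolding dist_norm by (rule coupling_norm[OF N couplingD(7)[OF N Y Y]])
  moreover have "Cauchy X" using X(2) by (rule LIMSEQ_imp_Cauchy)
  ultimately have "Cauchy Y" by (simp add: Cauchy_def)
  then obtain y where "Y \<longlonglongrightarrow> y" using Cauchy_convergent convergent_def by blast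
  then have "(\<lambda>n. (X n, Y n)) \<longlonglongrightarrow> (x, y)" by (intro tendsto_Pair X(2))
  then have "(x, y) \<in> N" by (rule closed_seqD[OF cl Y])
  then show "x \<in> Domain N" by blast
qed

lemma fock_relationsD:
  assumes "fock_relations q M B"
  shows "closed_csubspace M" "op_tuple M B"
    "x \<in> M \<Longrightarrow> (B i)\<^sup>\<star> (level M B (Suc m) x) = level M B m ((B i)\<^sup>\<star> x)"
    "x \<in> M \<Longrightarrow> level M B m (level M B m x) = level M B m x"
    "x \<in> M \<Longrightarrow> norm ((B i)\<^sup>\<star> (B j x) - (q i j *\<^sub>C B j ((B i)\<^sup>\<star> (x - inv_number M B n x)) +
      (if i = j then inv_number M B n x else 0))) \<le> 4 / Suc n * norm x"
  using assms unfolding fock_relations_def by blast+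

lemma fock_relations_tendsto:
  assumes B: "fock_relations q M B" and x: "x \<in> M"
  shows "(\<lambda>n. q i j *\<^sub>C B j ((B i)\<^sup>\<star> (x - inv_number M B n x)) +
    (if i = j then inv_number M B n x else 0)) \<longlonglongrightarrow> (B i)\<^sup>\<star> (B j x)" (is "?E \<longlonglongrightarrow> ?l")
proof -
  have "(\<lambda>n. 4 * (1 / real (Suc n)) * norm x) \<longlonglongrightarrow> 4 * 0 * norm x"
    by (intro tendsto_intros LIMSEQ_Suc[OF lim_1_over_n])
  then have lim: "(\<lambda>n. 4 / real (Suc n) * norm x) \<longlonglongrightarrow> 0" by simp
  have "(\<lambda>n. ?l - ?E n) \<longlonglongrightarrow> 0"
    by (rule Lim_null_comparison[OF always_eventually lim]) (use fock_relationsD(5)[OF B x] in blast)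
  then have "(\<lambda>n. ?E n - ?l) \<longlonglongrightarrow> 0" using tendsto_minus by fastforce
  then show ?thesis by (rule LIM_zero_cancel)
qed

context
  fixes q :: "'n::finite \<Rightarrow> 'n \<Rightarrow> complex"
    and M :: "'a::complex_hilbert_space set" and Z :: "'n \<Rightarrow> 'a \<Rightarrow> 'a"
    and K :: "'b::complex_hilbert_space set" and Q :: "'n \<Rightarrow> 'b \<Rightarrow> 'b"
  assumes Z: "fock_relations q M Z" and Q: "fock_relations q K Q"
begin

lemmas M = fock_relationsD(1)[OF Z] and Z_tuple = fock_relationsD(2)[OF Z]
  and K = fock_relationsD(1)[OF Q] and Q_tuple = fock_relationsD(2)[OF Q]

lemmas Z_clinear = op_tuple_clinear[OF M Z_tuple] and Q_clinear = op_tuple_clinear[OF K Q_tuple]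
  and Zs_clinear = adjoint_clinear[OF M Z_tuple] and Qs_clinear = adjoint_clinear[OF K Q_tuple]

lemma coupling_closure:
  assumes sub: "S \<subseteq> M \<times> K" and zero: "(0, 0) \<in> S"
    and lin: "\<And>x y x' y' c. (x, y) \<in> S \<Longrightarrow> (x', y') \<in> S \<Longrightarrow> (c *\<^sub>C x + x', c *\<^sub>C y + y') \<in> S"
    and iso: "\<And>x y x' y'. (x, y) \<in> S \<Longrightarrow> (x', y') \<in> S \<Longrightarrow> cinner x x' = cinner y y'"
    and adj: "\<And>i x y. (x, y) \<in> S \<Longrightarrow> ((Z i)\<^sup>\<star> x, (Q i)\<^sup>\<star> y) \<in> closure S"
  shows "coupling M Z K Q (closure S)"
  unfolding coupling_def
proof (intro conjI allI impI)
  have "closed (M \<times> K)"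
    using M K by (intro closed_Times) (simp_all add: closed_csubspace_def)
  then show "closure S \<subseteq> M \<times> K" by (rule closure_minimal[OF sub])
  show "(0, 0) \<in> closure S" using zero closure_subset by blast
  have seq: "\<exists>X Y. (\<forall>n. (X n, Y n) \<in> S) \<and> X \<longlonglongrightarrow> x \<and> Y \<longlonglongrightarrow> y" if xy: "(x, y) \<in> closure S" for x y
  proof -
    obtain p where p: "\<forall>n. p n \<in> S" "p \<longlonglongrightarrow> (x, y)"
      using xy unfolding closure_sequential by auto
    have "(\<lambda>n. fst (p n)) \<longlonglongrightarrow> x" "(\<lambda>n. snd (p n)) \<longlonglongrightarrow> y"
      using tendsto_fst[OF p(2)] tendsto_snd[OF p(2)] by simp_all
    then show ?thesis
      using p(1) by (intro exI[of _ "\<lambda>n. fst (p n)"] exI[of _ "\<lambda>n. snd (p n)"]) simp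
  qed
  { fix x y x' y' c assume "(x, y) \<in> closure S" "(x', y') \<in> closure S"
    then obtain X Y X' Y' where 1: "\<forall>n. (X n, Y n) \<in> S" "X \<longlonglongrightarrow> x" "Y \<longlonglongrightarrow> y"
      and 2: "\<forall>n. (X' n, Y' n) \<in> S" "X' \<longlonglongrightarrow> x'" "Y' \<longlonglongrightarrow> y'"
      using seq by metis
    show "(c *\<^sub>C x + x', c *\<^sub>C y + y') \<in> closure S"
    proof (rule closure_seqI)
      show "(\<lambda>n. (c *\<^sub>C X n + X' n, c *\<^sub>C Y n + Y' n)) \<longlonglongrightarrow> (c *\<^sub>C x + x', c *\<^sub>C y + y')"
        by (intro tendsto_Pair tendsto_add tendsto_scaleC 1 2)
    qed (use lin 1 2 in blast) }
  { fix x y x' y' assume "(x, y) \<in> closure S" "(x', y') \<in> closure S"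
    then obtain X Y X' Y' where 1: "\<forall>n. (X n, Y n) \<in> S" "X \<longlonglongrightarrow> x" "Y \<longlonglongrightarrow> y"
      and 2: "\<forall>n. (X' n, Y' n) \<in> S" "X' \<longlonglongrightarrow> x'" "Y' \<longlonglongrightarrow> y'"
      using seq by metis
    have "(\<lambda>n. cinner (X n) (X' n)) \<longlonglongrightarrow> cinner x x'" by (rule tendsto_cinner[OF 1(2) 2(2)])
    moreover have "(\<lambda>n. cinner (X n) (X' n)) = (\<lambda>n. cinner (Y n) (Y' n))"
      using iso 1(1) 2(1) by blast
    moreover have "(\<lambda>n. cinner (Y n) (Y' n)) \<longlonglongrightarrow> cinner y y'" by (rule tendsto_cinner[OF 1(3) 2(3)])
    ultimately show "cinner x x' = cinner y y'" using LIMSEQ_unique by metis }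
  fix i x y assume "(x, y) \<in> closure S"
  then obtain X Y where 1: "\<forall>n. (X n, Y n) \<in> S" "X \<longlonglongrightarrow> x" "Y \<longlonglongrightarrow> y"
    using seq by blast
  have lim: "(\<lambda>n. ((Z i)\<^sup>\<star> (X n), (Q i)\<^sup>\<star> (Y n))) \<longlonglongrightarrow> ((Z i)\<^sup>\<star> x, (Q i)\<^sup>\<star> y)"
    by (intro tendsto_Pair bounded_clinearD(6)[OF Zs_clinear] bounded_clinearD(6)[OF Qs_clinear] 1)
  show "((Z i)\<^sup>\<star> x, (Q i)\<^sup>\<star> y) \<in> closure S"
    by (rule closed_seqD[OF closed_closure _ lim]) (use adj 1(1) in blast)
qed

definition extension :: "('a \<Rightarrow> 'a) \<Rightarrow> ('b \<Rightarrow> 'b) \<Rightarrow> ('a \<times> 'b) set \<Rightarrow> ('a \<times> 'b) set" where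
  "extension A B N = {(x + A x', y + B y') | x y x' y'. (x, y) \<in> N \<and> (x', y') \<in> N}"

text \<open>If the inner products of the vectors \<open>A x\<close> among themselves and with the domain of the coupling agree
  with those of the vectors \<open>B y\<close>, and the adjoints do not lead out of the enlarged correspondence, then
  the closure of the enlargement is again a coupling. The closure is needed because the adjoints of \<open>Z j x\<close>
  are only limits of vectors of the enlargement.\<close>

lemma maximal_coupling_invariant:
  assumes N: "coupling M Z K Q N"
    and max: "\<forall>N'. coupling M Z K Q N' \<longrightarrow> N \<subseteq> N' \<longrightarrow> N' = N"
    and A: "bounded_clinear A" "\<And>x. x \<in> M \<Longrightarrow> A x \<in> M"
    and B: "bounded_clinear B" "\<And>y. y \<in> K \<Longrightarrow> B y \<in> K"
    and one: "\<And>x y x' y'. (x, y) \<in> N \<Longrightarrow> (x', y') \<in> N \<Longrightarrow> cinner x (A x') = cinner y (B y')"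
    and two: "\<And>x y x' y'. (x, y) \<in> N \<Longrightarrow> (x', y') \<in> N \<Longrightarrow> cinner (A x) (A x') = cinner (B y) (B y')"
    and adj: "\<And>i x y. (x, y) \<in> N \<Longrightarrow> ((Z i)\<^sup>\<star> (A x), (Q i)\<^sup>\<star> (B y)) \<in> closure (extension A B N)"
  shows "closed N \<and> (\<forall>x y. (x, y) \<in> N \<longrightarrow> (A x, B y) \<in> N)"
proof -
  note ND = couplingD[OF N] and MD = closed_csubspaceD[OF M] and KD = closed_csubspaceD[OF K]
  note Alin = bounded_clinearD[OF A(1)] and Blin = bounded_clinearD[OF B(1)]
  let ?S = "extension A B N"
  have "coupling M Z K Q (closure ?S)"
  proof (rule coupling_closure)
    show "?S \<subseteq> M \<times> K"
      proof
      fix p assume "p \<in> ?S"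
      then obtain x y z w where "p = (x + A z, y + B w)" "(x, y) \<in> N" "(z, w) \<in> N"
        unfolding extension_def by blast
      then show "p \<in> M \<times> K"
        using MD(2)[OF ND(9) A(2)[OF ND(9)]] KD(2)[OF ND(10) B(2)[OF ND(10)]] by simp
    qed
    have "(0 + A 0, 0 + B 0) \<in> ?S" unfolding extension_def using ND(2) by blast
    then show "(0, 0) \<in> ?S" by (simp add: Alin Blin)
    fix u v u' v' c assume "(u, v) \<in> ?S" "(u', v') \<in> ?S"
    then obtain x y z w x' y' z' w' where
      u: "u = x + A z" "v = y + B w" "(x, y) \<in> N" "(z, w) \<in> N" and
      u': "u' = x' + A z'" "v' = y' + B w'" "(x', y') \<in> N" "(z', w') \<in> N"
      unfolding extension_def by blast
    have "c *\<^sub>C u + u' = (c *\<^sub>C x + x') + A (c *\<^sub>C z + z')" "c *\<^sub>C v + v' = (c *\<^sub>C y + y') + B (c *\<^sub>C w + w')"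
      by (simp_all add: u u' Alin Blin scaleC_add_right)
    then show "(c *\<^sub>C u + u', c *\<^sub>C v + v') \<in> ?S"
      unfolding extension_def using ND(3) u u' by blast
    have "cinner (A z) x' = cinner (B w) y'"
      using one[OF u'(3) u(4)] by (metis cinner_commute)
    then show "cinner u u' = cinner v v'"
      unfolding u u' using ND(4)[OF u(3) u'(3)] one[OF u(3) u'(4)] two[OF u(4) u'(4)]
      by (simp add: cinner_add_left cinner_add_right)
  next
    have embed: "(x, y) \<in> ?S" if "(x, y) \<in> N" for x y
    proof -
      have "(x + A 0, y + B 0) \<in> ?S" unfolding extension_def using that ND(2) by blast
      then show ?thesis by (simp add: Alin Blin)
    qed
    fix i u v assume "(u, v) \<in> ?S"
    then obtain x y z w where u: "u = x + A z" "v = y + B w" "(x, y) \<in> N" "(z, w) \<in> N"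
      unfolding extension_def by blast
    obtain s where s: "\<forall>n. s n \<in> ?S" "s \<longlonglongrightarrow> ((Z i)\<^sup>\<star> (A z), (Q i)\<^sup>\<star> (B w))"
      using adj[OF u(4), of i] unfolding closure_sequential by auto
    let ?a = "((Z i)\<^sup>\<star> x, (Q i)\<^sup>\<star> y)"
    have "?a + s n \<in> ?S" for n
    proof -
      obtain x' y' z' w' where sn: "s n = (x' + A z', y' + B w')" "(x', y') \<in> N" "(z', w') \<in> N"
        using s(1)[rule_format, of n] unfolding extension_def by blast
      have "((Z i)\<^sup>\<star> x + x', (Q i)\<^sup>\<star> y + y') \<in> N" by (intro ND(6) ND(5) u(3) sn)
      then have "(((Z i)\<^sup>\<star> x + x') + A z', ((Q i)\<^sup>\<star> y + y') + B w') \<in> ?S"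
        unfolding extension_def using sn(3) by blast
      then show ?thesis by (simp add: sn(1) add.assoc)
    qed
    moreover have "(\<lambda>n. ?a + s n) \<longlonglongrightarrow> ?a + ((Z i)\<^sup>\<star> (A z), (Q i)\<^sup>\<star> (B w))"
      by (intro tendsto_add tendsto_const s(2))
    ultimately have "?a + ((Z i)\<^sup>\<star> (A z), (Q i)\<^sup>\<star> (B w)) \<in> closure ?S"
      by (rule closure_seqI)
    then show "((Z i)\<^sup>\<star> u, (Q i)\<^sup>\<star> v) \<in> closure ?S"
      by (simp add: u bounded_clinearD(1)[OF Zs_clinear] bounded_clinearD(1)[OF Qs_clinear])
  qed
  moreover have "N \<subseteq> ?S"
  proof
    fix p assume "p \<in> N"
    then obtain x y where p: "p = (x, y)" "(x, y) \<in> N" by (cases p) auto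
    have "(x + A 0, y + B 0) \<in> ?S" unfolding extension_def using p ND(2) by blast
    then show "p \<in> ?S" by (simp add: Alin Blin p)
  qed
  ultimately have eq: "closure ?S = N" using max closure_subset by (metis subset_trans)
  have "(A x, B y) \<in> N" if "(x, y) \<in> N" for x y
  proof -
    have "(0 + A x, 0 + B y) \<in> ?S" unfolding extension_def using ND(2) that by blast
    then show ?thesis using eq closure_subset by auto
  qed
  moreover have "closed N" using eq by (metis closed_closure)
  ultimately show ?thesis by blast
qed

lemma subset_extension:
  assumes N: "coupling M Z K Q N" and A: "bounded_clinear A" and B: "bounded_clinear B"
  shows "N \<subseteq> closure (extension A B N)"
proof
  fix p assume "p \<in> N"
  then obtain x y where p: "p = (x, y)" "(x, y) \<in> N" by (cases p) auto
  have "(x + A 0, y + B 0) \<in> extension A B N"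
    unfolding extension_def using p couplingD(2)[OF N] by blast
  then show "p \<in> closure (extension A B N)"
    using closure_subset by (auto simp: bounded_clinearD[OF A] bounded_clinearD[OF B] p)
qed

lemma ex_maximal_coupling:
  assumes "coupling M Z K Q N0"
  shows "\<exists>N. coupling M Z K Q N \<and> N0 \<subseteq> N \<and> (\<forall>N'. coupling M Z K Q N' \<longrightarrow> N \<subseteq> N' \<longrightarrow> N' = N)"
proof -
  let ?C = "{N. coupling M Z K Q N \<and> N0 \<subseteq> N}"
  have "\<exists>N\<in>?C. \<forall>N'\<in>?C. N \<subseteq> N' \<longrightarrow> N' = N"
  proof (rule subset_Zorn_nonempty)
    show "?C \<noteq> {}" using assms by blast
    fix \<C> assume ne: "\<C> \<noteq> {}" and chain: "subset.chain ?C \<C>"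
    then have c: "\<And>N. N \<in> \<C> \<Longrightarrow> coupling M Z K Q N" and sub: "\<And>N. N \<in> \<C> \<Longrightarrow> N0 \<subseteq> N"
      unfolding subset.chain_def by blast+
    have common: "\<exists>N\<in>\<C>. p \<in> N \<and> p' \<in> N" if "p \<in> \<Union>\<C>" "p' \<in> \<Union>\<C>" for p p'
    proof -
      obtain N N' where N: "N \<in> \<C>" "p \<in> N" "N' \<in> \<C>" "p' \<in> N'" using \<open>p \<in> \<Union>\<C>\<close> \<open>p' \<in> \<Union>\<C>\<close> by blast
      then have "N \<subseteq> N' \<or> N' \<subseteq> N" using chain unfolding subset_chain_def by blast
      then show ?thesis using N by blast
    qed
    have "coupling M Z K Q (\<Union>\<C>)"
      unfolding coupling_def
    proof (intro conjI allI impI)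
      show "\<Union>\<C> \<subseteq> M \<times> K" using couplingD(1)[OF c] by blast
      show "(0, 0) \<in> \<Union>\<C>" using couplingD(2)[OF c] ne by blast
      show "((Z i)\<^sup>\<star> x, (Q i)\<^sup>\<star> y) \<in> \<Union>\<C>" if "(x, y) \<in> \<Union>\<C>" for i x y
        using couplingD(5)[OF c] that by blast
      fix x y x' y' c' assume "(x, y) \<in> \<Union>\<C>" "(x', y') \<in> \<Union>\<C>"
      then obtain N where N: "N \<in> \<C>" "(x, y) \<in> N" "(x', y') \<in> N" using common by blast
      show "(c' *\<^sub>C x + x', c' *\<^sub>C y + y') \<in> \<Union>\<C>" using couplingD(3)[OF c] N by blast
      show "cinner x x' = cinner y y'" using couplingD(4)[OF c] N by blast
    qed
    then show "\<Union>\<C> \<in> ?C" using sub ne by blast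
  qed
  then obtain N where "N \<in> ?C" and max: "\<forall>N'\<in>?C. N \<subseteq> N' \<longrightarrow> N' = N" by (elim bexE)
  then have N: "coupling M Z K Q N" "N0 \<subseteq> N" by simp_all
  moreover have "N' = N" if "coupling M Z K Q N'" "N \<subseteq> N'" for N'
    using max that N(2) by simp
  ultimately show ?thesis by blast
qed

text \<open>The relations for the adjoint of \<open>Z i\<close> on \<open>Z j x\<close> involve the levels of \<open>x\<close>. So a maximal coupling
  is shown to be invariant under the levels first, by induction, and then under \<open>Z j\<close>.\<close>

lemma ex_creation_invariant_coupling:
  assumes N0: "coupling M Z K Q N0"
  shows "\<exists>N. coupling M Z K Q N \<and> N0 \<subseteq> N \<and> closed N \<and>
    (\<forall>i x y. (x, y) \<in> N \<longrightarrow> (Z i x, Q i y) \<in> N)"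
proof -
  obtain N where N: "coupling M Z K Q N" and sub: "N0 \<subseteq> N"
    and max: "\<forall>N'. coupling M Z K Q N' \<longrightarrow> N \<subseteq> N' \<longrightarrow> N' = N"
    using ex_maximal_coupling[OF N0] by blast
  note ND = couplingD[OF N]
  have level_matched: "cinner x (level M Z m x') = cinner y (level K Q m y')"
    if "(x, y) \<in> N" "(x', y') \<in> N" for m x y x' y'
    using that
  proof (induction m arbitrary: x y x' y')
    case 0
    then show ?case
      using ND(4)[OF 0] ND(9)[OF 0(2)] ND(10)[OF 0(2)] by (simp add: orth_proj_id[OF M] orth_proj_id[OF K])
  next
    case (Suc m)
    then show ?case
      using Suc.IH[OF ND(5)[OF Suc.prems(1)] ND(5)[OF Suc.prems(2)]]
      by (simp add: level.simps(2) cinner_sum_right flip: cinner_cadjoint_left[OF Z_clinear]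
          cinner_cadjoint_left[OF Q_clinear])
  qed
  have level: "(x, y) \<in> N \<longrightarrow> (level M Z m x, level K Q m y) \<in> N" for m x y
  proof (induction m arbitrary: x y)
    case 0
    then show ?case using ND(9,10) orth_proj_id[OF M] orth_proj_id[OF K] by auto
  next
    case (Suc m)
    have "closed N \<and> (\<forall>x y. (x, y) \<in> N \<longrightarrow> (level M Z (Suc m) x, level K Q (Suc m) y) \<in> N)"
    proof (rule maximal_coupling_invariant[OF N max])
      note clin = level_clinear[OF M Z_tuple, of "Suc m"] level_clinear[OF K Q_tuple, of "Suc m"]
      show "bounded_clinear (level M Z (Suc m))" "bounded_clinear (level K Q (Suc m))" by (fact clin)+
      show "level M Z (Suc m) x \<in> M" for x by (rule level_mem[OF M Z_tuple])
      show "level K Q (Suc m) y \<in> K" for y by (rule level_mem[OF K Q_tuple])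
      fix x y x' y' assume *: "(x, y) \<in> N" "(x', y') \<in> N"
      show "cinner x (level M Z (Suc m) x') = cinner y (level K Q (Suc m) y')"
        by (rule level_matched[OF *])
      show "cinner (level M Z (Suc m) x) (level M Z (Suc m) x') =
          cinner (level K Q (Suc m) y) (level K Q (Suc m) y')"
        using level_matched[OF *, of "Suc m"] ND(9)[OF *(1)] ND(9)[OF *(2)] ND(10)[OF *(1)] ND(10)[OF *(2)]
        by (simp add: cinner_level_left[OF M Z_tuple] cinner_level_left[OF K Q_tuple]
            level_mem[OF M Z_tuple] level_mem[OF K Q_tuple] fock_relationsD(4)[OF Z] fock_relationsD(4)[OF Q])
    next
      fix i x y assume *: "(x, y) \<in> N"
      have "((Z i)\<^sup>\<star> (level M Z (Suc m) x), (Q i)\<^sup>\<star> (level K Q (Suc m) y)) \<in> N"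
        unfolding fock_relationsD(3)[OF Z ND(9)[OF *]] fock_relationsD(3)[OF Q ND(10)[OF *]]
        using Suc.IH ND(5)[OF *] by blast
      then show "((Z i)\<^sup>\<star> (level M Z (Suc m) x), (Q i)\<^sup>\<star> (level K Q (Suc m) y)) \<in>
          closure (extension (level M Z (Suc m)) (level K Q (Suc m)) N)"
        using subset_extension[OF N level_clinear[OF M Z_tuple] level_clinear[OF K Q_tuple]] by blast
    qed
    then show ?case by blast
  qed
  have inv: "(inv_number M Z n x, inv_number K Q n y) \<in> N" if "(x, y) \<in> N" for n x y
    unfolding inv_number_def
    by (intro coupling_sum[OF N] ND(8) ND(7)) (use level that in blast)+
  have "closed N \<and> (\<forall>x y. (x, y) \<in> N \<longrightarrow> (Z j x, Q j y) \<in> N)" for j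
  proof -
    have one: "cinner x (Z j x') = cinner y (Q j y')" if "(x, y) \<in> N" "(x', y') \<in> N" for x y x' y'
      using ND(4)[OF ND(5)[OF that(1)] that(2)]
      by (simp add: cinner_cadjoint_left[OF Z_clinear] cinner_cadjoint_left[OF Q_clinear])
    \<comment> \<open>The approximations of the adjoint of \<open>B i\<close> on \<open>B j x\<close> given by the relations.\<close>
    let ?E = "\<lambda>M B i x n. q i j *\<^sub>C B j ((B i)\<^sup>\<star> (x - inv_number M B n x)) +
      (if i = j then inv_number M B n x else 0)"
    have two: "cinner (Z j x) (Z j x') = cinner (Q j y) (Q j y')"
      if *: "(x, y) \<in> N" "(x', y') \<in> N" for x y x' y'
    proof -
      have lim_Z: "(\<lambda>n. cinner x (?E M Z j x' n)) \<longlonglongrightarrow> cinner x ((Z j)\<^sup>\<star> (Z j x'))"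
        by (rule tendsto_cinner_right[OF fock_relations_tendsto[OF Z ND(9)[OF *(2)]]])
      have lim_Q: "(\<lambda>n. cinner y (?E K Q j y' n)) \<longlonglongrightarrow> cinner y ((Q j)\<^sup>\<star> (Q j y'))"
        by (rule tendsto_cinner_right[OF fock_relations_tendsto[OF Q ND(10)[OF *(2)]]])
      have "cinner x (?E M Z j x' n) = cinner y (?E K Q j y' n)" for n
        using ND(4)[OF *(1) inv[OF *(2), of n]] one[OF *(1) ND(5)[OF ND(7)[OF *(2) inv[OF *(2), of n]]]]
        by (simp add: cinner_add_right cinner_scaleC_right)
      then have "cinner x ((Z j)\<^sup>\<star> (Z j x')) = cinner y ((Q j)\<^sup>\<star> (Q j y'))"
        using LIMSEQ_unique[OF lim_Z] lim_Q by simp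
      then show ?thesis
        by (simp add: cinner_cadjoint_right[OF Z_clinear] cinner_cadjoint_right[OF Q_clinear])
    qed
    have adj: "((Z i)\<^sup>\<star> (Z j x), (Q i)\<^sup>\<star> (Q j y)) \<in> closure (extension (Z j) (Q j) N)"
      if *: "(x, y) \<in> N" for i x y
    proof -
      have "(?E M Z i x n, ?E K Q i y n) \<in> extension (Z j) (Q j) N" for n
      proof -
        let ?a = "if i = j then inv_number M Z n x else 0" and ?b = "if i = j then inv_number K Q n y else 0"
        let ?u = "q i j *\<^sub>C (Z i)\<^sup>\<star> (x - inv_number M Z n x)" and ?v = "q i j *\<^sub>C (Q i)\<^sup>\<star> (y - inv_number K Q n y)"
        have "(?a, ?b) \<in> N" using inv[OF *] ND(2) by simp
        moreover have "(?u, ?v) \<in> N" by (intro ND(8) ND(5) ND(7) inv *)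
        ultimately have "(?a + Z j ?u, ?b + Q j ?v) \<in> extension (Z j) (Q j) N"
          unfolding extension_def by blast
        then show ?thesis
          by (simp add: bounded_clinearD(4)[OF Z_clinear] bounded_clinearD(4)[OF Q_clinear] add.commute)
      qed
      moreover have "(\<lambda>n. (?E M Z i x n, ?E K Q i y n)) \<longlonglongrightarrow> ((Z i)\<^sup>\<star> (Z j x), (Q i)\<^sup>\<star> (Q j y))"
        by (intro tendsto_Pair fock_relations_tendsto[OF Z] fock_relations_tendsto[OF Q] ND(9,10)[OF *])
      ultimately show ?thesis by (rule closure_seqI)
    qed
    show ?thesis
      by (rule maximal_coupling_invariant[OF N max])
        (fact Z_clinear Q_clinear | rule op_tuple_mem[OF M Z_tuple] op_tuple_mem[OF K Q_tuple] |
          erule (1) one two | erule adj)+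
  qed
  then show ?thesis using N sub by blast
qed

end

section \<open>The two dilations\<close>

lemma word_op_Nil: "word_op M T [] = orth_proj M"
  and word_op_Cons: "word_op M T (i # \<alpha>) = T i \<circ> word_op M T \<alpha>"
  by (simp_all add: word_op_def)

lemma word_op_single: "closed_csubspace M \<Longrightarrow> op_tuple M T \<Longrightarrow> word_op M T [i] = T i"
  by (rule ext) (use bopsD(3)[of "T i" M] in \<open>simp add: word_op_Nil word_op_Cons op_tuple_def\<close>)

lemma q_commuting_adjoint:
  assumes T: "\<And>i. bounded_clinear (T i)" and comm: "q_commuting q T"
  shows "(T i)\<^sup>\<star> ((T j)\<^sup>\<star> x) = cnj (q i j) *\<^sub>C (T j)\<^sup>\<star> ((T i)\<^sup>\<star> x)"
proof (rule eqI_cinner)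
  fix z
  have eq: "T j (T i z) = q i j *\<^sub>C T i (T j z)" using comm unfolding q_commuting_def by blast
  show "cinner z ((T i)\<^sup>\<star> ((T j)\<^sup>\<star> x)) = cinner z (cnj (q i j) *\<^sub>C (T j)\<^sup>\<star> ((T i)\<^sup>\<star> x))"
    unfolding cinner_cadjoint_right[OF T] cinner_scaleC_right eq cinner_scaleC_left ..
qed

text \<open>The moments of \<open>T\<close> prescribed for \<open>\<phi>\<close> give \<open>\<parallel>(\<pi> S)\<^sup>\<star> h - T\<^sup>\<star> h\<parallel> = 0\<close>, after expanding the square.\<close>

lemma (in stinespring) adjoint_dilation:
  assumes T: "T \<in> bops H" and S: "S \<in> A" and first: "\<phi> S = T" and second: "\<phi> (S \<circ> S\<^sup>\<star>) = T \<circ> T\<^sup>\<star>"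
    and h: "h \<in> H"
  shows "(\<pi> S)\<^sup>\<star> h = T\<^sup>\<star> h"
proof -
  note T_clin = bopsD(1)[OF T H]
  have Th: "T\<^sup>\<star> h \<in> H" by (rule bopsD(2)[OF bops_cadjoint[OF H T] H])
  let ?t = "cinner (T\<^sup>\<star> h) (T\<^sup>\<star> h)"
  have SS: "S \<circ> S\<^sup>\<star> \<in> A" by (intro A_intros S)
  have "\<pi> (S \<circ> S\<^sup>\<star>) = \<pi> S \<circ> (\<pi> S)\<^sup>\<star>"
    unfolding \<pi>_comp[OF S AD(6)[OF S]] \<pi>_adj[OF S] ..
  then have 1: "cinner ((\<pi> S)\<^sup>\<star> h) ((\<pi> S)\<^sup>\<star> h) = ?t"
    using cinner_\<phi>[OF SS h h] by (simp add: second cinner_cadjoint_left[OF \<pi>_clin[OF S]]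
        cinner_cadjoint_left[OF T_clin])
  have 2: "cinner ((\<pi> S)\<^sup>\<star> h) (T\<^sup>\<star> h) = ?t"
    using cinner_\<phi>[OF S Th h] by (simp add: first cinner_cadjoint_left[OF \<pi>_clin[OF S]]
        cinner_cadjoint_left[OF T_clin])
  have 3: "cinner (T\<^sup>\<star> h) ((\<pi> S)\<^sup>\<star> h) = ?t"
    using 2 cinner_commute[of "T\<^sup>\<star> h" "(\<pi> S)\<^sup>\<star> h"] cinner_commute[of "T\<^sup>\<star> h" "T\<^sup>\<star> h"] by simp
  have "cinner ((\<pi> S)\<^sup>\<star> h - T\<^sup>\<star> h) ((\<pi> S)\<^sup>\<star> h - T\<^sup>\<star> h) = 0"
    unfolding cinner_diff_left cinner_diff_right 1 2 3 by simp
  then show ?thesis by (simp add: cinner_self_eq_0)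
qed

text \<open>The piece of a minimal dilation is minimal, because the compressions of the words in \<open>R\<close> are
  the words in \<open>Z\<close>.\<close>

lemma (in orthogonal_isometries) M_least:
  assumes dense: "closure (cspan {word_op L R \<alpha> h | \<alpha> h. h \<in> H}) = L"
    and N: "closed_csubspace N" "H \<subseteq> N" and inv: "\<And>i x. x \<in> N \<Longrightarrow> Z i x \<in> N" and HM: "H \<subseteq> M"
  shows "M \<subseteq> N"
proof
  fix x assume x: "x \<in> M"
  define V where "V = {x. P x \<in> N}"
  have V: "closed_csubspace V"
    unfolding V_def
  proof (rule closed_csubspaceI)
    fix X :: "nat \<Rightarrow> 'a" and x assume "\<And>n. X n \<in> {x. P x \<in> N}" "X \<longlonglongrightarrow> x"
    then have "\<And>n. P (X n) \<in> N" "(\<lambda>n. P (X n)) \<longlonglongrightarrow> P x" using Plin(6) by blast+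
    then have "P x \<in> N" by (rule closed_csubspaceD(6)[OF N(1)])
    then show "x \<in> {x. P x \<in> N}" by simp
  qed (simp_all add: Plin closed_csubspaceD(1-3)[OF N(1)])
  have "P (word_op L R \<alpha> h) \<in> N" if h: "h \<in> H" for \<alpha> h
  proof (induction \<alpha>)
    case Nil
    have "h \<in> M" using h HM by blast
    then show ?case using h N(2) by (auto simp: word_op_Nil orth_proj_id[OF L M_sub] orth_proj_id[OF M])
  next
    case (Cons i \<alpha>)
    then show ?case by (simp add: word_op_Cons proj_R inv)
  qed
  then have "{word_op L R \<alpha> h | \<alpha> h. h \<in> H} \<subseteq> V" by (auto simp: V_def)
  then have "closure (cspan {word_op L R \<alpha> h | \<alpha> h. h \<in> H}) \<subseteq> V"
    using V by (intro closure_minimal complex_vector.span_minimal) (simp_all add: closed_csubspace_def)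
  then have "L \<subseteq> V" by (simp only: dense)
  then have "x \<in> V" using M_sub[OF x] by blast
  then show "x \<in> N" by (simp add: V_def orth_proj_id[OF M x])
qed

text \<open>A closed coupling with full domain and range is the graph of a unitary.\<close>

lemma unitary_of_coupling:
  assumes N: "coupling M Z K Q N" and dom: "Domain N = M" and ran: "Range N = K"
    and inv: "\<And>i x y. (x, y) \<in> N \<Longrightarrow> (Z i x, Q i y) \<in> N"
    and H: "\<And>h. h \<in> H \<Longrightarrow> (h, h) \<in> N"
  shows "\<exists>U. unitary_between M K U \<and> (\<forall>h\<in>H. U h = h) \<and> (\<forall>i. \<forall>x\<in>M. U (Z i x) = Q i (U x))"
proof -
  note ND = couplingD[OF N]
  have unique: "y = y'" if "(x, y) \<in> N" "(x, y') \<in> N" for x y y'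
    using coupling_norm[OF N ND(7)[OF that]] by simp
  define U where "U x = (THE y. (x, y) \<in> N)" for x
  have U: "U x = y" if "(x, y) \<in> N" for x y
    unfolding U_def using that unique by blast
  have graph: "(x, U x) \<in> N" if "x \<in> M" for x
    using that U dom by blast
  have "U ` M = K"
  proof
    show "U ` M \<subseteq> K" using graph ran by blast
    show "K \<subseteq> U ` M"
    proof
      fix y assume "y \<in> K"
      then obtain x where "(x, y) \<in> N" using ran by blast
      then show "y \<in> U ` M" using U dom by blast
    qed
  qed
  moreover have "U (x + y) = U x + U y" "cinner (U x) (U y) = cinner x y" if "x \<in> M" "y \<in> M" for x y
    using U[OF ND(6)[OF graph[OF that(1)] graph[OF that(2)]]]
      ND(4)[OF graph[OF that(1)] graph[OF that(2)]] by simp_all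
  moreover have "U (c *\<^sub>C x) = c *\<^sub>C U x" if "x \<in> M" for c x
    using U[OF ND(8)[OF graph[OF that]]] .
  ultimately have "unitary_between M K U" by (simp add: unitary_between_def)
  moreover have "U (Z i x) = Q i (U x)" if "x \<in> M" for i x
    using U[OF inv[OF graph[OF that]]] .
  moreover have "U h = h" if "h \<in> H" for h using U[OF H[OF that]] .
  ultimately show ?thesis by blast
qed

theorem theorem19:
  fixes q :: "'n::finite \<Rightarrow> 'n \<Rightarrow> complex"
    and H L K :: "'a::complex_hilbert_space set"
    and T R Q :: "'n \<Rightarrow> 'a \<Rightarrow> 'a"
  assumes "CARD('n) \<ge> 2"
    and "q_coefficients q"
    and "separable_hilbert H"
    and "op_tuple H T"
    and "contractive H T"
    and "q_commuting q T"
    and "standard_noncommuting_dilation H T L R"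
    and "standard_q_dilation q H T K Q"
  shows "is_realization H (max_q_space q L R) (max_q_piece q L R) K Q"
proof -
  note q = \<open>q_coefficients q\<close> and T = \<open>op_tuple H T\<close>
  have H: "closed_csubspace H" using assms(3) by (simp add: separable_hilbert_def)
  have T_clin: "bounded_clinear (T i)" and Ts_mem: "(T i)\<^sup>\<star> h \<in> H" for i h
    using op_tuple_clinear[OF H T] adjoint_mem[OF H T] by auto
  note std = assms(7)[unfolded standard_noncommuting_dilation_def minimal_dilation_def]
  have dil: "is_dilation H T L R" using std by (elim conjE)
  have dense: "closure (cspan {word_op L R \<alpha> h | \<alpha> h. h \<in> H}) = L" using std by (elim conjE)
  have isom: "\<forall>i. \<forall>x\<in>L. norm (R i x) = norm x" using std by (elim conjE)
  have orth: "\<forall>i j. i \<noteq> j \<longrightarrow> (\<forall>x\<in>L. \<forall>y\<in>L. cinner (R i x) (R j y) = 0)"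
    using std by (elim conjE)
  have L: "closed_csubspace L" and HL: "H \<subseteq> L" and R: "op_tuple L R"
    and Rs: "h \<in> H \<Longrightarrow> (R i)\<^sup>\<star> h = (T i)\<^sup>\<star> h" for i h
    using dil unfolding is_dilation_def separable_hilbert_def by blast+
  interpret orthogonal_isometries q L R
    by unfold_locales (use q L R isom orth in auto)
  have HM: "H \<subseteq> M"
  proof (rule max_q_space_coinduct[OF L R HL])
    fix h i j assume h: "h \<in> H"
    show "(R i)\<^sup>\<star> h \<in> H" unfolding Rs[OF h] by (rule Ts_mem)
    show "(R i)\<^sup>\<star> ((R j)\<^sup>\<star> h) = cnj (q i j) *\<^sub>C (R j)\<^sup>\<star> ((R i)\<^sup>\<star> h)"
      unfolding Rs[OF h] Rs[OF Ts_mem] by (rule q_commuting_adjoint[OF T_clin assms(6)])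
  qed
  let ?F = "q_fock q" and ?S = "q_creation q" and ?A = "q_cstar q"
  have S: "fock_relations q ?F ?S" by (rule fock_relations_q_creation[OF q])
  note F = fock_relationsD(1)[OF S] and S_tuple = fock_relationsD(2)[OF S]
  have A: "unital_cstar_subalgebra ?F ?A"
    unfolding q_cstar_def using S_tuple
    by (intro unital_cstar_subalgebra_generated F) (auto simp: op_tuple_def)
  have SA: "?S i \<in> ?A" for i
    using range_subset_generated_cstar[of ?S ?F] by (auto simp: q_cstar_def)
  obtain \<phi> \<pi> where ucp: "unital_completely_positive ?F ?A H \<phi>"
    and moments: "\<And>\<alpha> \<beta>. \<phi> (word_op ?F ?S \<alpha> \<circ> (word_op ?F ?S \<beta>)\<^sup>\<star>) = word_op H T \<alpha> \<circ> (word_op H T \<beta>)\<^sup>\<star>"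
    and st: "minimal_stinespring ?F ?A H \<phi> K \<pi>" and Q: "\<And>i. Q i = \<pi> (?S i)"
    using assms(8) unfolding standard_q_dilation_def by blast
  interpret stinespring ?F ?A H K \<phi> \<pi>
    by unfold_locales (fact F H A ucp st)+
  have Q_eq: "Q = (\<lambda>i. \<pi> (?S i))" using Q by blast
  have Q_rel: "fock_relations q K Q"
    unfolding Q_eq by (rule fock_relations_\<pi>[OF SA S])
  have Qs: "(Q i)\<^sup>\<star> h = (T i)\<^sup>\<star> h" if h: "h \<in> H" for i h
    unfolding Q
  proof (rule adjoint_dilation[OF _ SA _ _ h])
    show "T i \<in> bops H" using T by (simp add: op_tuple_def)
    show "\<phi> (?S i) = T i"
    proof -
      have "?S i \<circ> orth_proj ?F = ?S i" "T i \<circ> orth_proj H = T i"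
        using word_op_single[OF F S_tuple, of i] word_op_single[OF H T, of i]
        by (simp_all add: word_op_Nil word_op_Cons)
      then show ?thesis
        using moments[of "[i]" "[]"]
        by (simp add: word_op_single[OF F S_tuple] word_op_single[OF H T] word_op_Nil
            cadjoint_orth_proj[OF F] cadjoint_orth_proj[OF H])
    qed
    show "\<phi> (?S i \<circ> (?S i)\<^sup>\<star>) = T i \<circ> (T i)\<^sup>\<star>"
      using moments[of "[i]" "[i]"] by (simp add: word_op_single[OF F S_tuple] word_op_single[OF H T])
  qed
  have "coupling M Z K Q {(h, h) | h. h \<in> H}"
    unfolding coupling_def
  proof (intro conjI allI impI)
    show "{(h, h) | h. h \<in> H} \<subseteq> M \<times> K" using HM H_sub by blast
    fix i x y assume "(x, y) \<in> {(h, h) | h. h \<in> H}"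
    then have xy: "x = y" "y \<in> H" by auto
    have "(Z i)\<^sup>\<star> y = (T i)\<^sup>\<star> y" by (rule trans[OF Zs_eq[OF subsetD[OF HM xy(2)]] Rs[OF xy(2)]])
    then show "((Z i)\<^sup>\<star> x, (Q i)\<^sup>\<star> y) \<in> {(h, h) | h. h \<in> H}"
      using Qs Ts_mem xy by simp
  qed (auto simp: closed_csubspaceD(1-3)[OF H])
  from ex_creation_invariant_coupling[OF fock_relations_piece Q_rel this]
  obtain N where N: "coupling M Z K Q N" and sub: "{(h, h) | h. h \<in> H} \<subseteq> N" and cl: "closed N"
    and "\<forall>i x y. (x, y) \<in> N \<longrightarrow> (Z i x, Q i y) \<in> N"
    by (elim exE conjE) (rule that)
  then have inv: "(x, y) \<in> N \<Longrightarrow> (Z i x, Q i y) \<in> N" for i x y by blast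
  note ND = couplingD[OF N]
  have dom: "Domain N = M"
  proof
    show "Domain N \<subseteq> M" using ND(1) by blast
    show "M \<subseteq> Domain N"
      by (rule M_least[OF dense closed_csubspace_Domain_coupling[OF N cl] _ _ HM])
        (use sub inv in blast)+
  qed
  have ran: "Range N = K"
  proof (rule K_least[OF q_cstar_def])
    have "closed (N\<inverse>)"
    proof -
      have "N\<inverse> = (\<lambda>p. (snd p, fst p)) -` N" by auto
      moreover have "closed ((\<lambda>p::'a \<times> 'a. (snd p, fst p)) -` N)"
        by (rule closed_vimage[OF cl]) (intro continuous_intros)
      ultimately show ?thesis by simp
    qed
    then show "closed_csubspace (Range N)"
      using closed_csubspace_Domain_coupling[OF coupling_converse[OF N]] by simp
    show "H \<subseteq> Range N" using sub by blast
    show "Range N \<subseteq> K" using ND(1) by blast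
    show "\<pi> (?S i) y \<in> Range N" "(\<pi> (?S i))\<^sup>\<star> y \<in> Range N" if "y \<in> Range N" for i y
      using that inv ND(5) unfolding Q[symmetric] by blast+
  qed
  have "(h, h) \<in> N" if "h \<in> H" for h using sub that by blast
  with unitary_of_coupling[OF N dom ran inv, of H] show ?thesis
    unfolding is_realization_def using HM H_sub by blast
qed

end
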